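(* Let $N\ge3$, $\Omega\subset\mathbb{R}^N$ a bounded domain, $1<p<2$, and suppose $Q$, $v$ satisfy hypothesis (H) and the Sobolev hypothesis (S) with constants $M_p>0$, $\sigma>1$. Let $\sigma'=\sigma/(\sigma-1)$, $q_c=\sigma'(2-p)$ and $m=\max\{2,q_c\}$. Given $u_0\in L^m_v(\Omega)$, let $u$ be the weak solution of $$\partial_t u - v^{-1}\operatorname{div}\big(|\sqrt{Q}\nabla u|^{p-2}Q\nabla u\big)=0 \text{ in } \Omega\times[0,T],\qquad u(0)=u_0,$$ on $[0,T]$ for all $T>0$. Then there exists a finite time $T_0\in(0,\infty)$ such that $u(t,\cdot)=0$ a.e. in $\Omega$ for all $t\ge T_0$.
   Context: $p'=p/(p-1)$. $Q:\Omega\to\mathbb{R}^{N\times N}$ is measurable, symmetric and positive definite a.e., with $|Q|_{\rm op}\in L^1_{loc}(\Omega)$ ($|\cdot|_{\rm op}$ the operator norm; $\sqrt Q$ defined pointwise). $v\ge0$ is a measurable weight. Hypothesis (H): $v\in L^1(\Omega)$; $|\sqrt Q(x)|_{\rm op}^p\le v(x)$ a.e.; $|(\sqrt Q)^{-1}|_{\rm op}\in L^{p'}_{loc}(\Omega)$. $dv=v\,dx$, $L^q_v(\Omega)$ is $L^q$ w.r.t. $v\,dx$. $\mathcal L^p_Q(\Omega)$: vector fields with $\|\vec f\|_{\mathcal L^p_Q}=(\int_\Omega|\sqrt Q\vec f|^pdx)^{1/p}<\infty$. $H^{1,p}_Q(\Omega)$: completion of Lipschitz functions on $\overline\Omega$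 under $\|u\|_{L^p_v}+\|\nabla u\|_{\mathcal L^p_Q}$ (elements are functions in $L^p_v\cap W^{1,1}_{loc}$ with $\nabla u\in\mathcal L^p_Q$); $\mathring H^{1,p}_Q(\Omega)$: closure of $C^{0,1}_c(\Omega)$ in it. Hypothesis (S): $\|u\|_{L^{\sigma p}_v}\le M_p\|\sqrt Q\nabla u\|_{L^p(\Omega)}$ for all $u\in\mathring H^{1,p}_Q(\Omega)$. Weak solution on $[0,T]$: measurable $u$ on $\Omega\times[0,T]$ with $u\in W^{1,2}_{loc}((0,T);L^2_v)\cap C([0,T];L^2_v)$, $u(t)\in\mathring H^{1,p}_Q(\Omega)$ for a.e. $t$, $\nabla u\in L^p((0,T);\mathcal L^p_Q)$, $u(t)\to u_0$ in $L^2_v$ as $t\to0$, and for all $\phi\in C^\infty([0,T];C^{0,1}_c(\Omega))$: $\int_0^T\int_\Omega|\sqrt Q\nabla u|^{p-2}Q\nabla u\cdot\nabla\phi\,dx\,dt=\int_0^T\int_\Omega u\partial_t\phi\,dv\,dt+\int_\Omega u_0\phi(0)\,dv-\int_\Omega u(T)\phi(T)\,dv$. *)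

theory Defs
  imports "HOL-Analysis.Analysis"
begin

definition msqrt :: "real^'n^'n \<Rightarrow> real^'n^'n" where
  "msqrt A = (THE S. transpose S = S \<and> (\<forall>\<xi>. 0 \<le> \<xi> \<bullet> (S *v \<xi>)) \<and> S ** S = A)"

definition opnorm :: "real^'n^'n \<Rightarrow> real" where
  "opnorm A = onorm (\<lambda>\<xi>. A *v \<xi>)"

definition loc_integrable ::
  "(real^'n) set \<Rightarrow> (real^'n \<Rightarrow> 'b::{banach,second_countable_topology}) \<Rightarrow> bool" where
  "loc_integrable \<Omega> f \<longleftrightarrow> (\<forall>K. compact K \<and> K \<subseteq> \<Omega> \<longrightarrow> integrable (lebesgue_on K) f)"

definition csupp_in :: "(real^'n) set \<Rightarrow> (real^'n \<Rightarrow> real) \<Rightarrow> bool" where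
  "csupp_in \<Omega> f \<longleftrightarrow> (\<exists>K. compact K \<and> K \<subseteq> \<Omega> \<and> (\<forall>x. x \<notin> K \<longrightarrow> f x = 0))"

definition lipc :: "(real^'n) set \<Rightarrow> (real^'n \<Rightarrow> real) \<Rightarrow> bool" where
  "lipc \<Omega> f \<longleftrightarrow> (\<exists>L. L-lipschitz_on UNIV f) \<and> csupp_in \<Omega> f"

text \<open>Pointwise gradient (exists a.e. for Lipschitz functions, by Rademacher).\<close>
definition grad :: "(real^'n \<Rightarrow> real) \<Rightarrow> real^'n \<Rightarrow> real^'n" where
  "grad f x = (SOME g. (f has_derivative (\<lambda>h. g \<bullet> h)) (at x))"

definition C1c_test :: "(real^'n) set \<Rightarrow> (real^'n \<Rightarrow> real) \<Rightarrow> (real^'n \<Rightarrow> real^'n) \<Rightarrow> bool" where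
  "C1c_test \<Omega> \<phi> d\<phi> \<longleftrightarrow> (\<forall>x. (\<phi> has_derivative (\<lambda>h. d\<phi> x \<bullet> h)) (at x)) \<and>
     continuous_on UNIV d\<phi> \<and> csupp_in \<Omega> \<phi>"

definition weak_gradient :: "(real^'n) set \<Rightarrow> (real^'n \<Rightarrow> real) \<Rightarrow> (real^'n \<Rightarrow> real^'n) \<Rightarrow> bool" where
  "weak_gradient \<Omega> u g \<longleftrightarrow> loc_integrable \<Omega> u \<and> loc_integrable \<Omega> g \<and>
     (\<forall>\<phi> d\<phi>. C1c_test \<Omega> \<phi> d\<phi> \<longrightarrow>
        (\<integral>x. u x *\<^sub>R d\<phi> x \<partial>lebesgue_on \<Omega>) = - (\<integral>x. \<phi> x *\<^sub>R g x \<partial>lebesgue_on \<Omega>))"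

text \<open>The space \<open>H^{1,p}_Q\<close> closure of C^{0,1}_c(\<Omega>), represented by pairs (u, \<nabla>u):
  u \<in> L^p_v \<inter> W^{1,1}_loc with weak gradient g, \<nabla>u \<in> \<L>^p_Q, and (u,g) is the limit
  of (\<phi>_k, \<nabla>\<phi>_k) with \<phi>_k \<in> C^{0,1}_c(\<Omega>) in the norm \<open>\<parallel>u\<parallel>_{L^p_v} + \<parallel>\<nabla>u\<parallel>_{\<L>^p_Q}\<close>.\<close>
definition H0 :: "(real^'n) set \<Rightarrow> (real^'n \<Rightarrow> real^'n^'n) \<Rightarrow> (real^'n \<Rightarrow> real) \<Rightarrow> real \<Rightarrow>
    ((real^'n \<Rightarrow> real) \<times> (real^'n \<Rightarrow> real^'n)) set" where
  "H0 \<Omega> Q v p = {(u, g).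
     u \<in> borel_measurable (lebesgue_on \<Omega>) \<and> g \<in> borel_measurable (lebesgue_on \<Omega>) \<and>
     (\<integral>\<^sup>+ x. ennreal (\<bar>u x\<bar> powr p * v x) \<partial>lebesgue_on \<Omega>) < \<infinity> \<and>
     (\<integral>\<^sup>+ x. ennreal (norm (msqrt (Q x) *v g x) powr p) \<partial>lebesgue_on \<Omega>) < \<infinity> \<and>
     weak_gradient \<Omega> u g \<and>
     (\<exists>\<phi> :: nat \<Rightarrow> real^'n \<Rightarrow> real. (\<forall>k. lipc \<Omega> (\<phi> k)) \<and>
        (\<lambda>k. \<integral>\<^sup>+ x. ennreal (\<bar>\<phi> k x - u x\<bar> powr p * v x) \<partial>lebesgue_on \<Omega>) \<longlonglongrightarrow> 0 \<and>
        (\<lambda>k. \<integral>\<^sup>+ x. ennreal (norm (msqrt (Q x) *v (grad (\<phi> k) x - g x)) powr p) \<partial>lebesgue_on \<Omega>)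
           \<longlonglongrightarrow> 0)}"

definition hyp_H :: "(real^'n) set \<Rightarrow> (real^'n \<Rightarrow> real^'n^'n) \<Rightarrow> (real^'n \<Rightarrow> real) \<Rightarrow> real \<Rightarrow> bool" where
  "hyp_H \<Omega> Q v p \<longleftrightarrow>
     Q \<in> borel_measurable (lebesgue_on \<Omega>) \<and>
     (AE x in lebesgue_on \<Omega>. transpose (Q x) = Q x \<and> (\<forall>\<xi>. \<xi> \<noteq> 0 \<longrightarrow> 0 < \<xi> \<bullet> (Q x *v \<xi>))) \<and>
     loc_integrable \<Omega> (\<lambda>x. opnorm (Q x)) \<and>
     v \<in> borel_measurable (lebesgue_on \<Omega>) \<and> (\<forall>x\<in>\<Omega>. 0 \<le> v x) \<and>
     integrable (lebesgue_on \<Omega>) v \<and>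
     (AE x in lebesgue_on \<Omega>. opnorm (msqrt (Q x)) powr p \<le> v x) \<and>
     loc_integrable \<Omega> (\<lambda>x. opnorm (matrix_inv (msqrt (Q x))) powr (p / (p - 1)))"

text \<open>Sobolev hypothesis (S), both sides raised to the power \<sigma> p.\<close>
definition hyp_S :: "(real^'n) set \<Rightarrow> (real^'n \<Rightarrow> real^'n^'n) \<Rightarrow> (real^'n \<Rightarrow> real) \<Rightarrow> real \<Rightarrow>
    real \<Rightarrow> real \<Rightarrow> bool" where
  "hyp_S \<Omega> Q v p \<sigma> M \<longleftrightarrow> (\<forall>(u, g) \<in> H0 \<Omega> Q v p.
     (\<integral>\<^sup>+ x. ennreal (\<bar>u x\<bar> powr (\<sigma> * p) * v x) \<partial>lebesgue_on \<Omega>) \<le>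
     ennreal ((M * (enn2real (\<integral>\<^sup>+ x. ennreal (norm (msqrt (Q x) *v g x) powr p) \<partial>lebesgue_on \<Omega>))
                   powr (1 / p)) powr (\<sigma> * p)))"

definition lip_norm :: "(real^'n \<Rightarrow> real) \<Rightarrow> real" where
  "lip_norm f = (SUP x. \<bar>f x\<bar>) + (SUP (x, y) \<in> {(x, y). x \<noteq> y}. \<bar>f x - f y\<bar> / dist x y)"

text \<open>Test functions C^\<infinity>([0,T]; C^{0,1}_c(\<Omega>)): all time derivatives D k exist (in the
  Lipschitz norm), take values in Lipschitz functions supported in a fixed compact K \<subseteq> \<Omega>.\<close>
definition test_fun :: "(real^'n) set \<Rightarrow> real \<Rightarrow> (real \<Rightarrow> real^'n \<Rightarrow> real) \<Rightarrow> bool" where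
  "test_fun \<Omega> T \<phi> \<longleftrightarrow> (\<exists>K. compact K \<and> K \<subseteq> \<Omega> \<and>
     (\<exists>D :: nat \<Rightarrow> real \<Rightarrow> real^'n \<Rightarrow> real. D 0 = \<phi> \<and>
       (\<forall>k. \<forall>t\<in>{0..T}.
          (\<forall>x. x \<notin> K \<longrightarrow> D k t x = 0) \<and> (\<exists>L. L-lipschitz_on UNIV (D k t)) \<and>
          ((\<lambda>s. lip_norm (\<lambda>x. (D k s x - D k t x) / (s - t) - D (Suc k) t x)) \<longlongrightarrow> 0)
             (at t within {0..T}))))"

text \<open>u \<in> W^{1,2}_loc((0,T); L^2_v(\<Omega>)), with the time derivative tested against
  scalar C^1_c(0,T) functions and elements of L^2_v.\<close>
definition W12loc :: "(real^'n) set \<Rightarrow> (real^'n \<Rightarrow> real) \<Rightarrow> real \<Rightarrow> (real \<Rightarrow> real^'n \<Rightarrow> real) \<Rightarrow> bool" where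
  "W12loc \<Omega> v T u \<longleftrightarrow> (\<exists>u' :: real \<Rightarrow> real^'n \<Rightarrow> real.
     (\<lambda>(t, x). u' t x) \<in> borel_measurable (lebesgue_on ({0<..<T} \<times> \<Omega>)) \<and>
     (\<forall>a b. 0 < a \<and> a < b \<and> b < T \<longrightarrow>
        (\<integral>\<^sup>+ t. (\<integral>\<^sup>+ x. ennreal ((u t x)\<^sup>2 * v x) \<partial>lebesgue_on \<Omega>) \<partial>lebesgue_on {a..b}) < \<infinity> \<and>
        (\<integral>\<^sup>+ t. (\<integral>\<^sup>+ x. ennreal ((u' t x)\<^sup>2 * v x) \<partial>lebesgue_on \<Omega>) \<partial>lebesgue_on {a..b}) < \<infinity>) \<and>
     (\<forall>\<psi> :: real \<Rightarrow> real. \<forall>w :: real^'n \<Rightarrow> real.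
        (\<forall>t. (\<psi> has_real_derivative deriv \<psi> t) (at t)) \<and> continuous_on UNIV (deriv \<psi>) \<and>
        (\<exists>a b. 0 < a \<and> a < b \<and> b < T \<and> (\<forall>t. t \<notin> {a..b} \<longrightarrow> \<psi> t = 0)) \<and>
        w \<in> borel_measurable (lebesgue_on \<Omega>) \<and>
        (\<integral>\<^sup>+ x. ennreal ((w x)\<^sup>2 * v x) \<partial>lebesgue_on \<Omega>) < \<infinity> \<longrightarrow>
        (\<integral>t. deriv \<psi> t * (\<integral>x. u t x * w x * v x \<partial>lebesgue_on \<Omega>) \<partial>lebesgue_on {0<..<T}) =
        - (\<integral>t. \<psi> t * (\<integral>x. u' t x * w x * v x \<partial>lebesgue_on \<Omega>) \<partial>lebesgue_on {0<..<T})))"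

definition weak_solution ::
  "(real^'n) set \<Rightarrow> (real^'n \<Rightarrow> real^'n^'n) \<Rightarrow> (real^'n \<Rightarrow> real) \<Rightarrow> real \<Rightarrow>
   (real^'n \<Rightarrow> real) \<Rightarrow> real \<Rightarrow> (real \<Rightarrow> real^'n \<Rightarrow> real) \<Rightarrow> (real \<Rightarrow> real^'n \<Rightarrow> real^'n) \<Rightarrow> bool" where
  "weak_solution \<Omega> Q v p u0 T u G \<longleftrightarrow>
     (\<lambda>(t, x). u t x) \<in> borel_measurable (lebesgue_on ({0..T} \<times> \<Omega>)) \<and>
     W12loc \<Omega> v T u \<and>
     (\<forall>t\<in>{0..T}. u t \<in> borel_measurable (lebesgue_on \<Omega>) \<and>
        (\<integral>\<^sup>+ x. ennreal ((u t x)\<^sup>2 * v x) \<partial>lebesgue_on \<Omega>) < \<infinity> \<and>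
        ((\<lambda>s. \<integral>\<^sup>+ x. ennreal ((u s x - u t x)\<^sup>2 * v x) \<partial>lebesgue_on \<Omega>) \<longlongrightarrow> 0)
          (at t within {0..T})) \<and>
     (AE t in lebesgue_on {0..T}. (u t, G t) \<in> H0 \<Omega> Q v p) \<and>
     (\<lambda>(t, x). G t x) \<in> borel_measurable (lebesgue_on ({0..T} \<times> \<Omega>)) \<and>
     (\<integral>\<^sup>+ t. (\<integral>\<^sup>+ x. ennreal (norm (msqrt (Q x) *v G t x) powr p) \<partial>lebesgue_on \<Omega>)
        \<partial>lebesgue_on {0..T}) < \<infinity> \<and>
     ((\<lambda>t. \<integral>\<^sup>+ x. ennreal ((u t x - u0 x)\<^sup>2 * v x) \<partial>lebesgue_on \<Omega>) \<longlongrightarrow> 0) (at_right 0) \<and>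
     (\<forall>\<phi>. test_fun \<Omega> T \<phi> \<longrightarrow>
        (\<integral>t. (\<integral>x. norm (msqrt (Q x) *v G t x) powr (p - 2) * ((Q x *v G t x) \<bullet> grad (\<phi> t) x)
               \<partial>lebesgue_on \<Omega>) \<partial>lebesgue_on {0..T})
        = (\<integral>t. (\<integral>x. u t x * vector_derivative (\<lambda>s. \<phi> s x) (at t within {0..T}) * v x
               \<partial>lebesgue_on \<Omega>) \<partial>lebesgue_on {0..T})
          + (\<integral>x. u0 x * \<phi> 0 x * v x \<partial>lebesgue_on \<Omega>)
          - (\<integral>x. u T x * \<phi> T x * v x \<partial>lebesgue_on \<Omega>))"

end

theory Submission
  imports Defs "HOL-Analysis.Analysis"
begin

text \<open>
  Testing the equation with an increasing function \<open>F(u)\<close> gives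
  \<open>E(b) + \<integral>\<^sub>a\<^sup>b \<integral> F'(u) |\<surd>Q \<nabla>u|\<^sup>p \<le> E(a)\<close>, where \<open>E(t) = \<integral> \<Phi>(u(t)) v\<close> and \<open>\<Phi>' = F\<close>. When \<open>\<Phi>\<close> is
  a truncation of the \<open>m\<close>-th power, the Sobolev hypothesis applied to \<open>H(u)\<close>, \<open>(H')\<^sup>p = F'\<close>, bounds the
  dissipation below, and in the limit \<open>E(b) + c (b - a) E(b)\<^sup>\<alpha> \<le> E(a)\<close> with \<open>\<alpha> = (m - 2 + p)/m < 1\<close>,
  which forces \<open>E\<close> to vanish in finite time.

  No time derivative of \<open>u\<close> is needed: test functions that are constant in time turn
  the weak formulation into a formula for \<open>u(t) - u(t - h)\<close>, convexity of \<open>\<Phi>\<close> bounds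
  \<open>E(t) - E(t - h)\<close> by the flux at times in \<open>(t - h, t]\<close> paired with \<open>\<nabla>F(u(t))\<close>, and
  continuity of translations in \<open>L\<^sup>1\<close> lets \<open>h\<close> tend to \<open>0\<close>. The chain rule for the
  approximating Lipschitz functions rests on Rademacher's theorem.
\<close>

section \<open>Translations in L1 and almost everywhere differentiability\<close>

text \<open>The exponents explain \<open>m\<close>. If \<open>\<Phi>\<close> is of size
  \<open>|s|^m\<close>, then \<open>H\<close> is of size \<open>|s|^((m-2+p)/p)\<close>, and the
  Sobolev inequality raised to the power \<open>\<sigma> p\<close> controls the integral of
  \<open>|u|^\<beta>\<close> with \<open>\<beta> = \<sigma>(m-2+p)\<close>. Since \<open>v\<close>
  has finite mass, this controls the \<open>m\<close>-th power as soon as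
  \<open>m \<le> \<beta>\<close>, which is \<open>m \<ge> q_c\<close> rearranged;
  \<open>m \<ge> 2\<close> keeps \<open>F'\<close> bounded near 0, and \<open>p < 2\<close> makes
  \<open>\<alpha> < 1\<close>. Truncation is forced: at positive times \<open>u(t)\<close> is only
  known to lie in \<open>L^2_v\<close>, so a test function \<open>F(u)\<close> needs bounded
  \<open>F\<close>, to be paired with \<open>u(t) - u(s)\<close>, and bounded \<open>F'\<close>, to
  keep its gradient in the energy space. The comparison constants stay independent of the cut-off
  level, which Fatou's lemma then sends to infinity. Rademacher's theorem enters because
  \<open>grad\<close> is chosen by \<open>SOME\<close> among pointwise derivatives: without
  differentiability almost everywhere nothing would relate the gradient of \<open>F(\<phi>)\<close>
  to that of \<open>\<phi>\<close>. Its proof also rests on continuity of translations, which makes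
  directional derivatives additive.\<close>

lemma nn_integral_lborel_shift:
  fixes f :: "'a::euclidean_space \<Rightarrow> ennreal"
  assumes [measurable]: "f \<in> borel_measurable borel"
  shows "(\<integral>\<^sup>+x. f (x + h) \<partial>lborel) = (\<integral>\<^sup>+x. f x \<partial>lborel)"
proof -
  have "(\<integral>\<^sup>+x. f x \<partial>lborel) = (\<integral>\<^sup>+x. f x \<partial>distr lborel borel ((+) h))"
    by (simp add: lborel_distr_plus)
  also have "\<dots> = (\<integral>\<^sup>+x. f (x + h) \<partial>lborel)"
    by (subst nn_integral_distr) (auto simp: add.commute)
  finally show ?thesis by simp
qed

text \<open>Regularity squeezes \<open>A\<close> between a compact \<open>K\<close> and an open
  \<open>U\<close> with little measure in between. A shift shorter than the distance from
  \<open>K\<close> to the complement of \<open>U\<close> keeps \<open>K\<close> inside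
  \<open>U\<close>, so \<open>A\<close> and its translate differ only on \<open>A - K\<close>,
  \<open>U - A\<close> and their translates; these four sets give the factor 4.\<close>

lemma indicator_translation_bound:
  fixes A :: "'a::euclidean_space set"
  assumes A: "A \<in> sets lborel" "emeasure lborel A < \<infinity>" and e: "0 < (e::real)"
  shows "\<exists>d>0. \<forall>h. norm h < d \<longrightarrow>
    (\<integral>\<^sup>+x. ennreal \<bar>indicator A (x + h) - indicator A x :: real\<bar> \<partial>lborel) \<le> ennreal (4 * e)"
proof -
  have A': "A \<in> sets borel" using A by simp
  obtain U where U: "open U" "A \<subseteq> U" "emeasure lborel (U - A) < ennreal e"
    using outer_regular_lborel[OF A' e] .
  obtain K where K: "compact K" "K \<subseteq> A" "emeasure lborel (A - K) < ennreal e"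
  proof (cases "emeasure lborel A < ennreal e")
    case True then show ?thesis using that[of "{}"] by simp
  next
    case False
    \<comment> \<open>Inner regularity is applied to the restriction of Lebesgue measure to
      \<open>A\<close>, which is a finite measure, and then read back for
      \<open>lborel\<close>.\<close>
    let ?M = "density lborel (indicator A)"
    have eM: "emeasure ?M B = emeasure lborel (A \<inter> B)" if "B \<in> sets borel" for B
      using that A' by (subst emeasure_density) (auto simp flip: indicator_inter_arith)
    have "emeasure ?M A = (SUP K \<in> {K. K \<subseteq> A \<and> compact K}. emeasure ?M K)"
      using A A' by (intro inner_regular) (auto simp: eM)
    moreover have "emeasure lborel A - ennreal e < emeasure lborel A"
      using A(2) e False by (intro ennreal_between) (auto simp: not_less intro: less_le_trans[of 0 "ennreal e"])
    ultimately obtain K where K: "K \<subseteq> A" "compact K" "emeasure lborel A - ennreal e < emeasure ?M K"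
      using A' by (auto simp: eM less_SUP_iff)
    have mK: "K \<in> sets borel" using K by (simp add: compact_imp_closed)
    have "emeasure ?M K = emeasure lborel K" using K mK by (simp add: eM Int_absorb1)
    then have lt: "emeasure lborel A < emeasure lborel K + ennreal e"
      using K(3) False by (simp add: minus_less_iff_ennreal not_less)
    have Kf: "emeasure lborel K < \<infinity>" using emeasure_compact_finite[OF K(2)] .
    have "emeasure lborel (A - K) = emeasure lborel A - emeasure lborel K"
      using K mK A Kf by (intro emeasure_Diff) auto
    also have "\<dots> < ennreal e" using lt Kf K(1) mK A'
      by (subst minus_less_iff_ennreal) (use emeasure_mono[OF K(1), of lborel] in \<open>auto simp: add.commute\<close>)
    finally show ?thesis using that K by blast
  qed
  then have K_le: "emeasure lborel (A - K) < ennreal e" by simp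
  have mU[measurable]: "U \<in> sets borel" "K \<in> sets borel" "A \<in> sets borel"
    using U(1) K(1) A' by (auto simp: compact_imp_closed)
  obtain d where d: "d > 0" "\<And>x y. x \<in> K \<Longrightarrow> dist x y < d \<Longrightarrow> y \<in> U"
  proof -
    have KU: "K \<subseteq> U" using K U by blast
    show ?thesis
    proof (cases "K = {} \<or> - U = {}")
      case True then show ?thesis using that[of 1] by (metis ComplI empty_iff zero_less_one)
    next
      case False
      have "\<exists>d>0. \<forall>x\<in>K. \<forall>y\<in>- U. d \<le> dist x y"
        by (rule separate_compact_closed) (use K U KU in auto)
      then show ?thesis using that by (metis ComplI not_le)
    qed
  qed
  have "(\<integral>\<^sup>+x. ennreal \<bar>indicator A (x + h) - indicator A x :: real\<bar> \<partial>lborel) \<le> ennreal (4 * e)"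
    if h: "norm h < d" for h
  proof -
    have out: "x + h \<in> A - K \<or> x \<in> U - A" if "x + h \<in> A" "x \<notin> A" for x
      using d(2)[of "x + h" x] that h by (auto simp: dist_norm)
    have inn: "x \<in> A - K \<or> x + h \<in> U - A" if "x \<in> A" "x + h \<notin> A" for x
      using d(2)[of x "x + h"] that h by (auto simp: dist_norm)
    have pw: "ennreal \<bar>indicator A (x + h) - indicator A x :: real\<bar> \<le>
        (indicator (A - K) (x + h) + indicator (U - A) x) + (indicator (A - K) x + indicator (U - A) (x + h))" for x
    proof -
      consider "x \<in> A \<longleftrightarrow> x + h \<in> A" | "x + h \<in> A" "x \<notin> A" | "x \<in> A" "x + h \<notin> A" by blast
      then show ?thesis
      proof cases
        case 1 then show ?thesis by (simp add: indicator_def)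
      next
        case 2
        from out[OF 2] show ?thesis
          by (rule disjE) (use 2 in \<open>simp_all add: indicator_def add_increasing add_increasing2\<close>)
      next
        case 3
        from inn[OF 3] show ?thesis
          by (rule disjE) (use 3 in \<open>simp_all add: indicator_def add_increasing add_increasing2\<close>)
      qed
    qed
    have "(\<integral>\<^sup>+x. ennreal \<bar>indicator A (x + h) - indicator A x :: real\<bar> \<partial>lborel) \<le>
      (\<integral>\<^sup>+x. (indicator (A - K) (x + h) + indicator (U - A) x) + (indicator (A - K) x + indicator (U - A) (x + h)) \<partial>lborel)"
      by (intro nn_integral_mono pw)
    also have "\<dots> = (emeasure lborel (A - K) + emeasure lborel (U - A)) + (emeasure lborel (A - K) + emeasure lborel (U - A))"
      by (simp add: nn_integral_add nn_integral_lborel_shift[of "indicator (A - K)"]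
         nn_integral_lborel_shift[of "indicator (U - A)"])
    also have "\<dots> \<le> (ennreal e + ennreal e) + (ennreal e + ennreal e)"
      using U(3) K_le by (intro add_mono) (auto simp: less_imp_le)
    also have "\<dots> = ennreal (4 * e)" using e by (simp flip: ennreal_plus)
    finally show ?thesis .
  qed
  then show ?thesis using d(1) by blast
qed

text \<open>Induction over integrable functions: multiples of indicators come from
  \<open>indicator_translation_bound\<close>, sums split the tolerance, and for a limit the shifted
  approximation error costs the same as the unshifted one because Lebesgue measure is translation
  invariant.\<close>

lemma L1_translation_continuous:
  fixes f :: "'a::euclidean_space \<Rightarrow> 'b::{banach,second_countable_topology}"
  assumes "integrable lborel f" "0 < (e::real)"
  shows "\<exists>d>0. \<forall>h. norm h < d \<longrightarrow> (\<integral>\<^sup>+x. ennreal (norm (f (x + h) - f x)) \<partial>lborel) \<le> ennreal e"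
  using assms
proof (induction arbitrary: e rule: integrable_induct)
  case (base A c)
  \<comment> \<open>The factor 4 cancels that of the indicator bound, and the \<open>+ 1\<close>
    allows \<open>c = 0\<close>.\<close>
  have "0 < e / (4 * (norm c + 1))" using base(3) by (auto intro!: divide_pos_pos mult_pos_pos add_nonneg_pos)
  from indicator_translation_bound[OF base(1,2) this]
  obtain d where d: "d > 0" "\<And>h. norm h < d \<Longrightarrow>
    (\<integral>\<^sup>+x. ennreal \<bar>indicator A (x + h) - indicator A x :: real\<bar> \<partial>lborel) \<le> ennreal (4 * (e / (4 * (norm c + 1))))" by blast
  have [measurable]: "A \<in> sets borel" using base by simp
  have "(\<integral>\<^sup>+x. ennreal (norm (indicator A (x + h) *\<^sub>R c - indicator A x *\<^sub>R c)) \<partial>lborel) \<le> ennreal e"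
    if h: "norm h < d" for h
  proof -
    have "(\<integral>\<^sup>+x. ennreal (norm (indicator A (x + h) *\<^sub>R c - indicator A x *\<^sub>R c)) \<partial>lborel)
      = (\<integral>\<^sup>+x. ennreal (norm c) * ennreal \<bar>indicator A (x + h) - indicator A x :: real\<bar> \<partial>lborel)"
      by (intro nn_integral_cong) (simp flip: scaleR_diff_left ennreal_mult add: mult.commute)
    also have "\<dots> = ennreal (norm c) * (\<integral>\<^sup>+x. ennreal \<bar>indicator A (x + h) - indicator A x :: real\<bar> \<partial>lborel)"
      by (intro nn_integral_cmult) simp
    also have "\<dots> \<le> ennreal (norm c) * ennreal (4 * (e / (4 * (norm c + 1))))"
      by (intro mult_left_mono d(2) h) simp
    also have "\<dots> = ennreal (norm c * (4 * (e / (4 * (norm c + 1)))))"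
      by (rule ennreal_mult[symmetric]) (use base(3) in auto)
    also have "\<dots> \<le> ennreal e"
      using base(3) by (intro ennreal_leI) (auto simp: field_simps add_pos_nonneg intro!: divide_le_eq[THEN iffD2])
    finally show ?thesis .
  qed
  then show ?case using d(1) by blast
next
  case (add f g)
  have "0 < e / 2" using add.prems by simp
  from add.IH(1)[OF this] add.IH(2)[OF this] obtain d1 d2 where d: "d1 > 0" "d2 > 0"
    "\<And>h. norm h < d1 \<Longrightarrow> (\<integral>\<^sup>+x. ennreal (norm (f (x + h) - f x)) \<partial>lborel) \<le> ennreal (e/2)"
    "\<And>h. norm h < d2 \<Longrightarrow> (\<integral>\<^sup>+x. ennreal (norm (g (x + h) - g x)) \<partial>lborel) \<le> ennreal (e/2)" by blast
  have [measurable]: "f \<in> borel_measurable borel" "g \<in> borel_measurable borel"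
    using add.hyps by (auto dest: borel_measurable_integrable)
  have "(\<integral>\<^sup>+x. ennreal (norm (f (x + h) + g (x + h) - (f x + g x))) \<partial>lborel) \<le> ennreal e"
    if h: "norm h < min d1 d2" for h
  proof -
    have "(\<integral>\<^sup>+x. ennreal (norm (f (x + h) + g (x + h) - (f x + g x))) \<partial>lborel)
      \<le> (\<integral>\<^sup>+x. ennreal (norm (f (x + h) - f x)) + ennreal (norm (g (x + h) - g x)) \<partial>lborel)"
      by (intro nn_integral_mono) (auto simp flip: ennreal_plus simp: norm_diff_triangle_ineq add_diff_add intro!: ennreal_leI norm_triangle_ineq)
    also have "\<dots> = (\<integral>\<^sup>+x. ennreal (norm (f (x + h) - f x)) \<partial>lborel) + (\<integral>\<^sup>+x. ennreal (norm (g (x + h) - g x)) \<partial>lborel)"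
      by (intro nn_integral_add) auto
    also have "\<dots> \<le> ennreal (e/2) + ennreal (e/2)" using h by (intro add_mono d) auto
    also have "\<dots> = ennreal e" using add.prems by (simp flip: ennreal_plus)
    finally show ?thesis .
  qed
  then show ?case using d(1,2) by (intro exI[of _ "min d1 d2"]) auto
next
  case (lim f s)
  have [measurable]: "f \<in> borel_measurable borel" "\<And>i. s i \<in> borel_measurable borel"
    using lim.hyps by (auto dest: borel_measurable_integrable)
  have "(\<lambda>i. \<integral>\<^sup>+x. ennreal (norm (s i x - f x)) \<partial>lborel) \<longlonglongrightarrow> (\<integral>\<^sup>+x. 0 \<partial>(lborel :: 'a measure))"
  \<comment> \<open>The induction rule supplies approximations bounded by
    \<open>2 * norm (f x)\<close>, hence the factor 3 in the majorant.\<close>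
  proof (rule nn_integral_dominated_convergence[where w = "\<lambda>x. ennreal (3 * norm (f x))"])
    show "(\<integral>\<^sup>+x. ennreal (3 * norm (f x)) \<partial>lborel) < \<infinity>"
      using lim.hyps(4) by (simp add: ennreal_mult' nn_integral_cmult integrable_iff_bounded ennreal_mult_less_top)
    show "AE x in lborel. ennreal (norm (s i x - f x)) \<le> ennreal (3 * norm (f x))" for i
    proof (intro AE_I2 ennreal_leI)
      fix x :: 'a
      have "norm (s i x - f x) \<le> norm (s i x) + norm (f x)" by (rule norm_triangle_ineq4)
      then show "norm (s i x - f x) \<le> 3 * norm (f x)" using lim.hyps(3)[of x i] by simp
    qed
    show "AE x in lborel. (\<lambda>i. ennreal (norm (s i x - f x))) \<longlonglongrightarrow> 0"
    proof (intro AE_I2)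
      fix x :: 'a
      have "(\<lambda>i. norm (s i x - f x)) \<longlonglongrightarrow> 0" using lim.hyps(2)[of x] by (simp add: LIM_zero_iff tendsto_norm_zero)
      then show "(\<lambda>i. ennreal (norm (s i x - f x))) \<longlonglongrightarrow> 0" using tendsto_ennrealI by fastforce
    qed
  qed auto
  then have "(\<lambda>i. \<integral>\<^sup>+x. ennreal (norm (s i x - f x)) \<partial>lborel) \<longlonglongrightarrow> 0" by simp
  then have "\<forall>\<^sub>F i in sequentially. (\<integral>\<^sup>+x. ennreal (norm (s i x - f x)) \<partial>lborel) < ennreal (e/3)"
    using lim.prems by (intro order_tendstoD) auto
  then obtain i where i: "(\<integral>\<^sup>+x. ennreal (norm (s i x - f x)) \<partial>lborel) < ennreal (e/3)"
    by (auto simp: eventually_sequentially)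
  have "0 < e / 3" using lim.prems by simp
  from lim.IH[OF this, of i] obtain d where d: "d > 0"
    "\<And>h. norm h < d \<Longrightarrow> (\<integral>\<^sup>+x. ennreal (norm (s i (x + h) - s i x)) \<partial>lborel) \<le> ennreal (e/3)" by blast
  have "(\<integral>\<^sup>+x. ennreal (norm (f (x + h) - f x)) \<partial>lborel) \<le> ennreal e" if h: "norm h < d" for h
  proof -
    have "(\<integral>\<^sup>+x. ennreal (norm (f (x + h) - f x)) \<partial>lborel) \<le>
      (\<integral>\<^sup>+x. ennreal (norm (s i (x + h) - f (x + h))) + (ennreal (norm (s i (x + h) - s i x)) + ennreal (norm (s i x - f x))) \<partial>lborel)"
    proof (intro nn_integral_mono)
      fix x :: 'a
      have "norm (f (x + h) - f x) \<le> norm (s i (x + h) - f (x + h)) + (norm (s i (x + h) - s i x) + norm (s i x - f x))"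
        by (smt (verit) norm_diff_triangle_ineq norm_minus_commute norm_triangle_ineq4 diff_add_cancel norm_triangle_sub add_diff_eq diff_diff_eq2 norm_diff_triangle_le)
      then show "ennreal (norm (f (x + h) - f x)) \<le> ennreal (norm (s i (x + h) - f (x + h))) + (ennreal (norm (s i (x + h) - s i x)) + ennreal (norm (s i x - f x)))"
        by (simp flip: ennreal_plus)
    qed
    also have "\<dots> = (\<integral>\<^sup>+x. ennreal (norm (s i x - f x)) \<partial>lborel) + ((\<integral>\<^sup>+x. ennreal (norm (s i (x + h) - s i x)) \<partial>lborel) + (\<integral>\<^sup>+x. ennreal (norm (s i x - f x)) \<partial>lborel))"
      by (simp add: nn_integral_add nn_integral_lborel_shift[of "\<lambda>x. ennreal (norm (s i x - f x))"])
    also have "\<dots> \<le> ennreal (e/3) + (ennreal (e/3) + ennreal (e/3))"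
      using i d(2)[OF h] by (intro add_mono) auto
    also have "\<dots> = ennreal e" using lim.prems by (simp flip: ennreal_plus)
    finally show ?thesis .
  qed
  then show ?case using d(1) by blast
qed

section \<open>Lipschitz functions on the line have derivatives almost everywhere, by Vitali
  coverings\<close>

lemma interval_family_cover:
  fixes E :: "real set"
  assumes "\<And>x d. \<lbrakk>x \<in> E; 0 < d\<rbrakk> \<Longrightarrow> \<exists>a b. (a, b) \<in> K \<and> x \<in> {a..b} \<and> b - a < d"
    and K: "\<And>a b. (a, b) \<in> K \<Longrightarrow> a < b"
  obtains C where "countable C" "C \<subseteq> K" "disjoint_family_on (\<lambda>(a, b). {a..b}) C"
    "negligible (E - (\<Union>(a, b)\<in>C. {a..b}))"
proof -
  let ?c = "\<lambda>(a, b). (a + b) / 2 :: real" and ?r = "\<lambda>(a, b). (b - a) / 2 :: real"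
  have cb: "cball (?c i) (?r i) = (\<lambda>(a, b). {a..b}) i" for i :: "real \<times> real"
    by (cases i) (auto simp: cball_eq_atLeastAtMost field_simps)
  have pos: "0 < ?r i" if "i \<in> K" for i using K that by (cases i) auto
  have "\<exists>i. i \<in> K \<and> x \<in> cball (?c i) (?r i) \<and> ?r i < d" if xd: "x \<in> E" "0 < d" for x d
  proof -
    obtain a b where ab: "(a, b) \<in> K" "x \<in> {a..b}" "b - a < d" using assms(1)[OF xd] by blast
    then have "x \<in> cball (?c (a,b)) (?r (a,b))" by (subst cb) simp
    moreover have "?r (a, b) < d" using K[OF ab(1)] ab(3) by simp
    ultimately show ?thesis using ab(1) by blast
  qed
  from Vitali_covering_theorem_cballs[of K ?r E ?c, OF pos this]
  obtain C where C: "countable C" "C \<subseteq> K"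
     "pairwise (\<lambda>i j. disjnt (cball (?c i) (?r i)) (cball (?c j) (?r j))) C"
     "negligible(E - (\<Union>i \<in> C. cball (?c i) (?r i)))" by blast
  have "disjoint_family_on (\<lambda>(a, b). {a..b}) C"
    using C(3) unfolding cb by (simp add: disjoint_family_on_def pairwise_def disjnt_def)
  moreover have "negligible (E - (\<Union>(a, b)\<in>C. {a..b}))" using C(4) unfolding cb .
  ultimately show ?thesis using that C(1,2) by blast
qed

text \<open>Covering \<open>E\<close> twice in the sense of Vitali, the Stieltjes measure of \<open>g\<close> shows that the outer
  measure \<open>m\<close> of \<open>E\<close> satisfies \<open>s m \<le> r m\<close>.\<close>

lemma negligible_different_derivates:
  fixes g :: "real \<Rightarrow> real" and E :: "real set"
  assumes mono: "\<And>x y. x \<le> y \<Longrightarrow> g x \<le> g y" and cont: "continuous_on UNIV g"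
    and rs: "0 \<le> r" "r < s" and E: "bounded E"
    and low: "\<And>x d. \<lbrakk>x \<in> E; 0 < d\<rbrakk> \<Longrightarrow> \<exists>a b. a < b \<and> x \<in> {a..b} \<and> b - a < d \<and> g b - g a < r * (b - a)"
    and high: "\<And>x d. \<lbrakk>x \<in> E; 0 < d\<rbrakk> \<Longrightarrow> \<exists>a b. a < b \<and> x \<in> {a..b} \<and> b - a < d \<and> s * (b - a) < g b - g a"
  shows "negligible E"
proof -
  let ?M = "outer_measure_of lebesgue E" and ?\<mu> = "interval_measure g"
  have mu: "emeasure ?\<mu> {a..b} = ennreal (g b - g a)" if "a \<le> b" for a b
    using emeasure_interval_measure_Icc[OF that mono cont] by simp
  obtain A where A: "A \<in> sets lebesgue" "E \<subseteq> A" "?M = emeasure lebesgue A"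
    using outer_measure_of_attain[of E lebesgue] by auto
  obtain R where "E \<subseteq> cball (0::real) R" using E by (auto simp: bounded_iff subset_iff)
  then have "?M \<le> outer_measure_of lebesgue (cball (0::real) R)" by (rule outer_measure_of_mono)
  also have "\<dots> = emeasure lborel (cball (0::real) R)" by simp
  also have "\<dots> < \<infinity>" by (intro emeasure_compact_finite) simp
  finally obtain M where M: "?M = ennreal M" "0 \<le> M" by (cases ?M) auto
  \<comment> \<open>\<open>e\<close> is the excess measure of an open set \<open>U\<close> around
    \<open>E\<close>. Since it is arbitrary, \<open>s * M \<le> r * M\<close> will follow, which
    forces \<open>M = 0\<close>.\<close>
  have main: "s * M \<le> r * (M + e)" if e: "0 < e" for e
  proof -
    obtain U where U: "open U" "A \<subseteq> U" "U - A \<in> lmeasurable" "emeasure lebesgue (U - A) < ennreal e"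
      using sets_lebesgue_outer_open[OF A(1) e] .
    have mU: "U \<in> sets borel" using U by simp
    have "emeasure lebesgue U = emeasure lebesgue A + emeasure lebesgue (U - A)"
      using U A by (subst plus_emeasure) (auto intro: fmeasurableD simp: Un_absorb1)
    then have leU: "emeasure lborel U \<le> ennreal (M + e)"
      using U(4) A(3) M e mU by (simp add: add_left_mono less_imp_le)
    have EU: "E \<subseteq> U" using A U by blast
    \<comment> \<open>The first cover consists of disjoint short intervals inside \<open>U\<close>
      on which \<open>g\<close> grows slower than \<open>r\<close>, so their total Stieltjes mass is
      at most \<open>r\<close> times the measure of \<open>U\<close>.\<close>
    obtain C1 where C1: "countable C1" "C1 \<subseteq> {(a,b). a < b \<and> {a..b} \<subseteq> U \<and> g b - g a < r * (b - a)}"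
      "disjoint_family_on (\<lambda>(a, b). {a..b}) C1" "negligible (E - (\<Union>(a, b)\<in>C1. {a..b}))"
    proof (rule interval_family_cover[of E "{(a,b). a < b \<and> {a..b} \<subseteq> U \<and> g b - g a < r * (b - a)}"])
      fix x d :: real assume x: "x \<in> E" "0 < d"
      obtain k where k: "k > 0" "ball x k \<subseteq> U" using U EU x open_contains_ball by blast
      obtain a b where ab: "a < b" "x \<in> {a..b}" "b - a < min d k" "g b - g a < r * (b - a)"
        using low[of x "min d k"] x k by auto
      have "{a..b} \<subseteq> ball x k" using ab by (auto simp: dist_real_def)
      then show "\<exists>a b. (a, b) \<in> {(a,b). a < b \<and> {a..b} \<subseteq> U \<and> g b - g a < r * (b - a)} \<and> x \<in> {a..b} \<and> b - a < d"
        using ab k by (intro exI[of _ a] exI[of _ b]) auto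
    qed auto
    let ?U = "\<Union>(a, b)\<in>C1. {a..b}" and ?V = "\<Union>(a, b)\<in>C1. {a<..<b}"
    have V: "open ?V" by auto
    \<comment> \<open>The second cover lies inside the open intervals of the first and uses growth
      faster than \<open>s\<close>. The nesting makes the two Stieltjes masses comparable:
      \<open>s\<close> times the length of \<open>?W\<close> is at most the mass of
      \<open>?U\<close>.\<close>
    obtain C2 where C2: "countable C2" "C2 \<subseteq> {(a,b). a < b \<and> {a..b} \<subseteq> ?V \<and> s * (b - a) < g b - g a}"
      "disjoint_family_on (\<lambda>(a, b). {a..b}) C2" "negligible (E \<inter> ?V - (\<Union>(a, b)\<in>C2. {a..b}))"
    proof (rule interval_family_cover[of "E \<inter> ?V" "{(a,b). a < b \<and> {a..b} \<subseteq> ?V \<and> s * (b - a) < g b - g a}"])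
      fix x d :: real assume x: "x \<in> E \<inter> ?V" "0 < d"
      then have "x \<in> ?V" by blast
      then obtain k where k: "k > 0" "ball x k \<subseteq> ?V" using V open_contains_ball by metis
      obtain a b where ab: "a < b" "x \<in> {a..b}" "b - a < min d k" "s * (b - a) < g b - g a"
        using high[of x "min d k"] x k by auto
      have "{a..b} \<subseteq> ball x k" using ab by (auto simp: dist_real_def)
      then have "{a..b} \<subseteq> ?V" using k by blast
      then show "\<exists>a b. (a, b) \<in> {(a,b). a < b \<and> {a..b} \<subseteq> ?V \<and> s * (b - a) < g b - g a} \<and> x \<in> {a..b} \<and> b - a < d"
        using ab by (intro exI[of _ a] exI[of _ b]) auto
    qed auto
    let ?W = "\<Union>(a, b)\<in>C2. {a..b}"
    have mW: "?W \<in> sets borel" "?U \<in> sets borel"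
      using C1(1) C2(1) by (auto intro!: sets.countable_UN' simp: split_beta)
    have UN: "emeasure N (\<Union>(a, b)\<in>C. {a..b}) = (\<integral>\<^sup>+i. emeasure N (case i of (a,b) \<Rightarrow> {a..b}) \<partial>count_space C)"
      if "countable C" "disjoint_family_on (\<lambda>(a, b). {a..b}) C" "sets N = sets borel"
      for C :: "(real \<times> real) set" and N
      using that by (intro emeasure_UN_countable) (auto simp: split_beta)
    have "ennreal s * emeasure lborel ?W = ennreal s * (\<integral>\<^sup>+i. emeasure lborel (case i of (a,b) \<Rightarrow> {a..b}) \<partial>count_space C2)"
      using UN[OF C2(1,3), of lborel] by simp
    also have "\<dots> = (\<integral>\<^sup>+i. ennreal s * emeasure lborel (case i of (a,b) \<Rightarrow> {a..b}) \<partial>count_space C2)"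
      by (subst nn_integral_cmult) auto
    also have "\<dots> \<le> (\<integral>\<^sup>+i. emeasure ?\<mu> (case i of (a,b) \<Rightarrow> {a..b}) \<partial>count_space C2)"
    proof (intro nn_integral_mono)
      fix i assume "i \<in> space (count_space C2)"
      then obtain a b where "i = (a, b)" "a < b" "s * (b - a) < g b - g a" using C2(2) by auto
      then show "ennreal s * emeasure lborel (case i of (a,b) \<Rightarrow> {a..b}) \<le> emeasure ?\<mu> (case i of (a,b) \<Rightarrow> {a..b})"
        using rs by (simp add: mu ennreal_leI flip: ennreal_mult)
    qed
    also have "\<dots> = emeasure ?\<mu> ?W"
      using UN[OF C2(1,3), of ?\<mu>] by simp
    also have "\<dots> \<le> emeasure ?\<mu> ?U"
    proof (rule emeasure_mono)
      have "?W \<subseteq> ?V"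
      proof (rule UN_least)
        fix i assume "i \<in> C2"
        with C2(2) have "i \<in> {(a,b). a < b \<and> {a..b} \<subseteq> ?V \<and> s * (b - a) < g b - g a}" by (rule subsetD)
        then show "(case i of (a, b) \<Rightarrow> {a..b}) \<subseteq> ?V" by (simp add: split_beta)
      qed
      moreover have "?V \<subseteq> ?U" by (rule UN_mono) (auto simp: split_beta)
      ultimately show "?W \<subseteq> ?U" by (rule subset_trans)
    qed (use mW in auto)
    also have "\<dots> = (\<integral>\<^sup>+i. emeasure ?\<mu> (case i of (a,b) \<Rightarrow> {a..b}) \<partial>count_space C1)"
      using UN[OF C1(1,3), of ?\<mu>] by simp
    also have "\<dots> \<le> (\<integral>\<^sup>+i. ennreal r * emeasure lborel (case i of (a,b) \<Rightarrow> {a..b}) \<partial>count_space C1)"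
    proof (intro nn_integral_mono)
      fix i assume "i \<in> space (count_space C1)"
      then obtain a b where "i = (a, b)" "a < b" "g b - g a < r * (b - a)" using C1(2) by auto
      then show "emeasure ?\<mu> (case i of (a,b) \<Rightarrow> {a..b}) \<le> ennreal r * emeasure lborel (case i of (a,b) \<Rightarrow> {a..b})"
        using rs by (simp add: mu ennreal_leI flip: ennreal_mult)
    qed
    also have "\<dots> = ennreal r * emeasure lborel ?U"
      using UN[OF C1(1,3), of lborel] by (simp add: nn_integral_cmult)
    also have "\<dots> \<le> ennreal r * ennreal (M + e)"
    proof (intro mult_left_mono order_trans[OF _ leU] emeasure_mono)
      show "?U \<subseteq> U"
      proof (rule UN_least)
        fix i assume "i \<in> C1"
        with C1(2) have "i \<in> {(a,b). a < b \<and> {a..b} \<subseteq> U \<and> g b - g a < r * (b - a)}" by (rule subsetD)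
        then show "(case i of (a, b) \<Rightarrow> {a..b}) \<subseteq> U" by (simp add: split_beta)
      qed
    qed (use mU in auto)
    finally have W: "ennreal s * emeasure lborel ?W \<le> ennreal (r * (M + e))"
      using rs M e by (simp add: ennreal_mult)
    \<comment> \<open>The points of \<open>E\<close> that \<open>?W\<close> may miss: those outside
      the first cover, the countably many endpoints lost in passing to open intervals, and those
      outside the second cover.\<close>
    let ?N = "(E - ?U) \<union> (fst ` C1 \<union> snd ` C1) \<union> (E \<inter> ?V - ?W)"
    have neg: "negligible ?N"
    proof (intro negligible_Un)
      have "countable (fst ` C1 \<union> snd ` C1)" using C1(1) by auto
      then have "negligible (fst ` C1 \<union> snd ` C1)"
        by (metis countable_imp_null_set_lborel negligible_iff_null_sets null_sets_completionI)
      then show "negligible (fst ` C1)" "negligible (snd ` C1)" by auto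
    qed (use C1 C2 in auto)
    have "?U \<subseteq> ?V \<union> (fst ` C1 \<union> snd ` C1)"
    proof
      fix x assume "x \<in> ?U"
      then obtain a b where "(a, b) \<in> C1" "a \<le> x" "x \<le> b" by auto
      moreover from this have "a \<in> fst ` C1" "b \<in> snd ` C1" by force+
      ultimately show "x \<in> ?V \<union> (fst ` C1 \<union> snd ` C1)"
        by (cases "x = a"; cases "x = b") (auto intro!: bexI[of _ "(a, b)"])
    qed
    then have "E \<subseteq> ?W \<union> ?N" by blast
    then have "?M \<le> outer_measure_of lebesgue (?W \<union> ?N)" by (rule outer_measure_of_mono)
    also have "\<dots> = emeasure lebesgue (?W \<union> ?N)"
      by (rule outer_measure_of_eq[OF sets.Un[OF _ negligible_imp_sets[OF neg]]]) (use mW(1) in simp)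
    also have "\<dots> = emeasure lebesgue ?W"
    proof (rule emeasure_Un_null_set)
      show "?W \<in> sets lebesgue" using mW(1) by simp
      show "?N \<in> null_sets lebesgue" using neg negligible_iff_null_sets by blast
    qed
    also have "\<dots> = emeasure lborel ?W" using mW by simp
    finally have "ennreal s * ?M \<le> ennreal (r * (M + e))"
      using W by (meson mult_left_mono order_trans zero_le)
    then show ?thesis using M rs e by (simp flip: ennreal_mult)
  qed
  have "M = 0"
  proof (rule ccontr)
    assume "M \<noteq> 0"
    then have "0 < (s - r) * M" using M rs by simp
    \<comment> \<open>Chosen so that \<open>r * e\<close> is at most half of the gap
      \<open>(s - r) * M\<close>; the \<open>+ 1\<close> covers \<open>r = 0\<close>.\<close>
    define e where "e = (s - r) * M / (2 * (r + 1))"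
    have "0 < e" unfolding e_def using \<open>0 < (s - r) * M\<close> rs by simp
    from main[OF this] have "(s - r) * M \<le> r * e" by (simp add: algebra_simps)
    also have "r * e \<le> (r + 1) * e" using \<open>0 < e\<close> by (simp add: algebra_simps)
    also have "\<dots> = (s - r) * M / 2" unfolding e_def using rs by (simp add: field_simps)
    finally show False using \<open>0 < (s - r) * M\<close> by linarith
  qed
  then have "A \<in> null_sets lebesgue" using A M by auto
  then show ?thesis using A(2) negligible_iff_null_sets negligible_subset by blast
qed

text \<open>Existence of a limit at 0, with countable quantifiers so that it is a measurable condition.\<close>

definition rat_cauchy :: "(real \<Rightarrow> real) \<Rightarrow> bool" where
  "rat_cauchy q \<longleftrightarrow> (\<forall>n::nat. \<exists>m::nat. \<forall>t\<in>\<rat>. \<forall>t'\<in>\<rat>.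
     t \<noteq> 0 \<and> t' \<noteq> 0 \<and> \<bar>t\<bar> < 1 / Suc m \<and> \<bar>t'\<bar> < 1 / Suc m \<longrightarrow> \<bar>q t - q t'\<bar> \<le> 1 / Suc n)"

text \<open>Away from 0 the function is continuous, so a real argument can be replaced by a nearby
  nonzero rational one at arbitrarily small cost. The rational Cauchy condition is thus the full
  one, and completeness supplies the limit.\<close>

lemma rat_cauchy_iff_limit:
  fixes q :: "real \<Rightarrow> real"
  assumes cont: "continuous_on (- {0}) q"
  shows "rat_cauchy q \<longleftrightarrow> (\<exists>l. (q \<longlongrightarrow> l) (at 0))"
proof
  assume R: "rat_cauchy q"
  have approx: "\<exists>s\<in>\<rat>. s \<noteq> 0 \<and> \<bar>s\<bar> < d \<and> \<bar>q s - q t\<bar> < e" if t: "t \<noteq> 0" "\<bar>t\<bar> < d" and e: "0 < e" for t d e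
  proof -
    have "isCont q t" using cont t(1) by (subst (asm) continuous_on_eq_continuous_at) auto
    then obtain k where k: "k > 0" "\<And>s. \<bar>s - t\<bar> < k \<Longrightarrow> \<bar>q s - q t\<bar> < e"
      using e unfolding continuous_at_eps_delta by (auto simp: dist_real_def)
    define j where "j = min k (min (d - \<bar>t\<bar>) \<bar>t\<bar>)"
    have "j > 0" using k t by (auto simp: j_def)
    then obtain s where s: "s \<in> \<rat>" "t < s" "s < t + j" using Rats_dense_in_real[of t "t + j"] by auto
    have "\<bar>s - t\<bar> < k" "\<bar>s\<bar> < d" "s \<noteq> 0" using s t unfolding j_def by auto
    then show ?thesis using s k by blast
  qed
  have main: "\<exists>d>0. \<forall>t t'. t \<noteq> 0 \<and> t' \<noteq> 0 \<and> \<bar>t\<bar> < d \<and> \<bar>t'\<bar> < d \<longrightarrow> \<bar>q t - q t'\<bar> < e" if e: "0 < e" for e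
  proof -
    obtain n where n: "1 / real (Suc n) < e / 3" using nat_approx_posE[of "e/3"] e by auto
    obtain m where m: "\<And>t t'. t\<in>\<rat> \<Longrightarrow> t'\<in>\<rat> \<Longrightarrow> t \<noteq> 0 \<Longrightarrow> t' \<noteq> 0 \<Longrightarrow> \<bar>t\<bar> < 1 / Suc m \<Longrightarrow> \<bar>t'\<bar> < 1 / Suc m \<Longrightarrow> \<bar>q t - q t'\<bar> \<le> 1 / Suc n"
      using R unfolding rat_cauchy_def by meson
    have "\<bar>q t - q t'\<bar> < e" if t: "t \<noteq> 0" "t' \<noteq> 0" "\<bar>t\<bar> < 1 / Suc m" "\<bar>t'\<bar> < 1 / Suc m" for t t'
    proof -
      obtain s where s: "s \<in> \<rat>" "s \<noteq> 0" "\<bar>s\<bar> < 1 / Suc m" "\<bar>q s - q t\<bar> < e/3" using approx[of t "1/Suc m" "e/3"] t e by auto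
      obtain s' where s': "s' \<in> \<rat>" "s' \<noteq> 0" "\<bar>s'\<bar> < 1 / Suc m" "\<bar>q s' - q t'\<bar> < e/3" using approx[of t' "1/Suc m" "e/3"] t e by auto
      have "\<bar>q s - q s'\<bar> \<le> 1 / Suc n" using m s s' by blast
      then show ?thesis using s(4) s'(4) n by linarith
    qed
    then show ?thesis by (intro exI[of _ "1 / real (Suc m)"]) auto
  qed
  define s where "s n = inverse (real (Suc n))" for n
  have s0: "s \<longlonglongrightarrow> 0" unfolding s_def by (rule LIMSEQ_inverse_real_of_nat)
  have spos: "s n > 0" for n by (simp add: s_def)
  have ev: "\<forall>\<^sub>F n in sequentially. \<bar>s n\<bar> < d" if "d > 0" for d
    using order_tendstoD(2)[OF tendsto_rabs_zero[OF s0] that] .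
  have "Cauchy (\<lambda>n. q (s n))"
  proof (rule metric_CauchyI)
    fix e :: real assume "0 < e"
    from main[OF this] obtain d where d: "d > 0" "\<And>t t'. t \<noteq> 0 \<Longrightarrow> t' \<noteq> 0 \<Longrightarrow> \<bar>t\<bar> < d \<Longrightarrow> \<bar>t'\<bar> < d \<Longrightarrow> \<bar>q t - q t'\<bar> < e" by blast
    obtain N where "\<And>n. n \<ge> N \<Longrightarrow> \<bar>s n\<bar> < d" using ev[OF d(1)] by (auto simp: eventually_sequentially)
    then show "\<exists>M. \<forall>m\<ge>M. \<forall>n\<ge>M. dist (q (s m)) (q (s n)) < e"
      using d(2) spos by (metis dist_real_def less_irrefl)
  qed
  then obtain l where l: "(\<lambda>n. q (s n)) \<longlonglongrightarrow> l" using Cauchy_convergent_iff convergent_def by blast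
  have "(q \<longlongrightarrow> l) (at 0)"
  proof (rule tendstoI)
    fix e :: real assume e: "0 < e"
    then have "0 < e/2" by simp
    from main[OF this] obtain d where d: "d > 0" "\<And>t t'. t \<noteq> 0 \<Longrightarrow> t' \<noteq> 0 \<Longrightarrow> \<bar>t\<bar> < d \<Longrightarrow> \<bar>t'\<bar> < d \<Longrightarrow> \<bar>q t - q t'\<bar> < e/2" by blast
    have "\<forall>\<^sub>F n in sequentially. dist (q (s n)) l < e/2" by (rule tendstoD[OF l \<open>0 < e/2\<close>])
    with ev[OF d(1)] have "\<forall>\<^sub>F n in sequentially. \<bar>s n\<bar> < d \<and> dist (q (s n)) l < e/2" by eventually_elim auto
    then obtain n where n: "\<bar>s n\<bar> < d" "dist (q (s n)) l < e/2" by (auto simp: eventually_sequentially)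
    have "dist (q t) l < e" if "t \<noteq> 0" "\<bar>t\<bar> < d" for t
    proof -
      have "\<bar>q t - q (s n)\<bar> < e/2" using d(2) that n spos[of n] by simp
      then show ?thesis using n(2) unfolding dist_real_def by linarith
    qed
    then show "\<forall>\<^sub>F x in at 0. dist (q x) l < e"
      using d(1) by (auto simp: eventually_at dist_real_def)
  qed
  then show "\<exists>l. (q \<longlongrightarrow> l) (at 0)" ..
next
  assume "\<exists>l. (q \<longlongrightarrow> l) (at 0)"
  then obtain l where l: "(q \<longlongrightarrow> l) (at 0)" ..
  show "rat_cauchy q"
    unfolding rat_cauchy_def
  proof
    fix n :: nat
    have "\<forall>\<^sub>F t in at 0. dist (q t) l < 1 / Suc n / 2" by (intro tendstoD[OF l]) simp
    then obtain d where d: "d > 0" "\<And>t. t \<noteq> 0 \<Longrightarrow> \<bar>t\<bar> < d \<Longrightarrow> \<bar>q t - l\<bar> < 1 / Suc n / 2"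
      by (auto simp: eventually_at dist_real_def)
    obtain m where "1 / real (Suc m) < d" using nat_approx_posE[OF d(1)] .
    then have "\<bar>q t - q t'\<bar> \<le> 1 / Suc n" if "t \<noteq> 0 \<and> t' \<noteq> 0 \<and> \<bar>t\<bar> < 1 / Suc m \<and> \<bar>t'\<bar> < 1 / Suc m" for t t'
    proof -
      have "\<bar>t\<bar> < d" "\<bar>t'\<bar> < d" using that \<open>1 / real (Suc m) < d\<close> by linarith+
      then have "\<bar>q t - l\<bar> < 1 / Suc n / 2" "\<bar>q t' - l\<bar> < 1 / Suc n / 2" using d(2) that by blast+
      moreover have "\<bar>a - b\<bar> \<le> k" if "\<bar>a - l\<bar> < k / 2" "\<bar>b - l\<bar> < k / 2" for a b k :: real
        using that by linarith
      ultimately show ?thesis by blast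
    qed
    then show "\<exists>m. \<forall>t\<in>\<rat>. \<forall>t'\<in>\<rat>. t \<noteq> 0 \<and> t' \<noteq> 0 \<and> \<bar>t\<bar> < 1 / Suc m \<and> \<bar>t'\<bar> < 1 / Suc m \<longrightarrow> \<bar>q t - q t'\<bar> \<le> 1 / Suc n"
      by blast
  qed
qed

text \<open>Failure of the Cauchy condition gives two sequences tending to 0 along which the values
  stay a fixed amount apart. Boundedness lets both sequences of values converge along a common
  subsequence, and two rationals fit between the limits. Rational thresholds turn the exceptional
  set into a countable union.\<close>

lemma not_rat_cauchy_gap:
  assumes "\<not> rat_cauchy q" and bd: "\<And>t. t \<noteq> 0 \<Longrightarrow> \<bar>q t\<bar> \<le> B"
  obtains r s where "r \<in> \<rat>" "s \<in> \<rat>" "r < s" "\<And>d. 0 < d \<Longrightarrow> \<exists>t. t \<noteq> 0 \<and> \<bar>t\<bar> < d \<and> q t < r"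
    "\<And>d. 0 < d \<Longrightarrow> \<exists>t. t \<noteq> 0 \<and> \<bar>t\<bar> < d \<and> s < q t"
proof -
  obtain n where "\<And>m. \<exists>t t'. t \<noteq> 0 \<and> t' \<noteq> 0 \<and> \<bar>t\<bar> < 1 / Suc m \<and> \<bar>t'\<bar> < 1 / Suc m \<and> \<not> \<bar>q t - q t'\<bar> \<le> 1 / Suc n"
    using assms(1) unfolding rat_cauchy_def by meson
  then have "\<exists>t t'. t \<noteq> 0 \<and> t' \<noteq> 0 \<and> \<bar>t\<bar> < 1 / Suc m \<and> \<bar>t'\<bar> < 1 / Suc m \<and> q t + 1 / Suc n < q t'" for m
    by (smt (verit, best))
  then obtain a b where ab: "\<And>m. a m \<noteq> 0" "\<And>m. b m \<noteq> 0" "\<And>m. \<bar>a m\<bar> < 1 / Suc m" "\<And>m. \<bar>b m\<bar> < 1 / Suc m"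
    "\<And>m. q (a m) + 1 / Suc n < q (b m)" by metis
  have cpt: "seq_compact ({-B..B} \<times> {-B..B})" by (intro compact_imp_seq_compact compact_Times compact_Icc)
  have mem: "\<forall>m. (q (a m), q (b m)) \<in> {-B..B} \<times> {-B..B}"
  proof
    fix m
    have "\<bar>q (a m)\<bar> \<le> B" "\<bar>q (b m)\<bar> \<le> B" using bd ab by blast+
    then show "(q (a m), q (b m)) \<in> {-B..B} \<times> {-B..B}" by (auto simp: abs_le_iff)
  qed
  obtain l k where l: "strict_mono k" "((\<lambda>m. (q (a m), q (b m))) \<circ> k) \<longlonglongrightarrow> l"
    using seq_compactE[OF cpt mem] by blast
  have la: "(\<lambda>m. q (a (k m))) \<longlonglongrightarrow> fst l" using tendsto_fst[OF l(2)] by (simp add: o_def)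
  have lb: "(\<lambda>m. q (b (k m))) \<longlonglongrightarrow> snd l" using tendsto_snd[OF l(2)] by (simp add: o_def)
  have "fst l + 1 / Suc n \<le> snd l"
    by (rule LIMSEQ_le[OF tendsto_add[OF la tendsto_const] lb]) (use ab(5) in \<open>auto simp: less_imp_le\<close>)
  then have lt: "fst l < snd l" by (smt (verit) divide_pos_pos of_nat_0_less_iff zero_less_Suc zero_less_one)
  obtain r where r: "r \<in> \<rat>" "fst l < r" "r < snd l" using Rats_dense_in_real[OF lt] by blast
  obtain s where s: "s \<in> \<rat>" "r < s" "s < snd l" using Rats_dense_in_real[OF r(3)] by blast
  have small: "\<forall>\<^sub>F m in sequentially. 1 / real (Suc (k m)) < d" if "0 < d" for d
  proof -
    have "(\<lambda>m. inverse (real (Suc m))) \<longlonglongrightarrow> 0" by (rule LIMSEQ_inverse_real_of_nat)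
    from LIMSEQ_subseq_LIMSEQ[OF this l(1)] have "(\<lambda>m. 1 / real (Suc (k m))) \<longlonglongrightarrow> 0"
      by (simp add: o_def inverse_eq_divide)
    then show ?thesis using that by (intro order_tendstoD) auto
  qed
  show thesis
  proof (rule that[OF r(1) s(1) s(2)])
    fix d :: real assume d: "0 < d"
    from small[OF d] order_tendstoD(2)[OF la r(2)]
    have "\<forall>\<^sub>F m in sequentially. 1 / real (Suc (k m)) < d \<and> q (a (k m)) < r" by eventually_elim auto
    then obtain m where "1 / real (Suc (k m)) < d" "q (a (k m)) < r" by (auto simp: eventually_sequentially)
    then show "\<exists>t. t \<noteq> 0 \<and> \<bar>t\<bar> < d \<and> q t < r" using ab(1)[of "k m"] ab(3)[of "k m"] by (intro exI[of _ "a (k m)"]) auto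
  next
    fix d :: real assume d: "0 < d"
    from small[OF d] order_tendstoD(1)[OF lb s(3)]
    have "\<forall>\<^sub>F m in sequentially. 1 / real (Suc (k m)) < d \<and> s < q (b (k m))" by eventually_elim auto
    then obtain m where "1 / real (Suc (k m)) < d" "s < q (b (k m))" by (auto simp: eventually_sequentially)
    then show "\<exists>t. t \<noteq> 0 \<and> \<bar>t\<bar> < d \<and> s < q t" using ab(2)[of "k m"] ab(4)[of "k m"] by (intro exI[of _ "b (k m)"]) auto
  qed
qed

lemma lipschitz_ae_rat_cauchy_real:
  fixes f :: "real \<Rightarrow> real"
  assumes f: "L-lipschitz_on UNIV f"
  shows "negligible {x. \<not> rat_cauchy (\<lambda>t. (f (x + t) - f x) / t)}"
proof -
  \<comment> \<open>Adding \<open>L * x\<close> makes the function nondecreasing and shifts every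
    difference quotient by \<open>L\<close>, so the oscillation of the quotients is unchanged and
    the result on monotone functions applies.\<close>
  define g where "g x = f x + L * x" for x
  define q where "q x t = (f (x + t) - f x) / t" for x t
  have lip: "\<bar>f x - f y\<bar> \<le> L * \<bar>x - y\<bar>" for x y
    using lipschitz_onD[OF f, of x y] by (simp add: dist_real_def)
  have mono: "g x \<le> g y" if "x \<le> y" for x y
    using lip[of x y] that by (simp add: g_def algebra_simps abs_if split: if_splits)
  have cont: "continuous_on UNIV g"
    unfolding g_def using lipschitz_on_continuous_on[OF f] by (intro continuous_intros)
  have qb: "\<bar>q x t\<bar> \<le> L" if "t \<noteq> 0" for x t
    using lip[of "x + t" x] that by (simp add: q_def abs_divide divide_le_eq)
  \<comment> \<open>The covering argument speaks of intervals containing \<open>x\<close>; as the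
    increment \<open>t\<close> may have either sign, \<open>x\<close> becomes the left or the right
    endpoint.\<close>
  have qg: "\<exists>a b. a < b \<and> x \<in> {a..b} \<and> b - a = \<bar>t\<bar> \<and> g b - g a = (q x t + L) * (b - a)" if "t \<noteq> 0" for x t
  proof (cases "t > 0")
    case True then show ?thesis
      by (intro exI[of _ x] exI[of _ "x + t"]) (auto simp: g_def q_def field_simps)
  next
    case False then show ?thesis using that
      by (intro exI[of _ "x + t"] exI[of _ x]) (auto simp: g_def q_def field_simps)
  qed
  define E where "E r s = {x. (\<forall>d>0. \<exists>t. t \<noteq> 0 \<and> \<bar>t\<bar> < d \<and> q x t < r) \<and> (\<forall>d>0. \<exists>t. t \<noteq> 0 \<and> \<bar>t\<bar> < d \<and> s < q x t)}" for r s
  have neg: "negligible (E r s \<inter> cball 0 (real k))" if rs: "r < s" for r s k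
  proof (cases "E r s = {}")
    case False
    then obtain x t where "t \<noteq> 0" "q x t < r" unfolding E_def by (auto dest: spec[of _ 1])
    \<comment> \<open>A point of \<open>E r s\<close> has a quotient below \<open>r\<close>, and
      every quotient is at least \<open>- L\<close>.\<close>
    then have r: "0 \<le> r + L" using qb[of t x] by linarith
    show ?thesis
    proof (rule negligible_different_derivates[OF mono cont r, of "s + L"])
      fix x d :: real assume x: "x \<in> E r s \<inter> cball 0 (real k)" "0 < d"
      obtain t where t: "t \<noteq> 0" "\<bar>t\<bar> < d" "q x t < r" using x unfolding E_def by auto
      obtain a b where ab: "a < b" "x \<in> {a..b}" "b - a = \<bar>t\<bar>" "g b - g a = (q x t + L) * (b - a)" using qg[OF t(1)] by blast
      have "(q x t + L) * (b - a) < (r + L) * (b - a)" using t ab by (intro mult_strict_right_mono) auto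
      then show "\<exists>a b. a < b \<and> x \<in> {a..b} \<and> b - a < d \<and> g b - g a < (r + L) * (b - a)" using ab t by metis
    next
      fix x d :: real assume x: "x \<in> E r s \<inter> cball 0 (real k)" "0 < d"
      obtain t where t: "t \<noteq> 0" "\<bar>t\<bar> < d" "s < q x t" using x unfolding E_def by auto
      obtain a b where ab: "a < b" "x \<in> {a..b}" "b - a = \<bar>t\<bar>" "g b - g a = (q x t + L) * (b - a)" using qg[OF t(1)] by blast
      have "(s + L) * (b - a) < (q x t + L) * (b - a)" using t ab by (intro mult_strict_right_mono) auto
      then show "\<exists>a b. a < b \<and> x \<in> {a..b} \<and> b - a < d \<and> (s + L) * (b - a) < g b - g a" using ab t by metis
    qed (use rs in auto)
  qed auto
  \<comment> \<open>Countably many pieces: pairs of rational thresholds, intersected with balls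
    because the covering argument asks for bounded sets.\<close>
  let ?I = "{(r, s, k). r \<in> \<rat> \<and> s \<in> \<rat> \<and> r < s} :: (real \<times> real \<times> nat) set"
  have "countable ?I"
    by (rule countable_subset[of _ "\<rat> \<times> \<rat> \<times> UNIV"]) (auto simp: countable_rat)
  then have "negligible (\<Union>((\<lambda>(r, s, k). E r s \<inter> cball 0 (real k)) ` ?I))"
    by (intro negligible_countable_Union) (auto intro!: neg)
  moreover have "{x. \<not> rat_cauchy (q x)} \<subseteq> \<Union>((\<lambda>(r, s, k). E r s \<inter> cball 0 (real k)) ` ?I)"
  proof
    fix x assume "x \<in> {x. \<not> rat_cauchy (q x)}"
    then have "\<not> rat_cauchy (q x)" by simp
    then obtain r s where rs: "r \<in> \<rat>" "s \<in> \<rat>" "r < s" "x \<in> E r s"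
    proof (rule not_rat_cauchy_gap)
      fix t :: real assume "t \<noteq> 0" then show "\<bar>q x t\<bar> \<le> L" by (rule qb)
    next
      fix r s assume "r \<in> \<rat>" "s \<in> \<rat>" "r < s" "\<And>d. 0 < d \<Longrightarrow> \<exists>t. t \<noteq> 0 \<and> \<bar>t\<bar> < d \<and> q x t < r"
        "\<And>d. 0 < d \<Longrightarrow> \<exists>t. t \<noteq> 0 \<and> \<bar>t\<bar> < d \<and> s < q x t"
      then show thesis by (intro that[of r s]) (simp_all add: E_def)
    qed
    obtain k :: nat where "\<bar>x\<bar> \<le> real k" using real_arch_simple by blast
    then have "x \<in> E r s \<inter> cball 0 (real k)" using rs by (simp add: dist_real_def)
    then show "x \<in> \<Union>((\<lambda>(r, s, k). E r s \<inter> cball 0 (real k)) ` ?I)" using rs by (intro UN_I[of "(r, s, k)"]) simp_all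
  qed
  ultimately show ?thesis unfolding q_def using negligible_subset by blast
qed

section \<open>Directional derivatives, Rademacher's theorem and integration by parts\<close>

definition dquot :: "('a::real_normed_vector \<Rightarrow> real) \<Rightarrow> 'a \<Rightarrow> 'a \<Rightarrow> real \<Rightarrow> real" where
  "dquot f w x t = (f (x + t *\<^sub>R w) - f x) / t"

text \<open>The limit is taken along a fixed sequence so that the function is Borel measurable on
  the whole space; wherever the two-sided limit exists, \<open>ddir_eqI\<close> identifies it with
  this value.\<close>

definition ddir :: "('a::real_normed_vector \<Rightarrow> real) \<Rightarrow> 'a \<Rightarrow> 'a \<Rightarrow> real" where
  "ddir f w x = lim (\<lambda>n. dquot f w x (1 / Suc n))"

lemma lipschitz_borel_measurable:
  fixes f :: "'a::euclidean_space \<Rightarrow> real"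
  shows "L-lipschitz_on UNIV f \<Longrightarrow> f \<in> borel_measurable borel"
  by (intro borel_measurable_continuous_onI lipschitz_on_continuous_on)

lemma dquot_bound:
  fixes f :: "'a::real_normed_vector \<Rightarrow> real"
  assumes "L-lipschitz_on UNIV f"
  shows "\<bar>dquot f w x t\<bar> \<le> L * norm w"
proof (cases "t = 0")
  case True
  then show ?thesis using lipschitz_on_nonneg[OF assms] by (simp add: dquot_def)
next
  case False
  have "\<bar>f (x + t *\<^sub>R w) - f x\<bar> \<le> L * (\<bar>t\<bar> * norm w)"
    using lipschitz_onD[OF assms, of "x + t *\<^sub>R w" x] by (simp add: dist_norm)
  then show ?thesis using False by (simp add: dquot_def abs_divide divide_le_eq mult_ac)
qed

lemma dquot_measurable[measurable]:
  fixes f :: "'a::euclidean_space \<Rightarrow> real"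
  assumes [measurable]: "f \<in> borel_measurable borel"
  shows "(\<lambda>x. dquot f w x t) \<in> borel_measurable borel"
  unfolding dquot_def by measurable

lemma ddir_measurable[measurable]:
  fixes f :: "'a::euclidean_space \<Rightarrow> real"
  assumes [measurable]: "f \<in> borel_measurable borel"
  shows "ddir f w \<in> borel_measurable borel"
  unfolding ddir_def[abs_def] by measurable

text \<open>The exceptional set meets every line parallel to \<open>w\<close> in a null set; averaging its translates
  along \<open>w\<close> with Tonelli shows that it is null.\<close>

lemma AE_dquot_limit_exists:
  fixes f :: "'a::euclidean_space \<Rightarrow> real"
  assumes f: "L-lipschitz_on UNIV f"
  shows "AE x in lborel. \<exists>l. (dquot f w x \<longlongrightarrow> l) (at 0)"
proof -
  have [measurable]: "f \<in> borel_measurable borel" using f by (rule lipschitz_borel_measurable)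
  let ?B = "{x. \<not> rat_cauchy (dquot f w x)}"
  have cont: "continuous_on (- {0}) (dquot f w x)" for x
    unfolding dquot_def
    by (intro continuous_intros continuous_on_compose2[OF lipschitz_on_continuous_on[OF f]]) auto
  have [measurable]: "Measurable.pred borel (\<lambda>x. rat_cauchy (dquot f w x))"
    \<comment> \<open>Writing the rationals as a range turns the bounded quantifiers into
      quantifiers over a countable type, which the measurability prover accepts.\<close>
    unfolding rat_cauchy_def Rats_def ball_simps ball_UNIV by measurable
  have B[measurable]: "?B \<in> sets borel" by measurable
  have line: "(\<integral>\<^sup>+t. indicator {0..1::real} t * indicator ?B (x + t *\<^sub>R w) \<partial>lborel) = 0" for x
  proof -
    let ?h = "\<lambda>s. f (x + s *\<^sub>R w)"
    have "(L * norm w)-lipschitz_on UNIV ?h"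
    proof (rule lipschitz_onI)
      fix s t :: real
      have "dist (?h s) (?h t) \<le> L * dist (x + s *\<^sub>R w) (x + t *\<^sub>R w)" using lipschitz_onD[OF f] by blast
      also have "\<dots> = L * norm w * dist s t"
        by (simp add: dist_norm flip: scaleR_diff_left)
      finally show "dist (?h s) (?h t) \<le> L * norm w * dist s t" .
    qed (use lipschitz_on_nonneg[OF f] in simp)
    from lipschitz_ae_rat_cauchy_real[OF this]
    have "negligible {s. \<not> rat_cauchy (\<lambda>t. (?h (s + t) - ?h s) / t)}" .
    moreover have "(\<lambda>t. (?h (s + t) - ?h s) / t) = dquot f w (x + s *\<^sub>R w)" for s
      by (rule ext) (simp add: dquot_def scaleR_add_left add.assoc)
    ultimately have "negligible {s. \<not> rat_cauchy (dquot f w (x + s *\<^sub>R w))}" by simp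
    then have "{s. \<not> rat_cauchy (dquot f w (x + s *\<^sub>R w))} \<in> null_sets lebesgue"
      by (simp only: negligible_iff_null_sets)
    then have "AE s in lebesgue. rat_cauchy (dquot f w (x + s *\<^sub>R w))" by (rule AE_I') auto
    then have "AE s in lborel. rat_cauchy (dquot f w (x + s *\<^sub>R w))" by (simp add: AE_completion_iff)
    then have "AE s in lborel. indicator {0..1::real} s * indicator ?B (x + s *\<^sub>R w) = (0::ennreal)"
      by eventually_elim simp
    then show ?thesis by (subst nn_integral_0_iff_AE) auto
  qed
  \<comment> \<open>The weight on the unit interval has integral one, so averaging over shifts along
    \<open>w\<close> leaves the measure unchanged.\<close>
  have "emeasure lborel ?B = (\<integral>\<^sup>+t. indicator {0..1::real} t * emeasure lborel ?B \<partial>lborel)"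
    by (subst nn_integral_multc) auto
  also have "\<dots> = (\<integral>\<^sup>+t. (\<integral>\<^sup>+x. indicator {0..1::real} t * indicator ?B (x + t *\<^sub>R w) \<partial>lborel) \<partial>lborel)"
    by (intro nn_integral_cong, subst nn_integral_cmult)
       (auto simp: nn_integral_lborel_shift[of "indicator ?B"])
  also have "\<dots> = (\<integral>\<^sup>+x. (\<integral>\<^sup>+t. indicator {0..1::real} t * indicator ?B (x + t *\<^sub>R w) \<partial>lborel) \<partial>lborel)"
    by (rule lborel_pair.Fubini') measurable
  also have "\<dots> = 0" using line by simp
  finally have "?B \<in> null_sets lborel" by auto
  then have "AE x in lborel. rat_cauchy (dquot f w x)" by (auto dest: AE_not_in)
  then show ?thesis by eventually_elim (use rat_cauchy_iff_limit[OF cont] in blast)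
qed

lemma filterlim_inverse_Suc_at_0: "filterlim (\<lambda>n. 1 / real (Suc n)) (at 0) sequentially"
  using LIMSEQ_inverse_real_of_nat by (auto simp: filterlim_at inverse_eq_divide)

lemma ddir_eqI: "(dquot f w x \<longlongrightarrow> l) (at 0) \<Longrightarrow> ddir f w x = l"
  unfolding ddir_def by (rule limI) (erule filterlim_compose[OF _ filterlim_inverse_Suc_at_0])

lemma AE_ddir:
  fixes f :: "'a::euclidean_space \<Rightarrow> real"
  assumes "L-lipschitz_on UNIV f"
  shows "AE x in lborel. (dquot f w x \<longlongrightarrow> ddir f w x) (at 0)"
  using AE_dquot_limit_exists[OF assms, of w] by eventually_elim (use ddir_eqI in metis)

lemma AE_ddir_seq:
  fixes f :: "'a::euclidean_space \<Rightarrow> real"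
  assumes "L-lipschitz_on UNIV f"
  shows "AE x in lborel. (\<lambda>n. dquot f w x (1 / Suc n)) \<longlonglongrightarrow> ddir f w x"
  using AE_ddir[OF assms, of w] by eventually_elim (erule filterlim_compose[OF _ filterlim_inverse_Suc_at_0])

lemma AE_ddir_bound:
  fixes f :: "'a::euclidean_space \<Rightarrow> real"
  assumes "L-lipschitz_on UNIV f"
  shows "AE x in lborel. \<bar>ddir f w x\<bar> \<le> L * norm w"
  using AE_ddir_seq[OF assms, of w]
  by eventually_elim (rule LIMSEQ_le_const2[OF tendsto_rabs], use dquot_bound[OF assms] in auto)

lemma dquot_outside:
  fixes f :: "'a::euclidean_space \<Rightarrow> real"
  assumes out: "\<forall>x. R < norm x \<longrightarrow> f x = 0" and x: "R + norm w < norm x" and t: "\<bar>t\<bar> \<le> 1"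
  shows "dquot f w x t = 0"
proof -
  have "norm x \<le> norm (x + t *\<^sub>R w) + norm (t *\<^sub>R w)" by (metis add_diff_cancel_right' norm_triangle_ineq4)
  moreover have "norm (t *\<^sub>R w) \<le> norm w" using t by (simp add: mult_left_le_one_le)
  ultimately have "R < norm (x + t *\<^sub>R w)" "R < norm x" using x norm_ge_zero[of w] by linarith+
  then show ?thesis using out by (simp add: dquot_def)
qed

text \<open>Dominated convergence: increments of size at most 1 move a point by at most
  \<open>norm w\<close>, so all quotients vanish outside one larger ball and are bounded by
  \<open>L * norm w\<close> inside it.\<close>

lemma lipschitz_supp_dquot_L1:
  fixes f :: "'a::euclidean_space \<Rightarrow> real"
  assumes f: "L-lipschitz_on UNIV f" and out: "\<forall>x. R < norm x \<longrightarrow> f x = 0"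
  shows "integrable lborel (ddir f w)"
    and "(\<lambda>n. \<integral>\<^sup>+x. ennreal \<bar>dquot f w x (1 / Suc n) - ddir f w x\<bar> \<partial>lborel) \<longlonglongrightarrow> 0"
    and "integrable lborel (\<lambda>x. dquot f w x (1 / Suc n))"
proof -
  have [measurable]: "f \<in> borel_measurable borel" using f by (rule lipschitz_borel_measurable)
  let ?K = "cball (0::'a) (R + norm w)" and ?B = "L * norm w"
  have B: "0 \<le> ?B" using lipschitz_on_nonneg[OF f] by simp
  have K[measurable]: "?K \<in> sets borel" by (intro borel_closed closed_cball)
  have fin: "emeasure lborel ?K < \<infinity>" by (intro emeasure_compact_finite) simp
  have int: "integrable lborel (\<lambda>x. ?B * indicator ?K x)" using fin by auto
  have q: "\<bar>dquot f w x (1 / Suc n)\<bar> \<le> ?B * indicator ?K x" for x n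
    using dquot_bound[OF f, of w x "1 / Suc n"]
      dquot_outside[where f = f and R = R and w = w and x = x and t = "1 / Suc n", OF out]
    by (cases "x \<in> ?K") auto
  have d: "AE x in lborel. \<bar>ddir f w x\<bar> \<le> ?B * indicator ?K x"
    using AE_ddir_seq[OF f, of w]
    by eventually_elim (rule LIMSEQ_le_const2[OF tendsto_rabs], use q in auto)
  show "integrable lborel (ddir f w)"
    by (rule Bochner_Integration.integrable_bound[OF int]) (use d B in auto)
  show "integrable lborel (\<lambda>x. dquot f w x (1 / Suc n))" for n
    by (rule Bochner_Integration.integrable_bound[OF int]) (use q B in auto)
  have "(\<lambda>n. \<integral>\<^sup>+x. ennreal \<bar>dquot f w x (1 / Suc n) - ddir f w x\<bar> \<partial>lborel) \<longlonglongrightarrow> (\<integral>\<^sup>+x. 0 \<partial>(lborel :: 'a measure))"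
  proof (rule nn_integral_dominated_convergence[where w = "\<lambda>x. ennreal (2 * (?B * indicator ?K x))"])
    have "integrable lborel (\<lambda>x. 2 * (?B * indicator ?K x))" using int by simp
    then show "(\<integral>\<^sup>+x. ennreal (2 * (?B * indicator ?K x)) \<partial>lborel) < \<infinity>"
      using B by (subst (asm) integrable_iff_bounded) simp
    show "AE x in lborel. ennreal \<bar>dquot f w x (1 / Suc n) - ddir f w x\<bar> \<le> ennreal (2 * (?B * indicator ?K x))" for n
      using d
    proof eventually_elim
      case (elim x)
      then show ?case using q[of x n] by (intro ennreal_leI) linarith
    qed
    show "AE x in lborel. (\<lambda>n. ennreal \<bar>dquot f w x (1 / Suc n) - ddir f w x\<bar>) \<longlonglongrightarrow> 0"
      using AE_ddir_seq[OF f, of w]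
    proof eventually_elim
      case (elim x)
      then have "(\<lambda>n. \<bar>dquot f w x (1 / Suc n) - ddir f w x\<bar>) \<longlonglongrightarrow> 0"
        by (intro tendsto_rabs_zero LIM_zero)
      from tendsto_ennrealI[OF this] show ?case by simp
    qed
  qed measurable
  then show "(\<lambda>n. \<integral>\<^sup>+x. ennreal \<bar>dquot f w x (1 / Suc n) - ddir f w x\<bar> \<partial>lborel) \<longlonglongrightarrow> 0" by simp
qed

lemma tendsto_0_if_ennreal_le:
  fixes f :: "'a \<Rightarrow> ennreal"
  assumes "\<And>e::real. 0 < e \<Longrightarrow> \<forall>\<^sub>F n in F. f n \<le> ennreal e"
  shows "(f \<longlongrightarrow> 0) F"
proof (rule order_tendstoI)
  fix y :: ennreal assume "0 < y"
  then obtain e where e: "0 < e" "ennreal e < y"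
  proof (cases y)
    case (real r)
    then show ?thesis using that[of "r / 2"] \<open>0 < y\<close> by (auto simp: ennreal_less_iff)
  next
    case top
    then show ?thesis using that[of 1] by simp
  qed
  show "\<forall>\<^sub>F n in F. f n < y" using assms[OF e(1)] by eventually_elim (use e in auto)
qed auto

text \<open>The difference quotient in direction \<open>w + z\<close> is a quotient in direction \<open>w\<close> plus a translated
  quotient in direction \<open>z\<close>, and translations are continuous in \<open>L\<^sup>1\<close>.\<close>

lemma AE_ddir_add:
  fixes f :: "'a::euclidean_space \<Rightarrow> real"
  assumes f: "L-lipschitz_on UNIV f" and out: "\<forall>x. R < norm x \<longrightarrow> f x = 0"
  shows "AE x in lborel. ddir f (w + z) x = ddir f w x + ddir f z x"
proof -
  have [measurable]: "f \<in> borel_measurable borel" using f by (rule lipschitz_borel_measurable)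
  let ?q = "\<lambda>w n x. dquot f w x (1 / Suc n)"
  let ?s = "\<lambda>n x. x + (1 / Suc n) *\<^sub>R w"
  let ?I = "\<lambda>w n. \<integral>\<^sup>+x. ennreal \<bar>?q w n x - ddir f w x\<bar> \<partial>lborel"
  let ?T = "\<lambda>n. \<integral>\<^sup>+x. ennreal \<bar>ddir f z (?s n x) - ddir f z x\<bar> \<partial>lborel"
  note L1 = lipschitz_supp_dquot_L1[OF f out]
  have T: "?T \<longlonglongrightarrow> 0"
  proof (rule tendsto_0_if_ennreal_le)
    fix e :: real assume e: "0 < e"
    obtain d where d: "d > 0" "\<And>h. norm h < d \<Longrightarrow> (\<integral>\<^sup>+x. ennreal (norm (ddir f z (x + h) - ddir f z x)) \<partial>lborel) \<le> ennreal e"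
      using L1_translation_continuous[OF L1(1) e] by blast
    have "(\<lambda>n. norm ((1 / Suc n) *\<^sub>R w)) \<longlonglongrightarrow> norm (0 *\<^sub>R w)"
      using filterlim_inverse_Suc_at_0 by (intro tendsto_intros) (auto simp: filterlim_at)
    then have "\<forall>\<^sub>F n in sequentially. norm ((1 / Suc n) *\<^sub>R w) < d" using d(1) by (intro order_tendstoD) auto
    then show "\<forall>\<^sub>F n in sequentially. ?T n \<le> ennreal e" by eventually_elim (use d(2) in auto)
  qed
  let ?D = "\<integral>\<^sup>+x. ennreal \<bar>ddir f (w + z) x - (ddir f w x + ddir f z x)\<bar> \<partial>lborel"
  have "?D \<le> (?I (w + z) n + ?I w n) + (?I z n + ?T n)" for n
  proof -
    have "?D \<le> (\<integral>\<^sup>+x. (ennreal \<bar>?q (w + z) n x - ddir f (w + z) x\<bar> + ennreal \<bar>?q w n x - ddir f w x\<bar>) +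
        (ennreal \<bar>?q z n (?s n x) - ddir f z (?s n x)\<bar> + ennreal \<bar>ddir f z (?s n x) - ddir f z x\<bar>) \<partial>lborel)"
    proof (rule nn_integral_mono)
      fix x
      have "?q (w + z) n x = ?q w n x + ?q z n (?s n x)"
        unfolding dquot_def by (simp add: algebra_simps diff_divide_distrib)
      then have "\<bar>ddir f (w + z) x - (ddir f w x + ddir f z x)\<bar> \<le>
        (\<bar>?q (w + z) n x - ddir f (w + z) x\<bar> + \<bar>?q w n x - ddir f w x\<bar>) +
        (\<bar>?q z n (?s n x) - ddir f z (?s n x)\<bar> + \<bar>ddir f z (?s n x) - ddir f z x\<bar>)" by linarith
      from ennreal_leI[OF this]
      show "ennreal \<bar>ddir f (w + z) x - (ddir f w x + ddir f z x)\<bar> \<le>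
        (ennreal \<bar>?q (w + z) n x - ddir f (w + z) x\<bar> + ennreal \<bar>?q w n x - ddir f w x\<bar>) +
        (ennreal \<bar>?q z n (?s n x) - ddir f z (?s n x)\<bar> + ennreal \<bar>ddir f z (?s n x) - ddir f z x\<bar>)"
        by (simp add: ennreal_plus)
    qed
    also have "\<dots> = (?I (w + z) n + ?I w n) + ((\<integral>\<^sup>+x. ennreal \<bar>?q z n (?s n x) - ddir f z (?s n x)\<bar> \<partial>lborel) + ?T n)"
      by (simp add: nn_integral_add)
    also have "(\<integral>\<^sup>+x. ennreal \<bar>?q z n (?s n x) - ddir f z (?s n x)\<bar> \<partial>lborel) = ?I z n"
      by (rule nn_integral_lborel_shift[of "\<lambda>x. ennreal \<bar>?q z n x - ddir f z x\<bar>"]) measurable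
    finally show ?thesis .
  qed
  moreover have "(\<lambda>n. (?I (w + z) n + ?I w n) + (?I z n + ?T n)) \<longlonglongrightarrow> (0 + 0) + (0 + 0)"
    by (intro tendsto_add L1(2) T)
  ultimately have "?D \<le> 0" by (intro LIMSEQ_le_const) auto
  then have "?D = 0" by simp
  then have "AE x in lborel. ennreal \<bar>ddir f (w + z) x - (ddir f w x + ddir f z x)\<bar> = 0"
    by (subst (asm) nn_integral_0_iff_AE) auto
  then show ?thesis by eventually_elim (simp add: ennreal_eq_0_iff)
qed

text \<open>Replacing the increment \<open>t\<close> by \<open>c * t\<close> preserves punctured
  neighbourhoods of 0 for either sign of \<open>c\<close>. The value \<open>-1\<close> is used in
  the integration by parts.\<close>

lemma AE_ddir_scale:
  fixes f :: "'a::euclidean_space \<Rightarrow> real"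
  assumes f: "L-lipschitz_on UNIV f"
  shows "AE x in lborel. ddir f (c *\<^sub>R w) x = c * ddir f w x"
proof (cases "c = 0")
  case True
  then show ?thesis by (auto simp: ddir_def dquot_def)
next
  case False
  show ?thesis using AE_ddir[OF f, of w]
  proof eventually_elim
    case (elim x)
    have "filterlim (\<lambda>t. c * t) (at 0) (at 0)"
      unfolding filterlim_at using False by (auto intro!: tendsto_eq_intros simp: eventually_at_filter)
    from filterlim_compose[OF elim this]
    have "((\<lambda>t. c * dquot f w x (c * t)) \<longlongrightarrow> c * ddir f w x) (at 0)" by (intro tendsto_intros)
    moreover have "(\<lambda>t. c * dquot f w x (c * t)) = dquot f (c *\<^sub>R w) x"
      using False by (auto simp: dquot_def mult.commute)
    ultimately show ?case by (intro ddir_eqI) simp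
  qed
qed

lemma AE_ddir_sum:
  fixes f :: "'a::euclidean_space \<Rightarrow> real"
  assumes f: "L-lipschitz_on UNIV f" and out: "\<forall>x. R < norm x \<longrightarrow> f x = 0" and "finite A"
  shows "AE x in lborel. ddir f (\<Sum>i\<in>A. c i *\<^sub>R b i) x = (\<Sum>i\<in>A. c i * ddir f (b i) x)"
  using \<open>finite A\<close>
proof induction
  case empty
  then show ?case by (simp add: ddir_def dquot_def)
next
  case (insert i A)
  from AE_ddir_add[OF f out, of "c i *\<^sub>R b i" "\<Sum>i\<in>A. c i *\<^sub>R b i"] AE_ddir_scale[OF f, of "c i" "b i"] insert.IH
  show ?case by eventually_elim (use insert.hyps in simp)
qed

text \<open>A candidate gradient assembled from directional derivatives. It is Borel measurable,
  whereas \<open>grad\<close> takes an arbitrary value wherever the function is not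
  differentiable.\<close>

definition pgrad :: "('a::euclidean_space \<Rightarrow> real) \<Rightarrow> 'a \<Rightarrow> 'a" where
  "pgrad f x = (\<Sum>i\<in>Basis. ddir f i x *\<^sub>R i)"

lemma pgrad_measurable[measurable]:
  assumes [measurable]: "f \<in> borel_measurable borel"
  shows "pgrad f \<in> borel_measurable borel"
  unfolding pgrad_def[abs_def] by measurable

lemma AE_ddir_eq_inner_pgrad:
  fixes f :: "'a::euclidean_space \<Rightarrow> real"
  assumes f: "L-lipschitz_on UNIV f" and out: "\<forall>x. R < norm x \<longrightarrow> f x = 0"
  shows "AE x in lborel. ddir f w x = pgrad f x \<bullet> w"
  using AE_ddir_sum[OF f out finite_Basis, of "\<lambda>i. w \<bullet> i" "\<lambda>i. i"]
proof eventually_elim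
  case (elim x)
  then have "ddir f w x = (\<Sum>i\<in>Basis. (w \<bullet> i) * ddir f i x)" by (simp add: euclidean_representation)
  also have "\<dots> = pgrad f x \<bullet> w"
    unfolding pgrad_def inner_sum_left by (intro sum.cong) (auto simp: inner_commute)
  finally show ?case .
qed

text \<open>Almost everywhere the quotients converge to the linear value simultaneously for a
  countable dense set of directions. Finitely many of these come close to every unit vector, and the
  Lipschitz bound carries the estimate from them to all directions, which makes the convergence
  uniform.\<close>

theorem rademacher_compact_support:
  fixes f :: "'a::euclidean_space \<Rightarrow> real"
  assumes f: "L-lipschitz_on UNIV f" and out: "\<forall>x. R < norm x \<longrightarrow> f x = 0"
  shows "AE x in lborel. (f has_derivative (\<lambda>h. pgrad f x \<bullet> h)) (at x)"
proof -
  obtain D :: "'a set" where D: "countable D" "\<And>X. open X \<Longrightarrow> X \<noteq> {} \<Longrightarrow> \<exists>d\<in>D. d \<in> X"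
    using countable_dense_setE by blast
  have "AE x in lborel. (dquot f w x \<longlongrightarrow> pgrad f x \<bullet> w) (at 0)" for w
    using AE_ddir[OF f, of w] AE_ddir_eq_inner_pgrad[OF f out, of w] by eventually_elim simp
  then have "AE x in lborel. \<forall>w\<in>D. (dquot f w x \<longlongrightarrow> pgrad f x \<bullet> w) (at 0)"
    using D(1) by (simp add: AE_ball_countable)
  then show ?thesis
  proof eventually_elim
    case (elim x)
    define g where "g = pgrad f x"
    have L: "0 \<le> L" using lipschitz_on_nonneg[OF f] .
    have "((\<lambda>h. norm (f (x + h) - f x - g \<bullet> h) / norm h) \<longlongrightarrow> 0) (at 0)"
    proof (rule tendstoI)
      fix e :: real assume e: "0 < e"
      \<comment> \<open>Changing the direction by \<open>k\<close> costs \<open>L * k\<close> in the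
        increment of \<open>f\<close> and \<open>norm g * k\<close> in the linear part; this choice
        keeps their sum below \<open>e / 4\<close>.\<close>
      define k where "k = e / (4 * (L + norm g + 1))"
      have k: "0 < k" using e L by (simp add: k_def add_nonneg_pos)
      have kb: "(L + norm g) * k \<le> e / 4"
      proof -
        have "(L + norm g) * k \<le> (L + norm g + 1) * k" using k by simp
        also have "\<dots> = e / 4"
        proof -
          have "L + norm g + 1 \<noteq> 0" using L norm_ge_zero[of g] by linarith
          moreover have "K * (e / (4 * K)) = e / 4" if "K \<noteq> 0" for K :: real using that by simp
          ultimately show ?thesis unfolding k_def by blast
        qed
        finally show ?thesis .
      qed
      \<comment> \<open>Density gives the cover and compactness leaves finitely many directions, so
        that one radius \<open>d\<close> serves them all.\<close>
      have "sphere 0 1 \<subseteq> (\<Union>w\<in>D. ball w k)"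
      proof
        fix y :: 'a
        obtain d where "d \<in> D" "d \<in> ball y k" using D(2)[of "ball y k"] k by auto
        then show "y \<in> (\<Union>w\<in>D. ball w k)" by (auto simp: dist_commute)
      qed
      then obtain F where F: "F \<subseteq> D" "finite F" "sphere 0 1 \<subseteq> (\<Union>w\<in>F. ball w k)"
        using compactE_image[of "sphere (0::'a) 1" D "\<lambda>w. ball w k"] by auto
      have "\<forall>\<^sub>F t in at 0. \<forall>w\<in>F. dist (dquot f w x t) (g \<bullet> w) < e / 4"
        using F e elim by (intro eventually_ball_finite ballI tendstoD) (auto simp: g_def)
      then obtain d where d: "d > 0" "\<And>t w. t \<noteq> 0 \<Longrightarrow> \<bar>t\<bar> < d \<Longrightarrow> w \<in> F \<Longrightarrow> \<bar>dquot f w x t - g \<bullet> w\<bar> < e / 4"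
        by (auto simp: eventually_at dist_real_def)
      have "norm (f (x + h) - f x - g \<bullet> h) / norm h < e" if h: "h \<noteq> 0" "norm h < d" for h
      proof -
        define t where "t = norm h"
        define y where "y = h /\<^sub>R t"
        have t: "0 < t" "t < d" using h by (auto simp: t_def)
        have hy: "h = t *\<^sub>R y" using t by (simp add: y_def)
        have "norm y = 1" using t by (simp add: y_def t_def)
        then have "y \<in> sphere 0 1" by simp
        with F(3) have "y \<in> (\<Union>w\<in>F. ball w k)" by (rule subsetD)
        then obtain w where w: "w \<in> F" "norm (y - w) < k" by (auto simp: dist_norm norm_minus_commute)
        have 1: "\<bar>f (x + t *\<^sub>R y) - f (x + t *\<^sub>R w)\<bar> \<le> t * (L * k)"
        proof -
          have "\<bar>f (x + t *\<^sub>R y) - f (x + t *\<^sub>R w)\<bar> \<le> L * norm (t *\<^sub>R y - t *\<^sub>R w)"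
            using lipschitz_onD[OF f, of "x + t *\<^sub>R y" "x + t *\<^sub>R w"] by (simp add: dist_norm)
          also have "norm (t *\<^sub>R y - t *\<^sub>R w) = t * norm (y - w)" using t by (simp flip: scaleR_diff_right)
          also have "L * (t * norm (y - w)) \<le> L * (t * k)" using L t w by (intro mult_left_mono) auto
          finally show ?thesis by (simp add: mult_ac)
        qed
        have 2: "\<bar>f (x + t *\<^sub>R w) - f x - t * (g \<bullet> w)\<bar> \<le> t * (e / 4)"
        proof -
          have "f (x + t *\<^sub>R w) - f x - t * (g \<bullet> w) = t * (dquot f w x t - g \<bullet> w)"
            using t by (simp add: dquot_def field_simps)
          then show ?thesis using d(2)[of t w] t w by (simp add: abs_mult)
        qed
        have 3: "\<bar>t * (g \<bullet> w) - t * (g \<bullet> y)\<bar> \<le> t * (norm g * k)"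
        proof -
          have "\<bar>g \<bullet> (w - y)\<bar> \<le> norm g * norm (w - y)" by (rule Cauchy_Schwarz_ineq2)
          also have "\<dots> \<le> norm g * k" using w by (intro mult_left_mono) (auto simp: norm_minus_commute)
          finally have "t * \<bar>g \<bullet> (w - y)\<bar> \<le> t * (norm g * k)" using t by simp
          moreover have "t * (g \<bullet> w) - t * (g \<bullet> y) = t * (g \<bullet> (w - y))" by (simp add: inner_diff_right algebra_simps)
          ultimately show ?thesis using t by (simp add: abs_mult)
        qed
        have "\<bar>f (x + h) - f x - g \<bullet> h\<bar> \<le> t * (L * k) + t * (e / 4) + t * (norm g * k)"
          using 1 2 3 unfolding hy inner_scaleR_right by linarith
        also have "\<dots> = t * ((L + norm g) * k + e / 4)" by (simp add: algebra_simps)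
        also have "\<dots> \<le> t * (e / 4 + e / 4)" using kb t by (intro mult_left_mono) auto
        also have "\<dots> < t * e" using t e by simp
        finally show ?thesis using t by (simp add: t_def divide_less_eq mult.commute)
      qed
      then show "\<forall>\<^sub>F h in at 0. dist (norm (f (x + h) - f x - g \<bullet> h) / norm h) 0 < e"
        using d(1) by (auto simp: eventually_at intro!: exI[of _ d])
    qed
    then show ?case
      unfolding has_derivative_at g_def by (intro conjI bounded_linear_inner_right)
  qed
qed

text \<open>Translation invariance moves a difference quotient from \<open>\<phi>\<close> to
  \<open>f\<close> and reverses its direction. The identity is exact for each increment and passes
  to the limit because the quotients converge in \<open>L^1\<close> and the other factor is
  bounded.\<close>

lemma lipschitz_integration_by_parts:
  fixes f \<phi> :: "'a::euclidean_space \<Rightarrow> real"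
  assumes f: "L-lipschitz_on UNIV f" and fout: "\<forall>x. R < norm x \<longrightarrow> f x = 0"
    and \<phi>: "B-lipschitz_on UNIV \<phi>" and \<phi>out: "\<forall>x. R < norm x \<longrightarrow> \<phi> x = 0"
  shows "(\<integral>x. f x * ddir \<phi> w x \<partial>lborel) = - (\<integral>x. \<phi> x * ddir f w x \<partial>lborel)"
proof -
  \<comment> \<open>Stated for a general pair of functions because it is used twice, with the roles
    of \<open>f\<close> and \<open>\<phi>\<close> exchanged and the direction reversed.\<close>
  have conv: "integrable lborel (\<lambda>x. a x * dquot b z x (1 / Suc n))"
     "(\<lambda>n. \<integral>x. a x * dquot b z x (1 / Suc n) \<partial>lborel) \<longlonglongrightarrow> (\<integral>x. a x * ddir b z x \<partial>lborel)"
    if a: "A-lipschitz_on UNIV a" and aout: "\<forall>x. R < norm x \<longrightarrow> a x = 0"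
      and b: "C-lipschitz_on UNIV b" and bout: "\<forall>x. R < norm x \<longrightarrow> b x = 0"
    for a b :: "'a \<Rightarrow> real" and A C z n
  proof -
    have [measurable]: "a \<in> borel_measurable borel" "b \<in> borel_measurable borel"
      using a b by (auto intro: lipschitz_borel_measurable)
    have "continuous_on (cball 0 R) a"
      using continuous_on_subset[OF lipschitz_on_continuous_on[OF a]] by blast
    then have "bounded (a ` cball 0 R)" by (intro compact_imp_bounded compact_continuous_image) auto
    then obtain K0 where "\<forall>y\<in>a ` cball 0 R. norm y \<le> K0" unfolding bounded_iff by blast
    then have aK: "\<bar>a x\<bar> \<le> max K0 0" for x
      using aout by (cases "norm x \<le> R") (auto simp: le_max_iff_disj)
    let ?K = "max K0 0"
    note L1 = lipschitz_supp_dquot_L1[OF b bout]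
    have bnd: "norm (a x * y) \<le> norm (?K * y)" for x y
      using aK[of x] by (simp add: abs_mult mult_right_mono)
    show int: "integrable lborel (\<lambda>x. a x * dquot b z x (1 / Suc n))" for n
      by (rule Bochner_Integration.integrable_bound[OF integrable_mult_right[OF L1(3), of ?K]]) (use bnd in auto)
    have intd: "integrable lborel (\<lambda>x. a x * ddir b z x)"
      by (rule Bochner_Integration.integrable_bound[OF integrable_mult_right[OF L1(1), of ?K]]) (use bnd in auto)
    show "(\<lambda>n. \<integral>x. a x * dquot b z x (1 / Suc n) \<partial>lborel) \<longlonglongrightarrow> (\<integral>x. a x * ddir b z x \<partial>lborel)"
    proof (rule tendsto_L1_int[OF int intd])
      have "(\<lambda>n. ennreal ?K * (\<integral>\<^sup>+x. ennreal \<bar>dquot b z x (1 / Suc n) - ddir b z x\<bar> \<partial>lborel)) \<longlonglongrightarrow> ennreal ?K * 0"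
        by (intro ennreal_tendsto_cmult L1(2)) auto
      then have lim: "(\<lambda>n. ennreal ?K * (\<integral>\<^sup>+x. ennreal \<bar>dquot b z x (1 / Suc n) - ddir b z x\<bar> \<partial>lborel)) \<longlonglongrightarrow> 0" by simp
      have le: "(\<integral>\<^sup>+x. norm (a x * dquot b z x (1 / Suc n) - a x * ddir b z x) \<partial>lborel)
        \<le> ennreal ?K * (\<integral>\<^sup>+x. ennreal \<bar>dquot b z x (1 / Suc n) - ddir b z x\<bar> \<partial>lborel)" for n
      proof -
        have "(\<integral>\<^sup>+x. norm (a x * dquot b z x (1 / Suc n) - a x * ddir b z x) \<partial>lborel)
          \<le> (\<integral>\<^sup>+x. ennreal ?K * ennreal \<bar>dquot b z x (1 / Suc n) - ddir b z x\<bar> \<partial>lborel)"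
          using bnd by (intro nn_integral_mono) (simp flip: ennreal_mult right_diff_distrib add: abs_mult)
        also have "\<dots> = ennreal ?K * (\<integral>\<^sup>+x. ennreal \<bar>dquot b z x (1 / Suc n) - ddir b z x\<bar> \<partial>lborel)"
          by (intro nn_integral_cmult) measurable
        finally show ?thesis .
      qed
      show "(\<lambda>n. \<integral>\<^sup>+x. norm (a x * dquot b z x (1 / Suc n) - a x * ddir b z x) \<partial>lborel) \<longlonglongrightarrow> 0"
        by (rule tendsto_sandwich[OF _ _ tendsto_const lim]) (use le in auto)
    qed
  qed
  have cont: "continuous_on UNIV f" "continuous_on UNIV \<phi>"
    using f \<phi> lipschitz_on_continuous_on by blast+
  have mf[measurable]: "f \<in> borel_measurable borel" "\<phi> \<in> borel_measurable borel"
    using f \<phi> by (auto intro: lipschitz_borel_measurable)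
  have eq: "(\<integral>x. f x * dquot \<phi> w x (1 / Suc n) \<partial>lborel) = (\<integral>x. \<phi> x * dquot f (- w) x (1 / Suc n) \<partial>lborel)" for n
  proof -
    define t where "t = 1 / real (Suc n)"
    have t: "t \<noteq> 0" by (simp add: t_def)
    have prod_int: "integrable lborel (\<lambda>x. f (x - c) * \<phi> x)" for c
    proof -
      have "integrable lborel (\<lambda>x. indicator (cball 0 R) x *\<^sub>R (f (x - c) * \<phi> x))"
        by (intro borel_integrable_compact continuous_intros continuous_on_subset[OF cont(2)]
             continuous_on_compose2[OF cont(1)]) auto
      also have "(\<lambda>x. indicator (cball 0 R) x *\<^sub>R (f (x - c) * \<phi> x)) = (\<lambda>x. f (x - c) * \<phi> x)"
        using \<phi>out by (intro ext) (auto simp: indicator_def not_le)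
      finally show ?thesis .
    qed
    have sh: "integrable lborel (\<lambda>x. f x * \<phi> (x + t *\<^sub>R w))"
      "(\<integral>x. f x * \<phi> (x + t *\<^sub>R w) \<partial>lborel) = (\<integral>x. f (x - t *\<^sub>R w) * \<phi> x \<partial>lborel)"
    proof -
      have d: "lborel = distr lborel borel ((+) (t *\<^sub>R w))" by (simp add: lborel_distr_plus)
      have "integrable (distr lborel borel ((+) (t *\<^sub>R w))) (\<lambda>x. f (x - t *\<^sub>R w) * \<phi> x)"
        using prod_int by (simp add: lborel_distr_plus)
      then show "integrable lborel (\<lambda>x. f x * \<phi> (x + t *\<^sub>R w))"
        by (subst (asm) integrable_distr_eq) (auto simp: add.commute)
      show "(\<integral>x. f x * \<phi> (x + t *\<^sub>R w) \<partial>lborel) = (\<integral>x. f (x - t *\<^sub>R w) * \<phi> x \<partial>lborel)"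
        by (subst (2) d, subst integral_distr) (auto simp: add.commute)
    qed
    have "(\<integral>x. f x * dquot \<phi> w x t \<partial>lborel) = (\<integral>x. (f x * \<phi> (x + t *\<^sub>R w) - f x * \<phi> x) / t \<partial>lborel)"
      by (simp add: dquot_def algebra_simps)
    also have "\<dots> = ((\<integral>x. f x * \<phi> (x + t *\<^sub>R w) \<partial>lborel) - (\<integral>x. f x * \<phi> x \<partial>lborel)) / t"
      using sh(1) prod_int[of 0] by simp
    also have "\<dots> = ((\<integral>x. f (x - t *\<^sub>R w) * \<phi> x \<partial>lborel) - (\<integral>x. f x * \<phi> x \<partial>lborel)) / t"
      using sh(2) by simp
    also have "\<dots> = (\<integral>x. (f (x - t *\<^sub>R w) * \<phi> x - f x * \<phi> x) / t \<partial>lborel)"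
      using prod_int[of "t *\<^sub>R w"] prod_int[of 0] by simp
    also have "\<dots> = (\<integral>x. \<phi> x * dquot f (- w) x t \<partial>lborel)"
      by (simp add: dquot_def algebra_simps)
    finally show ?thesis unfolding t_def .
  qed
  have "(\<integral>x. f x * ddir \<phi> w x \<partial>lborel) = (\<integral>x. \<phi> x * ddir f (- w) x \<partial>lborel)"
    using conv(2)[OF f fout \<phi> \<phi>out, of w] conv(2)[OF \<phi> \<phi>out f fout, of "- w"] unfolding eq
    by (rule LIMSEQ_unique)
  also have "\<dots> = (\<integral>x. - (\<phi> x * ddir f w x) \<partial>lborel)"
  proof (rule integral_cong_AE)
    show "AE x in lborel. \<phi> x * ddir f (- w) x = - (\<phi> x * ddir f w x)"
      using AE_ddir_scale[OF f, of "-1" w] by eventually_elim simp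
  qed measurable
  finally show ?thesis by simp
qed

section \<open>Square roots of positive definite matrices\<close>

lemma transpose_eq_iff_self_adjoint:
  fixes S :: "real^'n^'n"
  shows "transpose S = S \<longleftrightarrow> (\<forall>x y. (S *v x) \<bullet> y = x \<bullet> (S *v y))"
proof
  assume "transpose S = S"
  then show "\<forall>x y. (S *v x) \<bullet> y = x \<bullet> (S *v y)"
    by (metis dot_lmul_matrix transpose_matrix_vector)
next
  assume *: "\<forall>x y. (S *v x) \<bullet> y = x \<bullet> (S *v y)"
  have "(transpose S *v x) \<bullet> y = (S *v x) \<bullet> y" for x y
    using * by (simp add: transpose_matrix_vector dot_lmul_matrix)
  then have "transpose S *v x = S *v x" for x using vector_eq_rdot by blast
  then show "transpose S = S" by (simp add: matrix_eq)
qed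

text \<open>The quadratic form attains a positive minimum on the compact unit sphere, and
  homogeneity extends this to all vectors.\<close>

lemma spd_coercive:
  fixes A :: "real^'n^'n"
  assumes "\<And>\<xi>. \<xi> \<noteq> 0 \<Longrightarrow> 0 < \<xi> \<bullet> (A *v \<xi>)"
  obtains l where "0 < l" "\<And>x. l * (norm x)\<^sup>2 \<le> x \<bullet> (A *v x)"
proof -
  have "continuous_on (sphere 0 1) (\<lambda>x. x \<bullet> (A *v x))" by (intro continuous_intros matrix_vector_mult_linear_continuous_on)
  moreover have "sphere (0 :: real^'n) 1 \<noteq> {}" by simp
  ultimately obtain z where z: "z \<in> sphere 0 1" "\<And>x. x \<in> sphere 0 1 \<Longrightarrow> z \<bullet> (A *v z) \<le> x \<bullet> (A *v x)"
    using continuous_attains_inf[OF compact_sphere] by blast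
  show thesis
  proof (rule that)
    show "0 < z \<bullet> (A *v z)" using z(1) by (intro assms) auto
    fix x :: "real^'n"
    show "z \<bullet> (A *v z) * (norm x)\<^sup>2 \<le> x \<bullet> (A *v x)"
    proof (cases "x = 0")
      case False
      define y where "y = x /\<^sub>R norm x"
      have "y \<in> sphere 0 1" using False by (simp add: y_def)
      have x: "x = norm x *\<^sub>R y" using False by (simp add: y_def)
      have "x \<bullet> (A *v x) = (norm x)\<^sup>2 * (y \<bullet> (A *v y))"
        by (subst (1 2) x) (simp add: matrix_vector_mult_scaleR power2_eq_square)
      then show ?thesis using mult_left_mono[OF z(2)[OF \<open>y \<in> sphere 0 1\<close>], of "(norm x)\<^sup>2"] by (simp add: mult.commute)
    qed simp
  qed
qed

text \<open>If \<open>2 X = B + X X\<close> then \<open>(1 - X)\<close> is a square root of \<open>1 - B\<close>.\<close>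

lemma blinfun_quadratic_fixed_point:
  fixes B :: "'a::euclidean_space \<Rightarrow>\<^sub>L 'a"
  assumes b: "norm B \<le> b" "b < 1" and sym: "\<And>x y. blinfun_apply B x \<bullet> y = x \<bullet> blinfun_apply B y"
  obtains X :: "'a \<Rightarrow>\<^sub>L 'a" where "norm X \<le> b" "\<And>x y. blinfun_apply X x \<bullet> y = x \<bullet> blinfun_apply X y" "\<And>x. 2 *\<^sub>R blinfun_apply X x = blinfun_apply B x + blinfun_apply X (blinfun_apply X x)"
proof -
  have b0: "0 \<le> b" using b(1) norm_ge_zero order_trans by blast
  \<comment> \<open>Self-adjoint operators of norm at most \<open>b\<close> form a complete set that
    the iteration preserves, so the fixed point inherits self-adjointness. On it the quadratic term
    has Lipschitz constant \<open>2 * b\<close>, which the factor \<open>1/2\<close> reduces to the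
    contraction constant \<open>b\<close>.\<close>
  let ?S = "{X :: 'a \<Rightarrow>\<^sub>L 'a. norm X \<le> b \<and> (\<forall>x y. blinfun_apply X x \<bullet> y = x \<bullet> blinfun_apply X y)}"
  let ?F = "\<lambda>X. (1/2) *\<^sub>R (B + (X o\<^sub>L X))"
  have "closed ?S"
    by (intro closed_Collect_conj closed_Collect_all closed_Collect_le closed_Collect_eq continuous_intros)
  then have "complete ?S" by (simp add: complete_eq_closed)
  moreover have "?S \<noteq> {}" using b0 by (auto intro!: exI[of _ 0])
  moreover have "?F ` ?S \<subseteq> ?S"
  proof (rule image_subsetI)
    fix X :: "'a \<Rightarrow>\<^sub>L 'a" assume "X \<in> ?S"
    then have X: "norm X \<le> b" "\<forall>x y. blinfun_apply X x \<bullet> y = x \<bullet> blinfun_apply X y" by auto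
    have "norm (B + (X o\<^sub>L X)) \<le> norm B + norm (X o\<^sub>L X)" by (rule norm_triangle_ineq)
    also have "\<dots> \<le> b + norm X * norm X" using b norm_blinfun_compose[of X X] by (intro add_mono)
    also have "norm X * norm X \<le> b * 1" using X b b0 by (intro mult_mono) auto
    finally have "norm (B + (X o\<^sub>L X)) \<le> 2 * b" by simp
    moreover have "blinfun_apply (B + (X o\<^sub>L X)) x \<bullet> y = x \<bullet> blinfun_apply (B + (X o\<^sub>L X)) y" for x y
      using X(2) by (simp add: blinfun.add_left inner_add_left inner_add_right sym)
    ultimately show "?F X \<in> ?S"
      by (simp add: blinfun.scaleR_left)
  qed
  moreover have "dist (?F X) (?F Y) \<le> b * dist X Y" if "X \<in> ?S" "Y \<in> ?S" for X Y
  proof -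
    have "?F X - ?F Y = (1/2) *\<^sub>R ((X o\<^sub>L (X - Y)) + ((X - Y) o\<^sub>L Y))"
      by (rule blinfun_eqI) (simp add: blinfun.bilinear_simps algebra_simps)
    then have "dist (?F X) (?F Y) = norm ((X o\<^sub>L (X - Y)) + ((X - Y) o\<^sub>L Y)) / 2" by (simp add: dist_norm)
    also have "norm ((X o\<^sub>L (X - Y)) + ((X - Y) o\<^sub>L Y)) \<le> norm X * norm (X - Y) + norm (X - Y) * norm Y"
      by (rule norm_triangle_le) (intro add_mono norm_blinfun_compose)
    also have "\<dots> \<le> b * norm (X - Y) + norm (X - Y) * b" using that b0 by (intro add_mono mult_mono) auto
    finally show ?thesis by (simp add: dist_norm)
  qed
  ultimately have "\<exists>!X\<in>?S. ?F X = X" using b b0 by (intro Banach_fix) auto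
  then obtain X where X: "X \<in> ?S" "?F X = X" by blast
  have "2 *\<^sub>R blinfun_apply X x = blinfun_apply B x + blinfun_apply X (blinfun_apply X x)" for x
  proof -
    have "2 *\<^sub>R blinfun_apply X x = 2 *\<^sub>R blinfun_apply (?F X) x" by (simp only: X(2))
    also have "\<dots> = blinfun_apply B x + blinfun_apply X (blinfun_apply X x)" by (simp add: blinfun.bilinear_simps)
    finally show ?thesis .
  qed
  then show thesis using X(1) that by blast
qed

text \<open>With \<open>A = c (1 - B)\<close>, where \<open>B\<close> is self-adjoint and of norm
  below 1, the root is \<open>sqrt c\<close> times \<open>1 - X\<close>, with \<open>X\<close> the
  solution of the quadratic fixed-point equation. Its positivity follows from
  \<open>norm X < 1\<close>.\<close>

lemma spd_sqrt_exists:
  fixes A :: "real^'n^'n"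
  assumes sym: "transpose A = A" and pos: "\<And>\<xi>. \<xi> \<noteq> 0 \<Longrightarrow> 0 < \<xi> \<bullet> (A *v \<xi>)"
  obtains S where "transpose S = S" "\<And>\<xi>. \<xi> \<noteq> 0 \<Longrightarrow> 0 < \<xi> \<bullet> (S *v \<xi>)" "S ** S = A"
proof -
  obtain l where l: "0 < l" "\<And>x. l * (norm x)\<^sup>2 \<le> x \<bullet> (A *v x)" using spd_coercive[of A] pos by blast
  have bl: "bounded_linear (\<lambda>x. A *v x)" by (rule matrix_vector_mul_bounded_linear)
  obtain K where K: "0 < K" "\<And>x. norm (A *v x) \<le> norm x * K" using bounded_linear.pos_bounded[OF bl] by blast
  \<comment> \<open>This \<open>c\<close> minimises the bound \<open>1 - 2 l / c + K^2 / c^2\<close>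
    on the squared norm of \<open>B\<close>; the minimum is \<open>1 - l^2 / K^2\<close>.\<close>
  define c where "c = K\<^sup>2 / l"
  have c: "0 < c" using K l by (simp add: c_def)
  define B where "B = Blinfun (\<lambda>x. x - (1 / c) *\<^sub>R (A *v x))"
  have B: "blinfun_apply B x = x - (1 / c) *\<^sub>R (A *v x)" for x
    unfolding B_def by (subst bounded_linear_Blinfun_apply) (auto intro!: bounded_linear_intros bl)
  \<comment> \<open>\<open>max 0\<close> keeps the radicand nonnegative without first comparing
    \<open>l\<close> with \<open>K\<close>.\<close>
  define b where "b = sqrt (max 0 (1 - l\<^sup>2 / K\<^sup>2))"
  have b1: "b < 1" unfolding b_def using l K by (simp add: real_sqrt_lt_1_iff)
  have nB: "norm B \<le> b"
  proof (rule norm_blinfun_bound)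
    show "0 \<le> b" by (simp add: b_def)
    fix x :: "real^'n"
    have "(norm (blinfun_apply B x))\<^sup>2 = (norm x)\<^sup>2 - 2 / c * (x \<bullet> (A *v x)) + (norm (A *v x))\<^sup>2 / c\<^sup>2"
      unfolding B power2_norm_eq_inner
      by (simp add: inner_diff_left inner_diff_right inner_commute power2_eq_square algebra_simps)
    also have "\<dots> \<le> (norm x)\<^sup>2 - 2 / c * (l * (norm x)\<^sup>2) + (norm x * K)\<^sup>2 / c\<^sup>2"
      using c l(2)[of x] K(2)[of x] by (intro add_mono diff_mono mult_left_mono divide_right_mono power_mono) auto
    also have "\<dots> = (1 - l\<^sup>2 / K\<^sup>2) * (norm x)\<^sup>2"
      using K l by (simp add: c_def field_simps power2_eq_square)
    also have "\<dots> \<le> max 0 (1 - l\<^sup>2 / K\<^sup>2) * (norm x)\<^sup>2" by (intro mult_right_mono) auto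
    also have "\<dots> = (b * norm x)\<^sup>2" by (simp add: b_def power_mult_distrib)
    finally show "norm (blinfun_apply B x) \<le> b * norm x" by (rule power2_le_imp_le) (simp add: b_def)
  qed
  have symA: "(A *v x) \<bullet> y = x \<bullet> (A *v y)" for x y using sym transpose_eq_iff_self_adjoint by blast
  have symB: "blinfun_apply B x \<bullet> y = x \<bullet> blinfun_apply B y" for x y by (simp add: B inner_diff_left inner_diff_right symA)
  obtain X where X: "norm X \<le> b" "\<And>x y. blinfun_apply X x \<bullet> y = x \<bullet> blinfun_apply X y"
    "\<And>x. 2 *\<^sub>R blinfun_apply X x = blinfun_apply B x + blinfun_apply X (blinfun_apply X x)"
    using blinfun_quadratic_fixed_point[OF nB b1 symB] by blast
  define f where "f x = sqrt c *\<^sub>R (x - blinfun_apply X x)" for x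
  have lin: "linear f" unfolding f_def by (intro bounded_linear.linear bounded_linear_intros)
  define S where "S = matrix f"
  have S: "S *v x = f x" for x unfolding S_def using lin by (simp add: matrix_works linear_matrix_vector_mul_eq)
  show thesis
  proof (rule that)
    show "transpose S = S"
      unfolding transpose_eq_iff_self_adjoint S f_def by (simp add: inner_diff_left inner_diff_right X(2))
    show "0 < \<xi> \<bullet> (S *v \<xi>)" if "\<xi> \<noteq> 0" for \<xi>
    proof -
      have "\<xi> \<bullet> blinfun_apply X \<xi> \<le> norm \<xi> * (norm X * norm \<xi>)"
        by (rule order_trans[OF norm_cauchy_schwarz mult_left_mono[OF norm_blinfun]]) simp
      also have "\<dots> \<le> norm \<xi> * (b * norm \<xi>)" using X(1) by (intro mult_left_mono mult_right_mono) auto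
      also have "\<dots> < norm \<xi> * (1 * norm \<xi>)" using b1 that by (intro mult_strict_left_mono mult_strict_right_mono) auto
      also have "\<dots> = \<xi> \<bullet> \<xi>" by (simp add: power2_norm_eq_inner[symmetric] power2_eq_square)
      finally show ?thesis using c by (simp add: S f_def inner_diff_right)
    qed
    have "f (f x) = A *v x" for x
    proof -
      have "f (f x) = c *\<^sub>R (x - 2 *\<^sub>R blinfun_apply X x + blinfun_apply X (blinfun_apply X x))"
        using c by (simp add: f_def blinfun.bilinear_simps scaleR_diff_right algebra_simps scaleR_2)
      also have "\<dots> = c *\<^sub>R (x - blinfun_apply B x)" by (simp add: X(3))
      also have "\<dots> = A *v x" using c by (simp add: B)
      finally show ?thesis .
    qed
    then show "S ** S = A" by (simp add: matrix_eq S flip: matrix_vector_mul_assoc)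
  qed
qed

text \<open>Makes signs visible: if the quadratic form of \<open>S\<close> is nonnegative, every
  term on the right is nonnegative.\<close>

lemma trace_sandwich:
  fixes D S :: "real^'n^'n"
  assumes "transpose D = D"
  shows "trace (D ** S ** D) = (\<Sum>i\<in>UNIV. (D *v axis i 1) \<bullet> (S *v (D *v axis i 1)))"
proof -
  have "(D ** S ** D) $ i $ i = axis i 1 \<bullet> ((D ** S ** D) *v axis i 1)" for i
    by (simp add: matrix_vector_mult_basis column_def inner_axis' )
  also have "axis i 1 \<bullet> ((D ** S ** D) *v axis i 1) = (D *v axis i 1) \<bullet> (S *v (D *v axis i 1))" for i
    using assms transpose_eq_iff_self_adjoint[of D] by (simp flip: matrix_vector_mul_assoc)
  finally show ?thesis by (simp add: trace_def)
qed

text \<open>With \<open>D = S - R\<close> one has \<open>S D + D R = 0\<close>, and the traces of \<open>D S D\<close> and \<open>D R D\<close> are nonnegative.\<close>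

lemma psd_sqrt_unique:
  fixes S R :: "real^'n^'n"
  assumes S: "transpose S = S" "\<And>\<xi>. \<xi> \<noteq> 0 \<Longrightarrow> 0 < \<xi> \<bullet> (S *v \<xi>)"
    and R: "transpose R = R" "\<And>\<xi>. 0 \<le> \<xi> \<bullet> (R *v \<xi>)" and eq: "S ** S = R ** R"
  shows "R = S"
proof -
  define D where "D = S - R"
  have D: "transpose D = D" using S(1) R(1) by (simp add: D_def transpose_def vec_eq_iff)
  have "S ** D + D ** R = 0"
  proof -
    have "S *v (S *v x) = R *v (R *v x)" for x using eq by (simp add: matrix_vector_mul_assoc)
    then show ?thesis
      by (simp add: matrix_eq D_def matrix_vector_mult_add_rdistrib matrix_vector_mult_diff_rdistrib
          matrix_vector_mult_diff_distrib flip: matrix_vector_mul_assoc)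
  qed
  then have "D ** (S ** D) + D ** (D ** R) = 0"
  proof -
    have "D ** 0 = 0" by (simp add: matrix_eq flip: matrix_vector_mul_assoc)
    then show ?thesis using \<open>S ** D + D ** R = 0\<close> by (metis matrix_add_ldistrib)
  qed
  then have "trace (D ** (S ** D)) + trace (D ** (D ** R)) = 0" by (metis trace_add trace_0 mat_0)
  moreover have "trace (D ** (D ** R)) = trace (D ** R ** D)" by (metis trace_mul_sym matrix_mul_assoc)
  ultimately have "trace (D ** S ** D) + trace (D ** R ** D) = 0" by (simp add: matrix_mul_assoc)
  then have "(\<Sum>i\<in>UNIV. (D *v axis i 1) \<bullet> (S *v (D *v axis i 1)) + (D *v axis i 1) \<bullet> (R *v (D *v axis i 1))) = 0"
    by (simp add: trace_sandwich[OF D] sum.distrib)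
  moreover have S0: "0 \<le> \<xi> \<bullet> (S *v \<xi>)" for \<xi> using S(2)[of \<xi>] by (cases "\<xi> = 0") auto
  ultimately have "(D *v axis i 1) \<bullet> (S *v (D *v axis i 1)) + (D *v axis i 1) \<bullet> (R *v (D *v axis i 1)) = 0" for i
    by (subst (asm) sum_nonneg_eq_0_iff) (auto intro!: add_nonneg_nonneg R(2))
  then have "D *v axis i 1 = 0" for i
    using S(2)[of "D *v axis i 1"] R(2)[of "D *v axis i 1"] by (smt (verit))
  then have "column i D = 0" for i by (simp add: matrix_vector_mult_basis)
  then have "D = 0" by (simp add: column_def vec_eq_iff)
  then show ?thesis by (simp add: D_def)
qed

text \<open>\<open>msqrt\<close> is a definite description, so existence and uniqueness among
  symmetric positive semidefinite roots must both be known before it can be used.\<close>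

lemma msqrt_spd:
  fixes A :: "real^'n^'n"
  assumes sym: "transpose A = A" and pos: "\<forall>\<xi>. \<xi> \<noteq> 0 \<longrightarrow> 0 < \<xi> \<bullet> (A *v \<xi>)"
  shows "transpose (msqrt A) = msqrt A" "msqrt A ** msqrt A = A"
proof -
  obtain S where S: "transpose S = S" "\<And>\<xi>. \<xi> \<noteq> 0 \<Longrightarrow> 0 < \<xi> \<bullet> (S *v \<xi>)" "S ** S = A"
    using spd_sqrt_exists[OF sym] pos by blast
  have "\<exists>!S. transpose S = S \<and> (\<forall>\<xi>. 0 \<le> \<xi> \<bullet> (S *v \<xi>)) \<and> S ** S = A"
  proof (rule ex1I[of _ S])
    have "0 \<le> \<xi> \<bullet> (S *v \<xi>)" for \<xi> using S(2)[of \<xi>] by (cases "\<xi> = 0") auto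
    then show "transpose S = S \<and> (\<forall>\<xi>. 0 \<le> \<xi> \<bullet> (S *v \<xi>)) \<and> S ** S = A" using S by blast
    fix R assume "transpose R = R \<and> (\<forall>\<xi>. 0 \<le> \<xi> \<bullet> (R *v \<xi>)) \<and> R ** R = A"
    then show "R = S" using psd_sqrt_unique[of S R] S by metis
  qed
  from theI'[OF this] show "transpose (msqrt A) = msqrt A" "msqrt A ** msqrt A = A"
    unfolding msqrt_def by blast+
qed

text \<open>Equals \<open>|\<surd>A g|\<close>, but is visibly measurable in \<open>A\<close>.\<close>

definition qnorm :: "real^'n^'n \<Rightarrow> real^'n \<Rightarrow> real" where
  "qnorm A g = sqrt (g \<bullet> (A *v g))"

lemma norm_msqrt_eq_qnorm:
  assumes "transpose A = A" "\<forall>\<xi>. \<xi> \<noteq> 0 \<longrightarrow> 0 < \<xi> \<bullet> (A *v \<xi>)"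
  shows "norm (msqrt A *v g) = qnorm A g"
proof -
  have "(msqrt A *v g) \<bullet> (msqrt A *v g) = g \<bullet> (A *v g)"
    using msqrt_spd[OF assms] by (metis matrix_vector_mul_assoc transpose_eq_iff_self_adjoint)
  then show ?thesis by (simp add: qnorm_def norm_eq_sqrt_inner)
qed

section \<open>Lipschitz functions with compact support\<close>

text \<open>Lebesgue measure is complete, and the preimages under \<open>f\<close> differ from those
  under \<open>g\<close> only by null sets.\<close>

lemma borel_measurable_lebesgue_AE:
  fixes f :: "'a::euclidean_space \<Rightarrow> 'b::topological_space"
  assumes g: "g \<in> borel_measurable borel" and eq: "AE x in lborel. f x = g x"
  shows "f \<in> borel_measurable lebesgue"
proof (rule measurableI)
  fix A :: "'b set" assume A: "A \<in> sets borel"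
  have "AE x in lebesgue. x \<in> g -` A \<longleftrightarrow> x \<in> f -` A"
    using AE_completion[OF eq] by eventually_elim simp
  moreover have "g -` A \<in> sets lebesgue" using measurable_sets_borel[OF g A] by simp
  ultimately have "f -` A \<in> sets lebesgue" by (rule completion.in_sets_AE) simp
  then show "f -` A \<inter> space lebesgue \<in> sets lebesgue" by simp
qed simp

lemma integral_lebesgue_AE_borel:
  fixes f g :: "'a::euclidean_space \<Rightarrow> 'b::{banach,second_countable_topology}"
  assumes g: "g \<in> borel_measurable borel" and eq: "AE x in lborel. f x = g x"
  shows "(\<integral>x. f x \<partial>lebesgue) = (\<integral>x. g x \<partial>lborel)"
    and "integrable lebesgue f \<longleftrightarrow> integrable lborel g"
proof -
  have f: "f \<in> borel_measurable lebesgue" by (rule borel_measurable_lebesgue_AE[OF g eq])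
  have g': "g \<in> borel_measurable lebesgue" using g by (intro measurable_completion) simp
  show "(\<integral>x. f x \<partial>lebesgue) = (\<integral>x. g x \<partial>lborel)"
    using integral_cong_AE[OF f g' AE_completion[OF eq]] integral_completion[of g lborel] g by simp
  show "integrable lebesgue f \<longleftrightarrow> integrable lborel g"
    using integrable_cong_AE[OF f g' AE_completion[OF eq]] integrable_completion[of g lborel] g by simp
qed

lemma nn_integral_lebesgue_on:
  fixes f :: "'a::euclidean_space \<Rightarrow> ennreal"
  assumes "\<Omega> \<in> sets lebesgue"
  shows "(\<integral>\<^sup>+x. f x \<partial>lebesgue_on \<Omega>) = (\<integral>\<^sup>+x. f x * indicator \<Omega> x \<partial>lborel)"
  using assms by (simp add: nn_integral_restrict_space nn_integral_completion)

lemma AE_lebesgue_on_iff: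
  fixes \<Omega> :: "'a::euclidean_space set"
  assumes "\<Omega> \<in> sets lebesgue"
  shows "(AE x in lebesgue_on \<Omega>. P x) \<longleftrightarrow> (AE x in lborel. x \<in> \<Omega> \<longrightarrow> P x)"
  using assms by (simp add: AE_restrict_space_iff AE_completion_iff)

lemma lipcE:
  assumes "lipc \<Omega> f"
  obtains L R K where "L-lipschitz_on UNIV f" "\<forall>x. R < norm x \<longrightarrow> f x = 0"
    "compact K" "K \<subseteq> \<Omega>" "\<forall>x. x \<notin> K \<longrightarrow> f x = 0"
proof -
  obtain L K where *: "L-lipschitz_on UNIV f" "compact K" "K \<subseteq> \<Omega>" "\<forall>x. x \<notin> K \<longrightarrow> f x = 0"
    using assms by (auto simp: lipc_def csupp_in_def)
  obtain R where "\<forall>x\<in>K. norm x \<le> R" using compact_imp_bounded[OF *(2)] by (auto simp: bounded_iff)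
  then have "\<forall>x. R < norm x \<longrightarrow> f x = 0" using *(4) by force
  then show ?thesis using that * by blast
qed

lemma grad_eqI:
  assumes "(f has_derivative (\<lambda>h. g \<bullet> h)) (at x)"
  shows "grad f x = g"
proof -
  have "(f has_derivative (\<lambda>h. grad f x \<bullet> h)) (at x)"
    unfolding grad_def using assms by (rule someI)
  then have "(\<lambda>h. grad f x \<bullet> h) = (\<lambda>h. g \<bullet> h)" using assms by (rule has_derivative_unique)
  then show ?thesis by (metis vector_eq_rdot)
qed

text \<open>At a point of differentiability the derivative is unique, so the choice in
  \<open>grad\<close> has no freedom there and agrees with the Borel function
  \<open>pgrad\<close>.\<close>

lemma lipc_AE_grad:
  assumes "lipc \<Omega> f"
  shows "AE x in lborel. (f has_derivative (\<lambda>h. grad f x \<bullet> h)) (at x) \<and> grad f x = pgrad f x"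
proof -
  obtain L R K where "L-lipschitz_on UNIV f" "\<forall>x. R < norm x \<longrightarrow> f x = 0" using lipcE[OF assms] by metis
  from rademacher_compact_support[OF this] show ?thesis
    by eventually_elim (use grad_eqI in metis)
qed

lemma lipc_grad_measurable: "lipc \<Omega> f \<Longrightarrow> grad f \<in> borel_measurable lebesgue"
  by (rule borel_measurable_lebesgue_AE[of "pgrad f"])
     (use lipc_AE_grad in \<open>auto intro!: pgrad_measurable elim: lipcE intro: lipschitz_borel_measurable\<close>)

lemma lipc_measurable: "lipc \<Omega> f \<Longrightarrow> f \<in> borel_measurable borel"
  by (auto elim: lipcE intro: lipschitz_borel_measurable)

lemma lipc_bounded:
  assumes "lipc \<Omega> f"
  obtains B where "0 \<le> B" "\<And>x. \<bar>f x\<bar> \<le> B"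
proof -
  obtain L R K where *: "L-lipschitz_on UNIV f" "compact K" "\<forall>x. x \<notin> K \<longrightarrow> f x = 0" using lipcE[OF assms] by metis
  have "continuous_on K f"
    using continuous_on_subset[OF lipschitz_on_continuous_on[OF *(1)]] by blast
  then have "bounded (f ` K)" using *(2) by (intro compact_imp_bounded compact_continuous_image)
  then obtain K0 where K0: "\<forall>x\<in>K. \<bar>f x\<bar> \<le> K0" unfolding bounded_iff by auto
  have "\<bar>f x\<bar> \<le> max K0 0" for x using K0 *(3) by (cases "x \<in> K") (auto simp: le_max_iff_disj)
  then show ?thesis using that[of "max K0 0"] by simp
qed

lemma lipc_grad_bounded:
  assumes "lipc \<Omega> f"
  obtains B where "0 \<le> B" "AE x in lborel. norm (grad f x) \<le> B"
proof -
  obtain L R K where L: "L-lipschitz_on UNIV f" "\<forall>x. R < norm x \<longrightarrow> f x = 0" using lipcE[OF assms] by metis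
  have "AE x in lborel. \<forall>i\<in>Basis. \<bar>ddir f i x\<bar> \<le> L"
  proof (intro AE_finite_allI finite_Basis)
    fix i :: "real^'a" assume "i \<in> Basis"
    then show "AE x in lborel. \<bar>ddir f i x\<bar> \<le> L"
      using AE_ddir_bound[OF L(1), of i] by simp
  qed
  then have "AE x in lborel. norm (grad f x) \<le> (\<Sum>i\<in>(Basis :: (real^'a) set). L)"
    using lipc_AE_grad[OF assms]
  proof eventually_elim
    case (elim x)
    have "norm (pgrad f x) \<le> (\<Sum>i\<in>Basis. norm (ddir f i x *\<^sub>R i))" unfolding pgrad_def by (rule norm_sum)
    also have "\<dots> \<le> (\<Sum>i\<in>(Basis :: (real^'a) set). L)" using elim(1) by (intro sum_mono) auto
    finally show ?case using elim(2) by simp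
  qed
  moreover have "0 \<le> (\<Sum>i\<in>(Basis :: (real^'a) set). L)" using lipschitz_on_nonneg[OF L(1)] by (intro sum_nonneg)
  ultimately show ?thesis using that by blast
qed

lemma grad_zero_outside:
  assumes "closed K" "\<forall>x. x \<notin> K \<longrightarrow> f x = 0" "x \<notin> K"
  shows "grad f x = 0"
proof (rule grad_eqI)
  have "((\<lambda>_. 0) has_derivative (\<lambda>h. 0 \<bullet> h)) (at x)" by simp
  then show "(f has_derivative (\<lambda>h. 0 \<bullet> h)) (at x)"
    by (rule has_derivative_transform_within_open[of _ _ _ _ "- K"]) (use assms in auto)
qed

text \<open>The gradient is continuous and vanishes outside the compact support, hence is bounded,
  and the mean value inequality applies. Test functions thus fall under the results on Lipschitz
  functions.\<close>

lemma C1c_test_lipschitz: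
  assumes "C1c_test \<Omega> \<phi> d\<phi>"
  obtains B where "B-lipschitz_on UNIV \<phi>"
proof -
  obtain K where d: "\<And>x. (\<phi> has_derivative (\<lambda>h. d\<phi> x \<bullet> h)) (at x)" and c: "continuous_on UNIV d\<phi>"
    and K: "compact K" "\<forall>x. x \<notin> K \<longrightarrow> \<phi> x = 0"
    using assms by (auto simp: C1c_test_def csupp_in_def)
  have "bounded (d\<phi> ` K)" using K(1) c by (intro compact_imp_bounded compact_continuous_image) (auto intro: continuous_on_subset)
  then obtain K0 where K0: "\<forall>x\<in>K. norm (d\<phi> x) \<le> K0" unfolding bounded_iff by auto
  have "d\<phi> x = 0" if "x \<notin> K" for x
    using grad_zero_outside[OF compact_imp_closed[OF K(1)] K(2) that] grad_eqI[OF d] by simp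
  then have B: "norm (d\<phi> x) \<le> max K0 0" for x using K0 by (cases "x \<in> K") (auto simp: le_max_iff_disj)
  have "norm (\<phi> x - \<phi> y) \<le> max K0 0 * norm (x - y)" for x y
  proof (rule differentiable_bound[of UNIV \<phi> "\<lambda>x h. d\<phi> x \<bullet> h"])
    show "onorm ((\<bullet>) (d\<phi> x)) \<le> max K0 0" for x
      by (rule onorm_bound) (use B[of x] in \<open>auto intro!: order_trans[OF Cauchy_Schwarz_ineq2] mult_right_mono\<close>)
  qed (use d in auto)
  then have "(max K0 0)-lipschitz_on UNIV \<phi>" by (intro lipschitz_onI) (auto simp: dist_norm)
  then show ?thesis using that by blast
qed

lemma bounded_supp_integrable:
  fixes f :: "'a::euclidean_space \<Rightarrow> 'b::{banach,second_countable_topology}"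
  assumes f: "f \<in> borel_measurable lebesgue" and K: "compact K" and out: "\<forall>x. x \<notin> K \<longrightarrow> f x = 0"
    and b: "AE x in lborel. norm (f x) \<le> B"
  shows "integrable lebesgue f"
proof -
  have "integrable lborel (\<lambda>x. B * indicator K x)" using emeasure_compact_finite[OF K] K by (auto simp: compact_imp_closed)
  then have "integrable lebesgue (\<lambda>x. B * indicator K x)"
    using K by (subst integrable_completion) (auto simp: compact_imp_closed)
  then show ?thesis
  proof (rule Bochner_Integration.integrable_bound[OF _ f])
    show "AE x in lebesgue. norm (f x) \<le> norm (B * indicator K x)"
      using AE_completion[OF b] by eventually_elim (use out in \<open>auto simp: indicator_def\<close>)
  qed
qed

text \<open>\<open>H0\<close> demands the weak gradient identity of its members. For Lipschitz
  functions it is integration by parts in each coordinate, after \<open>grad\<close> has been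
  exchanged for directional derivatives almost everywhere.\<close>

lemma lipc_weak_gradient:
  fixes f :: "real^'n \<Rightarrow> real"
  assumes f: "lipc \<Omega> f" and \<Omega>: "open \<Omega>"
  shows "weak_gradient \<Omega> f (grad f)"
  unfolding weak_gradient_def
proof (intro conjI allI impI)
  obtain L R K where L: "L-lipschitz_on UNIV f" "\<forall>x. R < norm x \<longrightarrow> f x = 0"
    and K: "compact K" "K \<subseteq> \<Omega>" "\<forall>x. x \<notin> K \<longrightarrow> f x = 0" using lipcE[OF f] by metis
  obtain B1 where B1: "0 \<le> B1" "\<And>x. \<bar>f x\<bar> \<le> B1" using lipc_bounded[OF f] by blast
  obtain B2 where B2: "0 \<le> B2" "AE x in lborel. norm (grad f x) \<le> B2" using lipc_grad_bounded[OF f] by blast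
  note fm[measurable] = lipc_measurable[OF f] and gm[measurable] = lipc_grad_measurable[OF f]
  have fl: "f \<in> borel_measurable lebesgue" using fm by (intro measurable_completion) simp
  have gout: "\<forall>x. x \<notin> K \<longrightarrow> grad f x = 0" using grad_zero_outside[OF compact_imp_closed[OF K(1)] K(3)] by blast
  have \<Omega>l: "\<Omega> \<in> sets lebesgue" using \<Omega> by (simp add: borel_open)
  have loc: "loc_integrable \<Omega> h" if h: "integrable lebesgue h" for h :: "real^'n \<Rightarrow> 'c::{banach,second_countable_topology}"
    unfolding loc_integrable_def
  proof (intro allI impI)
    fix K' assume "compact K' \<and> K' \<subseteq> \<Omega>"
    then have "K' \<in> sets lebesgue" by (simp add: compact_imp_closed)
    then show "integrable (lebesgue_on K') h" using h
      by (subst integrable_restrict_space) (auto intro: integrable_mult_indicator)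
  qed
  show "loc_integrable \<Omega> f"
    by (rule loc, rule bounded_supp_integrable[OF fl K(1) K(3), of B1]) (use B1 in auto)
  show "loc_integrable \<Omega> (grad f)"
    by (rule loc, rule bounded_supp_integrable[OF gm K(1) gout B2(2)])
  fix \<phi> d\<phi> assume t: "C1c_test \<Omega> \<phi> d\<phi>"
  obtain B where B: "B-lipschitz_on UNIV \<phi>" using C1c_test_lipschitz[OF t] by blast
  obtain K' where d: "\<And>x. (\<phi> has_derivative (\<lambda>h. d\<phi> x \<bullet> h)) (at x)" and c: "continuous_on UNIV d\<phi>"
    and K': "compact K'" "K' \<subseteq> \<Omega>" "\<forall>x. x \<notin> K' \<longrightarrow> \<phi> x = 0"
    using t by (auto simp: C1c_test_def csupp_in_def)
  have \<phi>l: "lipc \<Omega> \<phi>" using B K' by (auto simp: lipc_def csupp_in_def)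
  obtain C1 where C1: "0 \<le> C1" "\<And>x. \<bar>\<phi> x\<bar> \<le> C1" using lipc_bounded[OF \<phi>l] by blast
  have gr\<phi>: "grad \<phi> = d\<phi>" using grad_eqI[OF d] by blast
  obtain C2 where C2: "0 \<le> C2" "AE x in lborel. norm (d\<phi> x) \<le> C2" using lipc_grad_bounded[OF \<phi>l] unfolding gr\<phi> by blast
  have \<phi>m[measurable]: "\<phi> \<in> borel_measurable borel" by (rule lipc_measurable[OF \<phi>l])
  have d\<phi>m[measurable]: "d\<phi> \<in> borel_measurable borel" using c by (rule borel_measurable_continuous_onI)
  have \<phi>ml: "\<phi> \<in> borel_measurable lebesgue" "d\<phi> \<in> borel_measurable lebesgue"
    by (intro measurable_completion; simp)+
  have i1: "integrable lebesgue (\<lambda>x. f x *\<^sub>R d\<phi> x)"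
  proof (rule bounded_supp_integrable[OF _ K(1), of _ "B1 * C2"])
    show "(\<lambda>x. f x *\<^sub>R d\<phi> x) \<in> borel_measurable lebesgue" using fl \<phi>ml by measurable
    show "AE x in lborel. norm (f x *\<^sub>R d\<phi> x) \<le> B1 * C2"
      using C2(2) by eventually_elim (use B1 C2(1) in \<open>auto intro!: mult_mono\<close>)
  qed (use K(3) in auto)
  have i2: "integrable lebesgue (\<lambda>x. \<phi> x *\<^sub>R grad f x)"
  proof (rule bounded_supp_integrable[OF _ K(1), of _ "C1 * B2"])
    show "(\<lambda>x. \<phi> x *\<^sub>R grad f x) \<in> borel_measurable lebesgue" using gm \<phi>ml by measurable
    show "AE x in lborel. norm (\<phi> x *\<^sub>R grad f x) \<le> C1 * B2"
      using B2(2) by eventually_elim (use C1 B2(1) in \<open>auto intro!: mult_mono\<close>)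
  qed (use gout in auto)
  have "(\<integral>x. f x *\<^sub>R d\<phi> x \<partial>lebesgue) = - (\<integral>x. \<phi> x *\<^sub>R grad f x \<partial>lebesgue)"
  proof (rule euclidean_eqI)
    fix i :: "real^'n" assume i: "i \<in> Basis"
    obtain R' where R': "\<forall>x\<in>K \<union> K'. norm x \<le> R'" using compact_imp_bounded[OF compact_Un[OF K(1) K'(1)]] by (auto simp: bounded_iff)
    have o: "\<forall>x. R' < norm x \<longrightarrow> f x = 0" "\<forall>x. R' < norm x \<longrightarrow> \<phi> x = 0" using R' K(3) K'(3) by force+
    \<comment> \<open>The test function is differentiable at every point, so its directional
      derivatives are the classical ones without exceptional set.\<close>
    have "ddir \<phi> i x = d\<phi> x \<bullet> i" for x
    proof (rule ddir_eqI)
      have l: "((\<lambda>t. x + t *\<^sub>R i) has_derivative (\<lambda>t. t *\<^sub>R i)) (at 0)" by (auto intro!: derivative_eq_intros)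
      have "((\<lambda>t. \<phi> (x + t *\<^sub>R i)) has_derivative (\<lambda>t. d\<phi> x \<bullet> (t *\<^sub>R i))) (at 0)"
        by (rule has_derivative_compose[OF l]) (use d[of x] in simp)
      then have "((\<lambda>t. \<phi> (x + t *\<^sub>R i)) has_real_derivative (d\<phi> x \<bullet> i)) (at 0)"
        by (simp add: has_field_derivative_def mult_commute_abs)
      then show "(dquot \<phi> i x \<longlongrightarrow> d\<phi> x \<bullet> i) (at 0)"
        by (simp add: DERIV_def dquot_def[abs_def])
    qed
    then have 1: "(\<integral>x. f x * (d\<phi> x \<bullet> i) \<partial>lborel) = - (\<integral>x. \<phi> x * ddir f i x \<partial>lborel)"
      using lipschitz_integration_by_parts[OF L(1) o(1) B o(2), of i] by simp
    have "(\<integral>x. f x *\<^sub>R d\<phi> x \<partial>lebesgue) \<bullet> i = (\<integral>x. f x * (d\<phi> x \<bullet> i) \<partial>lebesgue)"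
      using i1 by (simp flip: integral_inner_left)
    also have "\<dots> = (\<integral>x. f x * (d\<phi> x \<bullet> i) \<partial>lborel)" by (intro integral_completion) measurable
    also note 1
    also have "(\<integral>x. \<phi> x * ddir f i x \<partial>lborel) = (\<integral>x. \<phi> x * (grad f x \<bullet> i) \<partial>lebesgue)"
    proof (rule integral_lebesgue_AE_borel(1)[symmetric])
      show "AE x in lborel. \<phi> x * (grad f x \<bullet> i) = \<phi> x * ddir f i x"
        using lipc_AE_grad[OF f] AE_ddir_eq_inner_pgrad[OF L, of i] by eventually_elim auto
    qed measurable
    also have "- (\<integral>x. \<phi> x * (grad f x \<bullet> i) \<partial>lebesgue) = (- (\<integral>x. \<phi> x *\<^sub>R grad f x \<partial>lebesgue)) \<bullet> i"
      using i2 by (simp flip: integral_inner_left)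
    finally show "(\<integral>x. f x *\<^sub>R d\<phi> x \<partial>lebesgue) \<bullet> i = (- (\<integral>x. \<phi> x *\<^sub>R grad f x \<partial>lebesgue)) \<bullet> i" .
  qed
  moreover have "(\<lambda>x. indicator \<Omega> x *\<^sub>R f x *\<^sub>R d\<phi> x) = (\<lambda>x. f x *\<^sub>R d\<phi> x)"
    using K by (intro ext) (auto simp: indicator_def)
  moreover have "(\<lambda>x. indicator \<Omega> x *\<^sub>R \<phi> x *\<^sub>R grad f x) = (\<lambda>x. \<phi> x *\<^sub>R grad f x)"
    using K' by (intro ext) (auto simp: indicator_def)
  ultimately show "(\<integral>x. f x *\<^sub>R d\<phi> x \<partial>lebesgue_on \<Omega>) = - (\<integral>x. \<phi> x *\<^sub>R grad f x \<partial>lebesgue_on \<Omega>)"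
    using \<Omega>l by (simp add: integral_restrict_space)
qed

section \<open>The degenerate Sobolev space\<close>

definition spd :: "real^'n^'n \<Rightarrow> bool" where
  "spd A \<longleftrightarrow> transpose A = A \<and> (\<forall>\<xi>. \<xi> \<noteq> 0 \<longrightarrow> 0 < \<xi> \<bullet> (A *v \<xi>))"

lemma spd_norm: "spd A \<Longrightarrow> norm (msqrt A *v g) = qnorm A g"
  by (simp add: spd_def norm_msqrt_eq_qnorm)

lemma qnorm_nonneg: "spd A \<Longrightarrow> 0 \<le> qnorm A g"
  using spd_norm norm_ge_zero by metis

lemma qnorm_add: "spd A \<Longrightarrow> qnorm A (a + b) \<le> qnorm A a + qnorm A b"
  by (simp add: matrix_vector_right_distrib norm_triangle_ineq flip: spd_norm)

lemma qnorm_scale: "spd A \<Longrightarrow> qnorm A (c *\<^sub>R a) = \<bar>c\<bar> * qnorm A a"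
  by (simp add: matrix_vector_mult_scaleR flip: spd_norm)

lemma qnorm_cauchy_schwarz:
  assumes "spd A"
  shows "\<bar>(A *v a) \<bullet> b\<bar> \<le> qnorm A a * qnorm A b"
proof -
  have "msqrt A ** msqrt A = A" "transpose (msqrt A) = msqrt A" using assms msqrt_spd by (auto simp: spd_def)
  then have "(A *v a) \<bullet> b = (msqrt A *v a) \<bullet> (msqrt A *v b)"
    by (metis matrix_vector_mul_assoc transpose_eq_iff_self_adjoint)
  then show ?thesis using Cauchy_Schwarz_ineq2 assms by (metis spd_norm)
qed

lemma qnorm_self: "spd A \<Longrightarrow> (A *v a) \<bullet> a = (qnorm A a)\<^sup>2"
  by (cases "a = 0") (auto simp: qnorm_def spd_def inner_commute less_imp_le)

lemma norm_le_opnorm: "norm (A *v g) \<le> opnorm A * norm g"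
  unfolding opnorm_def by (rule onorm) (rule matrix_vector_mul_bounded_linear)

lemma measurable_matrix_vector_mult[measurable (raw)]:
  fixes A :: "'a \<Rightarrow> real^'n^'n"
  assumes "A \<in> borel_measurable M" "g \<in> borel_measurable M"
  shows "(\<lambda>x. A x *v g x) \<in> borel_measurable M"
  by (rule borel_measurable_continuous_Pair[OF assms])
     (auto simp: matrix_vector_mult_def intro!: continuous_intros continuous_on_vec_lambda)

lemma measurable_qnorm[measurable (raw)]:
  fixes A :: "'a \<Rightarrow> real^'n^'n"
  assumes [measurable]: "A \<in> borel_measurable M" "g \<in> borel_measurable M"
  shows "(\<lambda>x. qnorm (A x) (g x)) \<in> borel_measurable M"
  unfolding qnorm_def by measurable

lemma powr_add_le:
  fixes a b p :: real
  assumes "0 \<le> a" "0 \<le> b" "0 < p"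
  shows "(a + b) powr p \<le> 2 powr p * (a powr p + b powr p)"
proof -
  have "(a + b) powr p \<le> (2 * max a b) powr p" using assms by (intro powr_mono2) auto
  also have "\<dots> = 2 powr p * (max a b) powr p" using assms by (simp add: powr_mult)
  also have "(max a b) powr p \<le> a powr p + b powr p" by (auto simp: max_def)
  finally show ?thesis by simp
qed

text \<open>The class of admissible nonlinearities: \<open>F 0 = 0\<close> preserves compact support
  under composition, the bound on \<open>F'\<close> preserves Lipschitz continuity and finite
  energy, and continuity of \<open>F'\<close> lets gradients converge along an approximating
  sequence.\<close>

definition C1b :: "(real \<Rightarrow> real) \<Rightarrow> (real \<Rightarrow> real) \<Rightarrow> bool" where
  "C1b F F' \<longleftrightarrow> F 0 = 0 \<and> (\<forall>x. (F has_real_derivative F' x) (at x)) \<and> continuous_on UNIV F' \<and>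
     (\<exists>B. \<forall>x. \<bar>F' x\<bar> \<le> B)"

lemma C1b_lipschitz:
  assumes "C1b F F'"
  obtains B where "0 \<le> B" "\<And>x. \<bar>F' x\<bar> \<le> B" "B-lipschitz_on UNIV F"
proof -
  obtain B where B: "\<And>x. \<bar>F' x\<bar> \<le> B" and d: "\<And>x. (F has_real_derivative F' x) (at x)" using assms by (auto simp: C1b_def)
  have "0 \<le> B" using B[of 0] by linarith
  moreover have "B-lipschitz_on UNIV F"
  proof (rule lipschitz_onI)
    fix x y :: real
    have "norm (F x - F y) \<le> B * norm (x - y)"
      by (rule field_differentiable_bound[of UNIV F F']) (use B d in \<open>auto intro: has_field_derivative_at_within\<close>)
    then show "dist (F x) (F y) \<le> B * dist x y" by (simp add: dist_norm)
  qed fact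
  ultimately show ?thesis using that B by blast
qed

lemma C1b_measurable: "C1b F F' \<Longrightarrow> F \<in> borel_measurable borel" "C1b F F' \<Longrightarrow> F' \<in> borel_measurable borel"
proof -
  assume F: "C1b F F'"
  show "F \<in> borel_measurable borel" using C1b_lipschitz[OF F] lipschitz_borel_measurable by metis
next
  assume "C1b F F'"
  then show "F' \<in> borel_measurable borel" by (auto simp: C1b_def intro: borel_measurable_continuous_onI)
qed

lemma C1b_cont: "C1b F F' \<Longrightarrow> isCont F x" "C1b F F' \<Longrightarrow> isCont F' x"
  by (auto simp: C1b_def continuous_on_eq_continuous_at intro: DERIV_isCont)

lemma lipc_compose:
  assumes F: "C1b F F'" and \<phi>: "lipc \<Omega> \<phi>"
  shows "lipc \<Omega> (\<lambda>x. F (\<phi> x))"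
proof -
  obtain B where B: "B-lipschitz_on UNIV F" using C1b_lipschitz[OF F] by blast
  obtain L R K where L: "L-lipschitz_on UNIV \<phi>" "compact K" "K \<subseteq> \<Omega>" "\<forall>x. x \<notin> K \<longrightarrow> \<phi> x = 0" using lipcE[OF \<phi>] by metis
  have "(B * L)-lipschitz_on UNIV (\<lambda>x. F (\<phi> x))"
    using lipschitz_on_compose2[OF L(1), of B F] lipschitz_on_subset[OF B] by auto
  moreover have "F 0 = 0" using F by (simp add: C1b_def)
  ultimately show ?thesis using L by (auto simp: lipc_def csupp_in_def)
qed

lemma lipc_compose_grad:
  assumes F: "C1b F F'" and \<phi>: "lipc \<Omega> \<phi>"
  shows "AE x in lborel. grad (\<lambda>x. F (\<phi> x)) x = F' (\<phi> x) *\<^sub>R grad \<phi> x"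
  using lipc_AE_grad[OF \<phi>]
proof eventually_elim
  case (elim x)
  have "(F has_derivative (\<lambda>h. F' (\<phi> x) * h)) (at (\<phi> x))" using F by (simp add: C1b_def has_field_derivative_def)
  from has_derivative_compose[OF conjunct1[OF elim] this]
  have "((\<lambda>x. F (\<phi> x)) has_derivative (\<lambda>h. F' (\<phi> x) * (grad \<phi> x \<bullet> h))) (at x)" .
  then show ?case by (intro grad_eqI) simp
qed

text \<open>The first integrals may be infinite, so the subsequence theorem for \<open>L^1\<close>
  is applied after an index shift \<open>k0\<close> beyond which they are below 1.\<close>

lemma nn_integral_tendsto_0_AE_subseq:
  fixes h :: "nat \<Rightarrow> 'a \<Rightarrow> real"
  assumes [measurable]: "\<And>k. h k \<in> borel_measurable M" and nn: "\<And>k x. x \<in> space M \<Longrightarrow> 0 \<le> h k x"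
    and lim: "(\<lambda>k. \<integral>\<^sup>+x. ennreal (h k x) \<partial>M) \<longlonglongrightarrow> 0"
  obtains r :: "nat \<Rightarrow> nat" where "strict_mono r" "AE x in M. (\<lambda>k. h (r k) x) \<longlonglongrightarrow> 0"
proof -
  have "\<forall>\<^sub>F k in sequentially. (\<integral>\<^sup>+x. ennreal (h k x) \<partial>M) < 1" by (rule order_tendstoD(2)[OF lim]) simp
  then obtain k0 where k0: "\<And>k. k0 \<le> k \<Longrightarrow> (\<integral>\<^sup>+x. ennreal (h k x) \<partial>M) < 1" by (auto simp: eventually_sequentially)
  have int: "integrable M (h (n + k0))" for n
  proof -
    have "(\<integral>\<^sup>+x. ennreal (norm (h (n + k0) x)) \<partial>M) = (\<integral>\<^sup>+x. ennreal (h (n + k0) x) \<partial>M)"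
      using nn by (intro nn_integral_cong) simp
    also have "\<dots> < \<infinity>" using k0[of "n + k0"] by (auto intro: less_trans)
    finally show ?thesis by (simp add: integrable_iff_bounded)
  qed
  have "(\<integral>x. norm (h (n + k0) x) \<partial>M) = enn2real (\<integral>\<^sup>+x. ennreal (h (n + k0) x) \<partial>M)" for n
  proof -
    have "(\<integral>x. norm (h (n + k0) x) \<partial>M) = (\<integral>x. h (n + k0) x \<partial>M)"
      using nn by (intro Bochner_Integration.integral_cong) auto
    also have "\<dots> = enn2real (\<integral>\<^sup>+x. ennreal (h (n + k0) x) \<partial>M)"
      using nn by (intro integral_eq_nn_integral) auto
    finally show ?thesis .
  qed
  moreover have "(\<lambda>n. enn2real (\<integral>\<^sup>+x. ennreal (h (n + k0) x) \<partial>M)) \<longlonglongrightarrow> 0"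
    by (rule tendsto_enn2real) (use LIMSEQ_ignore_initial_segment[OF lim] in simp_all)
  ultimately have "(\<lambda>n. \<integral>x. norm (h (n + k0) x) \<partial>M) \<longlonglongrightarrow> 0" by simp
  from tendsto_L1_AE_subseq[OF int this] obtain r :: "nat \<Rightarrow> nat"
    where r: "strict_mono r" "AE x in M. (\<lambda>n. h (r n + k0) x) \<longlonglongrightarrow> 0" by blast
  then show ?thesis by (intro that[of "\<lambda>n. r n + k0"]) (auto simp: strict_mono_def)
qed

section \<open>Consequences of hypothesis (H): energies, chain rule and a truncated Sobolev
  inequality\<close>

locale degenerate_weight =
  fixes \<Omega> :: "(real^'n) set" and Q :: "real^'n \<Rightarrow> real^'n^'n" and v :: "real^'n \<Rightarrow> real" and p :: real
  assumes open_Om: "open \<Omega>" and H: "hyp_H \<Omega> Q v p" and p: "1 < p" "p < 2"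
begin

abbreviation M where "M \<equiv> lebesgue_on \<Omega>"

lemma Om_sets[simp]: "\<Omega> \<in> sets lebesgue" using open_Om by (simp add: borel_open)

lemma Q_meas[measurable]: "Q \<in> borel_measurable M" and v_meas[measurable]: "v \<in> borel_measurable M"
  and v_nonneg: "\<And>x. x \<in> \<Omega> \<Longrightarrow> 0 \<le> v x" and v_int: "integrable M v"
  using H by (auto simp: hyp_H_def)

lemma AE_spd: "AE x in M. spd (Q x)"
  using H by (simp add: hyp_H_def spd_def)

text \<open>This is the bound of (H) on the operator norm of the root. The quantifier over
  \<open>g\<close> stands inside \<open>AE\<close>, so one null set serves all vector
  fields.\<close>

lemma AE_qnorm_le: "AE x in M. \<forall>g. qnorm (Q x) g powr p \<le> v x * norm g powr p"
proof -
  have "AE x in M. opnorm (msqrt (Q x)) powr p \<le> v x" using H by (simp add: hyp_H_def)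
  with AE_spd show ?thesis
  proof eventually_elim
    case (elim x)
    show ?case
    proof
      fix g
      have o: "0 \<le> opnorm (msqrt (Q x))" unfolding opnorm_def by (rule onorm_pos_le) (rule matrix_vector_mul_bounded_linear)
      have "qnorm (Q x) g powr p \<le> (opnorm (msqrt (Q x)) * norm g) powr p"
        using p norm_le_opnorm[of "msqrt (Q x)" g] spd_norm[OF elim(1)] by (intro powr_mono2) (auto simp: qnorm_nonneg[OF elim(1)])
      also have "\<dots> = opnorm (msqrt (Q x)) powr p * norm g powr p" using o by (simp add: powr_mult)
      also have "\<dots> \<le> v x * norm g powr p" using elim(2) by (intro mult_right_mono) auto
      finally show "qnorm (Q x) g powr p \<le> v x * norm g powr p" .
    qed
  qed
qed

text \<open>Positive definiteness makes \<open>qnorm\<close> positive on nonzero vectors, and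
  \<open>v\<close> dominates it. A positive weight turns statements about \<open>v dx\<close> into
  statements almost everywhere, both for approximating sequences and in the final
  conclusion.\<close>

lemma AE_v_pos: "AE x in M. 0 < v x"
  using AE_spd AE_qnorm_le
proof eventually_elim
  case (elim x)
  define e :: "real^'n" where "e = axis undefined 1"
  have "e \<noteq> 0" by (simp add: e_def axis_eq_0_iff)
  then have "0 < qnorm (Q x) e" using elim(1) by (simp add: qnorm_def spd_def)
  then have "0 < qnorm (Q x) e powr p" by simp
  also have "\<dots> \<le> v x * norm e powr p" using elim(2) by blast
  finally show ?case by (simp add: e_def)
qed

definition energy :: "(real^'n \<Rightarrow> real^'n) \<Rightarrow> ennreal" where
  "energy g = (\<integral>\<^sup>+x. ennreal (qnorm (Q x) (g x) powr p) \<partial>M)"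

lemma energy_msqrt: "(\<integral>\<^sup>+x. ennreal (norm (msqrt (Q x) *v g x) powr p) \<partial>M) = energy g"
  unfolding energy_def using AE_spd by (intro nn_integral_cong_AE) (auto elim!: eventually_mono simp: spd_norm)

lemma borel_measurable_M: "f \<in> borel_measurable lebesgue \<Longrightarrow> f \<in> borel_measurable M"
  by (rule measurable_restrict_space1)

lemma lipc_meas_M: "lipc \<Omega> f \<Longrightarrow> f \<in> borel_measurable M" "lipc \<Omega> f \<Longrightarrow> grad f \<in> borel_measurable M"
  by (intro borel_measurable_M measurable_completion; simp add: lipc_measurable)
     (intro borel_measurable_M lipc_grad_measurable)

lemma AE_M_I: "AE x in lborel. P x \<Longrightarrow> AE x in M. P x"
  by (simp add: AE_lebesgue_on_iff) (auto elim: eventually_mono)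

lemma v_nn_finite: "(\<integral>\<^sup>+x. ennreal (v x) \<partial>M) < \<infinity>"
proof -
  have "(\<integral>\<^sup>+x. ennreal (v x) \<partial>M) = (\<integral>\<^sup>+x. ennreal (norm (v x)) \<partial>M)"
    using v_nonneg by (intro nn_integral_cong) simp
  then show ?thesis using v_int by (simp add: integrable_iff_bounded)
qed

text \<open>Bounded values, a bounded gradient and the integrability of \<open>v\<close> make both
  norms finite, and a constant sequence approximates. This makes (S) available for Lipschitz
  functions.\<close>

lemma lipc_in_H0:
  assumes f: "lipc \<Omega> f"
  shows "(f, grad f) \<in> H0 \<Omega> Q v p"
proof -
  note fm[measurable] = lipc_meas_M[OF f]
  obtain B where B: "0 \<le> B" "\<And>x. \<bar>f x\<bar> \<le> B" using lipc_bounded[OF f] by blast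
  obtain C where C: "0 \<le> C" "AE x in lborel. norm (grad f x) \<le> C" using lipc_grad_bounded[OF f] by blast
  have fin: "(\<integral>\<^sup>+x. ennreal (c * v x) \<partial>M) < \<infinity>" if "0 \<le> c" for c
  proof -
    have "(\<integral>\<^sup>+x. ennreal (c * v x) \<partial>M) = ennreal c * (\<integral>\<^sup>+x. ennreal (v x) \<partial>M)"
      using that by (simp add: ennreal_mult' nn_integral_cmult)
    then show ?thesis using v_nn_finite by (simp add: ennreal_mult_less_top)
  qed
  have "(\<integral>\<^sup>+x. ennreal (\<bar>f x\<bar> powr p * v x) \<partial>M) \<le> (\<integral>\<^sup>+x. ennreal (B powr p * v x) \<partial>M)"
    using B p v_nonneg by (intro nn_integral_mono ennreal_leI mult_right_mono powr_mono2) auto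
  then have 1: "(\<integral>\<^sup>+x. ennreal (\<bar>f x\<bar> powr p * v x) \<partial>M) < \<infinity>" using fin[of "B powr p"] by (simp add: le_less_trans)
  have "energy (grad f) \<le> (\<integral>\<^sup>+x. ennreal (C powr p * v x) \<partial>M)"
    unfolding energy_def
  proof (rule nn_integral_mono_AE)
    show "AE x in M. ennreal (qnorm (Q x) (grad f x) powr p) \<le> ennreal (C powr p * v x)"
      using AE_qnorm_le AE_M_I[OF C(2)] AE_v_pos
    proof eventually_elim
      case (elim x)
      have "qnorm (Q x) (grad f x) powr p \<le> v x * norm (grad f x) powr p" using elim(1) by blast
      also have "\<dots> \<le> v x * C powr p" using elim p by (intro mult_left_mono powr_mono2) auto
      finally show ?case by (simp add: mult.commute ennreal_leI)
    qed
  qed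
  then have 2: "energy (grad f) < \<infinity>" using fin[of "C powr p"] by (simp add: le_less_trans)
  show ?thesis
    unfolding H0_def using 1 2 fm f lipc_weak_gradient[OF f open_Om]
    by (auto simp: energy_msqrt energy_def qnorm_def intro!: exI[of _ "\<lambda>_. f"])
qed

lemma H0_D:
  assumes "(u, g) \<in> H0 \<Omega> Q v p"
  shows "u \<in> borel_measurable M" "g \<in> borel_measurable M" "energy g < \<infinity>"
  using assms by (auto simp: H0_def energy_msqrt)

text \<open>From the convergence in \<open>L^p_v\<close> only convergence almost everywhere is kept:
  along a subsequence the weighted differences tend to 0 pointwise, and \<open>v > 0\<close> can be
  divided out.\<close>

lemma H0_approx:
  assumes "(u, g) \<in> H0 \<Omega> Q v p"
  obtains \<phi> :: "nat \<Rightarrow> real^'n \<Rightarrow> real" where "\<And>k. lipc \<Omega> (\<phi> k)" "AE x in M. (\<lambda>k. \<phi> k x) \<longlonglongrightarrow> u x"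
    "(\<lambda>k. energy (\<lambda>x. grad (\<phi> k) x - g x)) \<longlonglongrightarrow> 0"
proof -
  obtain \<phi> :: "nat \<Rightarrow> real^'n \<Rightarrow> real" where l: "\<And>k. lipc \<Omega> (\<phi> k)"
    and c1: "(\<lambda>k. \<integral>\<^sup>+ x. ennreal (\<bar>\<phi> k x - u x\<bar> powr p * v x) \<partial>M) \<longlonglongrightarrow> 0"
    and c2: "(\<lambda>k. energy (\<lambda>x. grad (\<phi> k) x - g x)) \<longlonglongrightarrow> 0"
    and [measurable]: "u \<in> borel_measurable M"
    using assms by (auto simp: H0_def energy_msqrt)
  have [measurable]: "\<phi> k \<in> borel_measurable M" for k using l by (rule lipc_meas_M)
  obtain r :: "nat \<Rightarrow> nat" where r: "strict_mono r" "AE x in M. (\<lambda>k. \<bar>\<phi> (r k) x - u x\<bar> powr p * v x) \<longlonglongrightarrow> 0"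
    by (rule nn_integral_tendsto_0_AE_subseq[OF _ _ c1]) (use v_nonneg in auto)
  show ?thesis
  proof (rule that[of "\<lambda>k. \<phi> (r k)"])
    show "AE x in M. (\<lambda>k. \<phi> (r k) x) \<longlonglongrightarrow> u x"
      using r(2) AE_v_pos
    proof eventually_elim
      case (elim x)
      have "(\<lambda>k. (\<bar>\<phi> (r k) x - u x\<bar> powr p * v x) / v x) \<longlonglongrightarrow> 0 / v x"
        using elim by (intro tendsto_divide) auto
      then have "(\<lambda>k. \<bar>\<phi> (r k) x - u x\<bar> powr p) \<longlonglongrightarrow> 0" using elim by simp
      then have "(\<lambda>k. (\<bar>\<phi> (r k) x - u x\<bar> powr p) powr (1/p)) \<longlonglongrightarrow> 0 powr (1/p)"
        using p by (intro tendsto_powr') auto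
      then have "(\<lambda>k. \<bar>\<phi> (r k) x - u x\<bar>) \<longlonglongrightarrow> 0" using p by (simp add: powr_powr)
      then show ?case by (simp add: tendsto_rabs_zero_iff LIM_zero_iff)
    qed
    show "(\<lambda>k. energy (\<lambda>x. grad (\<phi> (r k)) x - g x)) \<longlonglongrightarrow> 0"
      using LIMSEQ_subseq_LIMSEQ[OF c2 r(1)] by (simp add: o_def)
  qed (use l in auto)
qed

text \<open>A crude triangle inequality for \<open>p\<close>-th powers stands in for Minkowski's;
  its factor \<open>2 powr p\<close> reappears in \<open>sobolev_truncated\<close> and only affects
  the final constant.\<close>

lemma energy_add_le:
  assumes [measurable]: "g \<in> borel_measurable M" "h \<in> borel_measurable M"
  shows "energy (\<lambda>x. g x + h x) \<le> ennreal (2 powr p) * (energy g + energy h)"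
proof -
  have "energy (\<lambda>x. g x + h x) \<le> (\<integral>\<^sup>+x. ennreal (2 powr p) * (ennreal (qnorm (Q x) (g x) powr p) + ennreal (qnorm (Q x) (h x) powr p)) \<partial>M)"
    unfolding energy_def
  proof (rule nn_integral_mono_AE)
    show "AE x in M. ennreal (qnorm (Q x) (g x + h x) powr p) \<le> ennreal (2 powr p) * (ennreal (qnorm (Q x) (g x) powr p) + ennreal (qnorm (Q x) (h x) powr p))"
      using AE_spd
    proof eventually_elim
      case (elim x)
      have "qnorm (Q x) (g x + h x) powr p \<le> (qnorm (Q x) (g x) + qnorm (Q x) (h x)) powr p"
        using p qnorm_nonneg[OF elim] qnorm_add[OF elim] by (intro powr_mono2) auto
      also have "\<dots> \<le> 2 powr p * (qnorm (Q x) (g x) powr p + qnorm (Q x) (h x) powr p)"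
        using p qnorm_nonneg[OF elim] by (intro powr_add_le) auto
      finally show ?case by (simp flip: ennreal_plus ennreal_mult)
    qed
  qed
  also have "\<dots> = ennreal (2 powr p) * (energy g + energy h)"
    unfolding energy_def by (simp add: nn_integral_cmult nn_integral_add)
  finally show ?thesis .
qed

lemma energy_mult_le:
  assumes [measurable]: "g \<in> borel_measurable M" "c \<in> borel_measurable M" and B: "0 \<le> B" "\<And>x. \<bar>c x\<bar> \<le> B"
  shows "energy (\<lambda>x. c x *\<^sub>R g x) \<le> ennreal (B powr p) * energy g"
proof -
  have "energy (\<lambda>x. c x *\<^sub>R g x) \<le> (\<integral>\<^sup>+x. ennreal (B powr p) * ennreal (qnorm (Q x) (g x) powr p) \<partial>M)"
    unfolding energy_def
  proof (rule nn_integral_mono_AE)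
    show "AE x in M. ennreal (qnorm (Q x) (c x *\<^sub>R g x) powr p) \<le> ennreal (B powr p) * ennreal (qnorm (Q x) (g x) powr p)"
      using AE_spd
    proof eventually_elim
      case (elim x)
      have "qnorm (Q x) (c x *\<^sub>R g x) powr p \<le> (B * qnorm (Q x) (g x)) powr p"
        using p B qnorm_nonneg[OF elim] by (intro powr_mono2) (auto simp: qnorm_scale[OF elim] intro!: mult_right_mono)
      then show ?case using B qnorm_nonneg[OF elim] by (simp add: powr_mult flip: ennreal_mult)
    qed
  qed
  also have "\<dots> = ennreal (B powr p) * energy g" unfolding energy_def by (rule nn_integral_cmult) measurable
  finally show ?thesis .
qed

lemma energy_mult_finite:
  assumes "g \<in> borel_measurable M" "c \<in> borel_measurable M" "0 \<le> B" "\<And>x. \<bar>c x\<bar> \<le> B" and g: "energy g < \<infinity>"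
  shows "energy (\<lambda>x. c x *\<^sub>R g x) < \<infinity>"
  using energy_mult_le[OF assms(1-4)] g by (auto simp: ennreal_mult_less_top intro: le_less_trans)

text \<open>The gradient difference splits into \<open>F' (\<phi> k x)\<close> times the gradient
  error and \<open>F' (\<phi> k x) - F' (u x)\<close> times \<open>g\<close>. The first part is
  small because \<open>F'\<close> is bounded, the second by dominated convergence and continuity of
  \<open>F'\<close>.\<close>

lemma chain_rule_convergence:
  assumes F: "C1b F F'" and l: "\<And>k. lipc \<Omega> (\<phi> k)" and ae: "AE x in M. (\<lambda>k. \<phi> k x) \<longlonglongrightarrow> u x"
    and c: "(\<lambda>k. energy (\<lambda>x. grad (\<phi> k) x - g x)) \<longlonglongrightarrow> 0"
    and [measurable]: "u \<in> borel_measurable M" "g \<in> borel_measurable M" and g: "energy g < \<infinity>"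
  shows "(\<lambda>k. energy (\<lambda>x. grad (\<lambda>y. F (\<phi> k y)) x - F' (u x) *\<^sub>R g x)) \<longlonglongrightarrow> 0"
proof -
  obtain B where B: "0 \<le> B" "\<And>x. \<bar>F' x\<bar> \<le> B" using C1b_lipschitz[OF F] by blast
  have [measurable]: "\<phi> k \<in> borel_measurable M" "grad (\<phi> k) \<in> borel_measurable M" for k using l by (intro lipc_meas_M; blast)+
  have [measurable]: "F' \<in> borel_measurable borel" using C1b_measurable[OF F] by blast
  let ?a = "\<lambda>k x. F' (\<phi> k x) *\<^sub>R (grad (\<phi> k) x - g x)" and ?b = "\<lambda>k x. (F' (\<phi> k x) - F' (u x)) *\<^sub>R g x"
  have le: "energy (\<lambda>x. grad (\<lambda>y. F (\<phi> k y)) x - F' (u x) *\<^sub>R g x) \<le> ennreal (2 powr p) * (ennreal (B powr p) * energy (\<lambda>x. grad (\<phi> k) x - g x) + energy (?b k))" for k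
  proof -
    have "energy (\<lambda>x. grad (\<lambda>y. F (\<phi> k y)) x - F' (u x) *\<^sub>R g x) = energy (\<lambda>x. ?a k x + ?b k x)"
      unfolding energy_def using AE_M_I[OF lipc_compose_grad[OF F l[of k]]]
      by (intro nn_integral_cong_AE) (auto elim!: eventually_mono simp: algebra_simps)
    also have "\<dots> \<le> ennreal (2 powr p) * (energy (?a k) + energy (?b k))" by (rule energy_add_le) measurable
    also have "energy (?a k) \<le> ennreal (B powr p) * energy (\<lambda>x. grad (\<phi> k) x - g x)"
      using B by (intro energy_mult_le) measurable
    finally show ?thesis by (simp add: add_right_mono mult_left_mono)
  qed
  have "(\<lambda>k. energy (?b k)) \<longlonglongrightarrow> (\<integral>\<^sup>+x. 0 \<partial>M)"
    unfolding energy_def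
  proof (rule nn_integral_dominated_convergence[where w = "\<lambda>x. ennreal ((2 * B) powr p) * ennreal (qnorm (Q x) (g x) powr p)"])
    have "(\<integral>\<^sup>+x. ennreal ((2 * B) powr p) * ennreal (qnorm (Q x) (g x) powr p) \<partial>M) = ennreal ((2 * B) powr p) * energy g"
      unfolding energy_def by (rule nn_integral_cmult) measurable
    then show "(\<integral>\<^sup>+x. ennreal ((2 * B) powr p) * ennreal (qnorm (Q x) (g x) powr p) \<partial>M) < \<infinity>"
      using g by (simp add: ennreal_mult_less_top)
    show "AE x in M. ennreal (qnorm (Q x) (?b k x) powr p) \<le> ennreal ((2 * B) powr p) * ennreal (qnorm (Q x) (g x) powr p)" for k
      using AE_spd
    proof eventually_elim
      case (elim x)
      have "\<bar>F' (\<phi> k x) - F' (u x)\<bar> \<le> 2 * B" using B(2)[of "\<phi> k x"] B(2)[of "u x"] by linarith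
      then have "qnorm (Q x) (?b k x) powr p \<le> ((2 * B) * qnorm (Q x) (g x)) powr p"
        using p B qnorm_nonneg[OF elim] by (intro powr_mono2) (auto simp: qnorm_scale[OF elim] intro!: mult_right_mono)
      also have "\<dots> = (2 * B) powr p * qnorm (Q x) (g x) powr p" using B qnorm_nonneg[OF elim] by (simp add: powr_mult)
      finally show ?case by (simp flip: ennreal_mult)
    qed
    show "AE x in M. (\<lambda>k. ennreal (qnorm (Q x) (?b k x) powr p)) \<longlonglongrightarrow> 0"
      using AE_spd ae
    proof eventually_elim
      case (elim x)
      have "(\<lambda>k. F' (\<phi> k x)) \<longlonglongrightarrow> F' (u x)" by (rule isCont_tendsto_compose[OF C1b_cont(2)[OF F] elim(2)])
      then have "(\<lambda>k. \<bar>F' (\<phi> k x) - F' (u x)\<bar> * qnorm (Q x) (g x)) \<longlonglongrightarrow> 0 * qnorm (Q x) (g x)"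
        by (intro tendsto_mult tendsto_rabs_zero LIM_zero tendsto_const)
      then have "(\<lambda>k. (\<bar>F' (\<phi> k x) - F' (u x)\<bar> * qnorm (Q x) (g x)) powr p) \<longlonglongrightarrow> 0 powr p"
        using p qnorm_nonneg[OF elim(1)] by (intro tendsto_powr') auto
      from tendsto_ennrealI[OF this] show ?case by (simp add: qnorm_scale[OF elim(1)])
    qed
  qed measurable
  then have b0: "(\<lambda>k. energy (?b k)) \<longlonglongrightarrow> 0" by simp
  have "(\<lambda>k. ennreal (2 powr p) * (ennreal (B powr p) * energy (\<lambda>x. grad (\<phi> k) x - g x) + energy (?b k))) \<longlonglongrightarrow>
     ennreal (2 powr p) * (ennreal (B powr p) * 0 + 0)"
    by (intro ennreal_tendsto_cmult tendsto_add c b0) auto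
  then have lim: "(\<lambda>k. ennreal (2 powr p) * (ennreal (B powr p) * energy (\<lambda>x. grad (\<phi> k) x - g x) + energy (?b k))) \<longlonglongrightarrow> 0" by simp
  show ?thesis by (rule tendsto_sandwich[OF _ _ tendsto_const lim]) (use le in auto)
qed

text \<open>(S) is applied to the Lipschitz functions \<open>F (\<phi> k x)\<close> and carried to
  the limit, by Fatou's lemma on the left and by energy convergence on the right. This avoids
  proving that \<open>F (u x)\<close> has a weak gradient.\<close>

lemma sobolev_truncated:
  assumes S: "hyp_S \<Omega> Q v p \<sigma> Ms" and \<sigma>: "1 < \<sigma>" and Ms: "0 < Ms"
    and ug: "(u, g) \<in> H0 \<Omega> Q v p" and F: "C1b F F'"
  shows "(\<integral>\<^sup>+x. ennreal (\<bar>F (u x)\<bar> powr (\<sigma> * p) * v x) \<partial>M) \<le>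
    ennreal (Ms powr (\<sigma> * p) * (2 powr p * enn2real (energy (\<lambda>x. F' (u x) *\<^sub>R g x))) powr \<sigma>)"
proof -
  note ugm[measurable] = H0_D(1,2)[OF ug]
  obtain \<phi> where l: "\<And>k. lipc \<Omega> (\<phi> k)" and ae: "AE x in M. (\<lambda>k. \<phi> k x) \<longlonglongrightarrow> u x"
    and c: "(\<lambda>k. energy (\<lambda>x. grad (\<phi> k) x - g x)) \<longlonglongrightarrow> 0" using H0_approx[OF ug] by blast
  obtain B where B: "0 \<le> B" "\<And>x. \<bar>F' x\<bar> \<le> B" using C1b_lipschitz[OF F] by blast
  have Fm[measurable]: "F \<in> borel_measurable borel" "F' \<in> borel_measurable borel" using C1b_measurable[OF F] by blast+
  have lF: "lipc \<Omega> (\<lambda>x. F (\<phi> k x))" for k using F l by (rule lipc_compose)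
  have [measurable]: "\<phi> k \<in> borel_measurable M" "grad (\<lambda>y. F (\<phi> k y)) \<in> borel_measurable M" for k
    using lipc_meas_M l lF by blast+
  let ?G = "\<lambda>x. F' (u x) *\<^sub>R g x" and ?d = "\<lambda>k. energy (\<lambda>x. grad (\<lambda>y. F (\<phi> k y)) x - F' (u x) *\<^sub>R g x)"
  have d: "?d \<longlonglongrightarrow> 0" by (rule chain_rule_convergence[OF F l ae c ugm H0_D(3)[OF ug]])
  have fk: "energy (grad (\<lambda>y. F (\<phi> k y))) < \<infinity>" for k using H0_D(3)[OF lipc_in_H0[OF lF]] .
  have Gf: "energy ?G < \<infinity>" using B H0_D(3)[OF ug] by (intro energy_mult_finite) measurable
  \<comment> \<open>Finiteness of \<open>?d k\<close>, which holds for large \<open>k\<close>, is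
    required because \<open>enn2real\<close> sends infinity to 0 and is monotone only below
    infinity.\<close>
  have bound: "(\<integral>\<^sup>+x. ennreal (\<bar>F (\<phi> k x)\<bar> powr (\<sigma> * p) * v x) \<partial>M) \<le>
     ennreal (Ms powr (\<sigma> * p) * enn2real (ennreal (2 powr p) * (?d k + energy ?G)) powr \<sigma>)" if dk: "?d k < \<infinity>" for k
  proof -
    let ?e = "enn2real (energy (grad (\<lambda>y. F (\<phi> k y))))"
    have "(\<integral>\<^sup>+x. ennreal (\<bar>F (\<phi> k x)\<bar> powr (\<sigma> * p) * v x) \<partial>M) \<le> ennreal ((Ms * ?e powr (1 / p)) powr (\<sigma> * p))"
      using S lipc_in_H0[OF lF[of k]] unfolding hyp_S_def energy_msqrt by (auto dest!: bspec)
    also have "(Ms * ?e powr (1 / p)) powr (\<sigma> * p) = Ms powr (\<sigma> * p) * ?e powr \<sigma>"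
      using p Ms by (simp add: powr_mult powr_powr)
    also have "ennreal (Ms powr (\<sigma> * p) * ?e powr \<sigma>) \<le> ennreal (Ms powr (\<sigma> * p) * enn2real (ennreal (2 powr p) * (?d k + energy ?G)) powr \<sigma>)"
    proof (intro ennreal_leI mult_left_mono powr_mono2 enn2real_mono)
      show "energy (grad (\<lambda>y. F (\<phi> k y))) \<le> ennreal (2 powr p) * (?d k + energy ?G)"
        using energy_add_le[of "\<lambda>x. grad (\<lambda>y. F (\<phi> k y)) x - F' (u x) *\<^sub>R g x" ?G] by simp
      show "ennreal (2 powr p) * (?d k + energy ?G) < top" using Gf dk by (simp add: ennreal_mult_less_top)
    qed (use \<sigma> in auto)
    finally show ?thesis .
  qed
  have "\<forall>\<^sub>F k in sequentially. ?d k < 1" by (rule order_tendstoD(2)[OF d]) simp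
  then have ev: "\<forall>\<^sub>F k in sequentially. (\<integral>\<^sup>+x. ennreal (\<bar>F (\<phi> k x)\<bar> powr (\<sigma> * p) * v x) \<partial>M) \<le>
     ennreal (Ms powr (\<sigma> * p) * enn2real (ennreal (2 powr p) * (?d k + energy ?G)) powr \<sigma>)"
    by eventually_elim (rule bound, auto intro: less_trans)
  have "(\<lambda>k. ennreal (2 powr p) * (?d k + energy ?G)) \<longlonglongrightarrow> ennreal (2 powr p) * (0 + energy ?G)"
    by (intro ennreal_tendsto_cmult tendsto_add d tendsto_const) auto
  moreover have "ennreal (2 powr p) * (0 + energy ?G) = ennreal (2 powr p * enn2real (energy ?G))"
    using Gf by (simp add: ennreal_mult)
  ultimately have "(\<lambda>k. enn2real (ennreal (2 powr p) * (?d k + energy ?G))) \<longlonglongrightarrow> 2 powr p * enn2real (energy ?G)"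
    by (intro tendsto_enn2real) auto
  then have lim: "(\<lambda>k. ennreal (Ms powr (\<sigma> * p) * enn2real (ennreal (2 powr p) * (?d k + energy ?G)) powr \<sigma>)) \<longlonglongrightarrow>
     ennreal (Ms powr (\<sigma> * p) * (2 powr p * enn2real (energy ?G)) powr \<sigma>)"
    using \<sigma> by (intro tendsto_ennrealI tendsto_mult tendsto_const tendsto_powr') auto
  have "(\<integral>\<^sup>+x. ennreal (\<bar>F (u x)\<bar> powr (\<sigma> * p) * v x) \<partial>M) \<le> (\<integral>\<^sup>+x. liminf (\<lambda>k. ennreal (\<bar>F (\<phi> k x)\<bar> powr (\<sigma> * p) * v x)) \<partial>M)"
  proof (rule nn_integral_mono_AE)
    show "AE x in M. ennreal (\<bar>F (u x)\<bar> powr (\<sigma> * p) * v x) \<le> liminf (\<lambda>k. ennreal (\<bar>F (\<phi> k x)\<bar> powr (\<sigma> * p) * v x))"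
      using ae
    proof eventually_elim
      case (elim x)
      have "(\<lambda>k. F (\<phi> k x)) \<longlonglongrightarrow> F (u x)" by (rule isCont_tendsto_compose[OF C1b_cont(1)[OF F] elim])
      then have "(\<lambda>k. ennreal (\<bar>F (\<phi> k x)\<bar> powr (\<sigma> * p) * v x)) \<longlonglongrightarrow> ennreal (\<bar>F (u x)\<bar> powr (\<sigma> * p) * v x)"
        using p \<sigma> by (intro tendsto_ennrealI tendsto_mult tendsto_const tendsto_powr' tendsto_rabs) auto
      then have "liminf (\<lambda>k. ennreal (\<bar>F (\<phi> k x)\<bar> powr (\<sigma> * p) * v x)) = ennreal (\<bar>F (u x)\<bar> powr (\<sigma> * p) * v x)"
        by (intro lim_imp_Liminf) auto
      then show ?case by simp
    qed
  qed
  also have "\<dots> \<le> liminf (\<lambda>k. \<integral>\<^sup>+x. ennreal (\<bar>F (\<phi> k x)\<bar> powr (\<sigma> * p) * v x) \<partial>M)"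
    by (rule nn_integral_liminf) measurable
  also have "\<dots> \<le> liminf (\<lambda>k. ennreal (Ms powr (\<sigma> * p) * enn2real (ennreal (2 powr p) * (?d k + energy ?G)) powr \<sigma>))"
    by (rule Liminf_mono[OF ev])
  also have "\<dots> = ennreal (Ms powr (\<sigma> * p) * (2 powr p * enn2real (energy ?G)) powr \<sigma>)"
    by (rule lim_imp_Liminf[OF _ lim]) simp
  finally show ?thesis .
qed

end

section \<open>Weak solutions tested with Sobolev functions\<close>

lemma measurable_fst_borel[measurable (raw)]:
  fixes f :: "'c \<Rightarrow> 'a::second_countable_topology \<times> 'b::second_countable_topology"
  assumes "f \<in> borel_measurable M"
  shows "(\<lambda>x. fst (f x)) \<in> borel_measurable M"
proof -
  have "fst \<in> borel_measurable (borel :: ('a \<times> 'b) measure)"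
    by (intro borel_measurable_continuous_onI continuous_intros)
  then show ?thesis using measurable_compose[OF assms] by blast
qed

lemma measurable_snd_borel[measurable (raw)]:
  fixes f :: "'c \<Rightarrow> 'a::second_countable_topology \<times> 'b::second_countable_topology"
  assumes "f \<in> borel_measurable M"
  shows "(\<lambda>x. snd (f x)) \<in> borel_measurable M"
proof -
  have "snd \<in> borel_measurable (borel :: ('a \<times> 'b) measure)"
    by (intro borel_measurable_continuous_onI continuous_intros)
  then show ?thesis using measurable_compose[OF assms] by blast
qed

section \<open>Borel representatives and null sets in space-time\<close>

lemma lebesgue_ex_borel:
  fixes f :: "'a::euclidean_space \<Rightarrow> 'b::euclidean_space"
  assumes "f \<in> borel_measurable lebesgue"
  obtains g where "g \<in> borel_measurable borel" "AE x in lborel. f x = g x"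
proof -
  have "\<exists>g. g \<in> borel_measurable borel \<and> (AE x in lborel. f x \<bullet> i = g x)" for i
    using completion_ex_borel_measurable_real[of "\<lambda>x. f x \<bullet> i" lborel] assms by auto
  then obtain g where g: "\<And>i. g i \<in> borel_measurable borel" "\<And>i. AE x in lborel. f x \<bullet> i = g i x" by metis
  have [measurable]: "g i \<in> borel_measurable borel" for i by (rule g)
  have "AE x in lborel. \<forall>i\<in>Basis. f x \<bullet> i = g i x" using g(2) by (intro AE_finite_allI) auto
  then have "AE x in lborel. f x = (\<Sum>i\<in>Basis. g i x *\<^sub>R i)"
    by eventually_elim (metis (no_types, lifting) euclidean_representation sum.cong)
  then show ?thesis by (intro that[of "\<lambda>x. \<Sum>i\<in>Basis. g i x *\<^sub>R i"]) measurable
qed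

lemma lebesgue_on_ex_borel:
  fixes f :: "'a::euclidean_space \<Rightarrow> 'b::euclidean_space"
  assumes "f \<in> borel_measurable (lebesgue_on S)" and S: "S \<in> sets borel"
  obtains g where "g \<in> borel_measurable borel" "AE x in lborel. x \<in> S \<longrightarrow> g x = f x" "\<And>x. x \<notin> S \<Longrightarrow> g x = 0"
proof -
  have "(\<lambda>x. indicator S x *\<^sub>R f x) \<in> borel_measurable lebesgue"
  proof -
    have "S \<inter> space lebesgue \<in> sets lebesgue" using S by simp
    from borel_measurable_restrict_space_iff[OF this, of f] assms(1) show ?thesis by simp
  qed
  then obtain g where g: "g \<in> borel_measurable borel" "AE x in lborel. indicator S x *\<^sub>R f x = g x"
    using lebesgue_ex_borel by blast
  show ?thesis
  proof (rule that[of "\<lambda>x. indicator S x *\<^sub>R g x"])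
    show "(\<lambda>x. indicator S x *\<^sub>R g x) \<in> borel_measurable borel" using S g(1) by measurable
    show "AE x in lborel. x \<in> S \<longrightarrow> indicator S x *\<^sub>R g x = f x"
      using g(2) by eventually_elim auto
  qed auto
qed

text \<open>Measurability is given on each bounded time interval separately. The cut-offs at integer
  times stabilise pointwise, so their limit is one Lebesgue measurable function for all nonnegative
  times, and this has a Borel version.\<close>

lemma lebesgue_on_times_ex_borel:
  fixes f :: "real \<Rightarrow> 'a::euclidean_space \<Rightarrow> 'b::euclidean_space"
  assumes f: "\<And>T. 0 < T \<Longrightarrow> (\<lambda>(t, x). f t x) \<in> borel_measurable (lebesgue_on ({0..T} \<times> \<Omega>))"
    and \<Omega>: "\<Omega> \<in> sets borel"
  obtains g where "g \<in> borel_measurable borel" "AE z in lborel. 0 \<le> fst z \<and> snd z \<in> \<Omega> \<longrightarrow> g z = f (fst z) (snd z)"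
    "\<And>t x. t < 0 \<or> x \<notin> \<Omega> \<Longrightarrow> g (t, x) = 0"
proof -
  let ?S = "{0::real..} \<times> \<Omega>" and ?Sn = "\<lambda>n::nat. {0..real (Suc n)} \<times> \<Omega>"
  have b: "?S \<in> sets borel" "?Sn n \<in> sets borel" for n using \<Omega> by (auto intro!: borel_Times borel_closed[OF closed_atLeast])
  have "(\<lambda>z. indicator ?S z *\<^sub>R (case z of (t, x) \<Rightarrow> f t x)) \<in> borel_measurable lebesgue"
  proof (rule borel_measurable_LIMSEQ_metric)
    show "(\<lambda>z. indicator (?Sn n) z *\<^sub>R (case z of (t, x) \<Rightarrow> f t x)) \<in> borel_measurable lebesgue" for n
    proof -
      have "?Sn n \<inter> space lebesgue \<in> sets lebesgue" using b(2)[of n] by simp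
      from borel_measurable_restrict_space_iff[OF this, of "\<lambda>(t, x). f t x"] f[of "real (Suc n)"]
      show ?thesis by (simp del: of_nat_Suc)
    qed
    fix z :: "real \<times> 'a"
    obtain N :: nat where "fst z \<le> real N" using real_arch_simple by blast
    then have "indicator (?Sn n) z = (indicator ?S z :: real)" if "N \<le> n" for n
      using that by (cases z) (auto simp: indicator_def)
    then show "(\<lambda>n. indicator (?Sn n) z *\<^sub>R (case z of (t, x) \<Rightarrow> f t x)) \<longlonglongrightarrow> indicator ?S z *\<^sub>R (case z of (t, x) \<Rightarrow> f t x)"
      by (intro tendsto_eventually) (auto simp: eventually_sequentially intro!: exI[of _ N])
  qed
  then have "(\<lambda>(t, x). f t x) \<in> borel_measurable (lebesgue_on ?S)"
  proof -
    assume a: "(\<lambda>z. indicator ?S z *\<^sub>R (case z of (t, x) \<Rightarrow> f t x)) \<in> borel_measurable lebesgue"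
    have "?S \<inter> space lebesgue \<in> sets lebesgue" using b(1) by simp
    from borel_measurable_restrict_space_iff[OF this, of "\<lambda>(t, x). f t x"] a show ?thesis by simp
  qed
  from lebesgue_on_ex_borel[OF this b(1)] obtain g where g: "g \<in> borel_measurable borel"
    "AE x in lborel. x \<in> ?S \<longrightarrow> g x = (\<lambda>(t, x). f t x) x" "\<And>x. x \<notin> ?S \<Longrightarrow> g x = 0" by blast
  show ?thesis
  proof (rule that[OF g(1)])
    show "AE z in lborel. 0 \<le> fst z \<and> snd z \<in> \<Omega> \<longrightarrow> g z = f (fst z) (snd z)"
      using g(2) by eventually_elim (auto simp: split_beta)
    show "g (t, x) = 0" if "t < 0 \<or> x \<notin> \<Omega>" for t x using g(3)[of "(t, x)"] that by auto
  qed
qed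

lemma AE_lborel_pairD:
  fixes P :: "'a::euclidean_space \<times> 'b::euclidean_space \<Rightarrow> bool"
  assumes "AE z in lborel. P z"
  shows "AE x in lborel. AE y in lborel. P (x, y)"
  using assms unfolding lborel_prod[symmetric] by (rule lborel_pair.AE_pair)

text \<open>A null set times a whole space is null, since infinity times 0 is 0 for extended
  nonnegative reals.\<close>

lemma AE_lborel_snd:
  fixes P :: "'b::euclidean_space \<Rightarrow> bool"
  assumes "AE x in lborel. P x"
  shows "AE z in (lborel :: ('a::euclidean_space \<times> 'b) measure). P (snd z)"
proof -
  obtain Z where Z: "{x. \<not> P x} \<subseteq> Z" "Z \<in> null_sets lborel"
    using assms by (auto elim!: AE_E simp: null_sets_def)
  have "(UNIV :: 'a set) \<times> Z \<in> null_sets (lborel \<Otimes>\<^sub>M lborel)"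
  proof (rule null_setsI)
    have "emeasure (lborel \<Otimes>\<^sub>M lborel) ((UNIV :: 'a set) \<times> Z) = emeasure lborel (UNIV :: 'a set) * emeasure lborel Z"
      using Z(2) by (intro lborel.emeasure_pair_measure_Times) auto
    then show "emeasure (lborel \<Otimes>\<^sub>M lborel) ((UNIV :: 'a set) \<times> Z) = 0" using Z(2) by auto
    show "(UNIV :: 'a set) \<times> Z \<in> sets (lborel \<Otimes>\<^sub>M lborel)" using Z(2) by auto
  qed
  then have "(UNIV :: 'a set) \<times> Z \<in> null_sets (lborel :: ('a \<times> 'b) measure)" by (simp add: lborel_prod)
  then show ?thesis by (rule AE_I') (use Z in auto)
qed

lemma nn_integral_lborel_pair:
  fixes f :: "'a::euclidean_space \<times> 'b::euclidean_space \<Rightarrow> ennreal"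
  assumes "f \<in> borel_measurable borel"
  shows "(\<integral>\<^sup>+z. f z \<partial>lborel) = (\<integral>\<^sup>+x. (\<integral>\<^sup>+y. f (x, y) \<partial>lborel) \<partial>lborel)"
  using assms lborel.nn_integral_fst[of f lborel] by (simp add: lborel_prod)

text \<open>The Borel version of \<open>Q\<close> is 0 outside \<Omega>, so that integrals can run
  over the whole space; this predicate covers both regimes.\<close>

definition psd0 :: "real^'n^'n \<Rightarrow> bool" where "psd0 A \<longleftrightarrow> spd A \<or> A = 0"

lemma qnorm_zero_left[simp]: "qnorm 0 g = 0" by (simp add: qnorm_def)
lemma qnorm_zero_right[simp]: "qnorm A 0 = 0" by (simp add: qnorm_def)

lemma psd0_qnorm:
  assumes "psd0 A"
  shows "0 \<le> qnorm A g" "qnorm A (c *\<^sub>R a) = \<bar>c\<bar> * qnorm A a" "\<bar>(A *v a) \<bullet> b\<bar> \<le> qnorm A a * qnorm A b"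
    "(A *v a) \<bullet> a = (qnorm A a)\<^sup>2"
  using assms by (auto simp: psd0_def qnorm_nonneg qnorm_scale qnorm_cauchy_schwarz qnorm_self)

text \<open>Splitting at \<open>y = d * x\<close> gives Young's inequality with non-sharp constants
  but with a coefficient of \<open>x powr p\<close> that can be taken as small as desired.\<close>

lemma young_powr:
  fixes x y d p :: real
  assumes "0 \<le> x" "0 \<le> y" "0 < d" "1 < p"
  shows "x powr (p - 1) * y \<le> d * x powr p + d powr (1 - p) * y powr p"
proof (cases "y \<le> d * x")
  case True
  have "x powr (p - 1) * y \<le> x powr (p - 1) * (d * x)" using True by (intro mult_left_mono) auto
  also have "\<dots> = d * x powr p" using assms by (cases "x = 0") (auto simp: powr_diff)
  finally show ?thesis using assms by (simp add: add_increasing2)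
next
  case False
  then have y: "0 < y" using assms mult_nonneg_nonneg[of d x] by linarith
  have "x \<le> y / d" using False assms by (simp add: pos_le_divide_eq mult.commute)
  then have "x powr (p - 1) * y \<le> (y / d) powr (p - 1) * y" using assms by (intro mult_right_mono powr_mono2) auto
  also have "\<dots> = d powr (1 - p) * y powr p"
    using y assms by (simp add: powr_divide powr_diff field_simps)
  finally show ?thesis using assms by (simp add: add_increasing)
qed

lemma flux_inner_bound:
  assumes "psd0 A" "1 < p"
  shows "\<bar>(qnorm A a powr (p - 2) *\<^sub>R (A *v a)) \<bullet> b\<bar> \<le> qnorm A a powr (p - 1) * qnorm A b"
proof -
  note q = psd0_qnorm[OF assms(1)]
  have "\<bar>(qnorm A a powr (p - 2) *\<^sub>R (A *v a)) \<bullet> b\<bar> \<le> qnorm A a powr (p - 2) * (qnorm A a * qnorm A b)"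
    using q(3) by (simp add: abs_mult mult_left_mono)
  also have "\<dots> = qnorm A a powr (p - 1) * qnorm A b"
  \<comment> \<open>Where the weighted gradient vanishes the negative exponent \<open>p - 2\<close>
    is harmless, because \<open>0 powr (p - 2)\<close> is 0.\<close>
  proof (cases "qnorm A a = 0")
    case False
    then have "0 < qnorm A a" using q(1)[of a] by linarith
    then have "qnorm A a powr (p - 1) = qnorm A a powr (p - 2) * qnorm A a"
      using powr_add[of "qnorm A a" "p - 2" 1] by simp
    then show ?thesis by simp
  qed simp
  finally show ?thesis .
qed

text \<open>\<open>Qh\<close>, \<open>Gh\<close>, \<open>uh\<close> are Borel representatives of \<open>Q\<close>, \<open>G\<close>, \<open>u\<close>: the data are only Lebesgue
  measurable jointly in time and space, whereas Tonelli needs product measurability.\<close>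

locale weak_flow_borel = degenerate_weight \<Omega> Q v p
  for \<Omega> :: "(real^'n) set" and Q v p +
  fixes u0 :: "real^'n \<Rightarrow> real" and u :: "real \<Rightarrow> real^'n \<Rightarrow> real" and G :: "real \<Rightarrow> real^'n \<Rightarrow> real^'n"
    and Qh :: "real^'n \<Rightarrow> real^'n^'n" and Gh :: "real \<times> (real^'n) \<Rightarrow> real^'n" and uh :: "real \<times> (real^'n) \<Rightarrow> real"
  assumes u0_meas[measurable]: "u0 \<in> borel_measurable (lebesgue_on \<Omega>)"
    and u0_L2: "(\<integral>\<^sup>+x. ennreal ((u0 x)\<^sup>2 * v x) \<partial>lebesgue_on \<Omega>) < \<infinity>"
    and sol: "\<And>T. 0 < T \<Longrightarrow> weak_solution \<Omega> Q v p u0 T u G"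
    and Qh_meas[measurable]: "Qh \<in> borel_measurable borel"
    and Gh_meas[measurable]: "Gh \<in> borel_measurable borel"
    and uh_meas[measurable]: "uh \<in> borel_measurable borel"
    and Qh_eq: "AE x in lborel. x \<in> \<Omega> \<longrightarrow> Qh x = Q x" and Qh_out: "\<And>x. x \<notin> \<Omega> \<Longrightarrow> Qh x = 0"
    and Gh_eq: "AE z in lborel. 0 \<le> fst z \<and> snd z \<in> \<Omega> \<longrightarrow> Gh z = G (fst z) (snd z)"
    and Gh_out: "\<And>t x. t < 0 \<or> x \<notin> \<Omega> \<Longrightarrow> Gh (t, x) = 0"
    and uh_eq: "AE z in lborel. 0 \<le> fst z \<and> snd z \<in> \<Omega> \<longrightarrow> uh z = u (fst z) (snd z)"
begin

definition N where "N z = qnorm (Qh (snd z)) (Gh z)"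
definition flux where "flux z = N z powr (p - 2) *\<^sub>R (Qh (snd z) *v Gh z)"
definition energyh where "energyh w = (\<integral>\<^sup>+x. ennreal (qnorm (Qh x) (w x) powr p) \<partial>lborel)"

lemma N_meas[measurable]: "N \<in> borel_measurable borel"
  unfolding N_def[abs_def] by measurable
lemma flux_meas[measurable]: "flux \<in> borel_measurable borel"
  unfolding flux_def[abs_def] by measurable

lemma Om_borel[measurable]: "\<Omega> \<in> sets borel" using open_Om by simp

lemma AE_psd0: "AE x in lborel. psd0 (Qh x)"
proof -
  have "AE x in lborel. x \<in> \<Omega> \<longrightarrow> spd (Q x)" using AE_spd by (simp add: AE_lebesgue_on_iff)
  then show ?thesis using Qh_eq
    by eventually_elim (use Qh_out in \<open>auto simp: psd0_def\<close>)
qed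

lemma AE_psd0_pair: "AE z in lborel. psd0 (Qh (snd (z :: real \<times> (real^'n))))"
  using AE_psd0 by (rule AE_lborel_snd)

lemma energyh_eq:
  assumes "AE x in lborel. x \<in> \<Omega> \<longrightarrow> w x = g x"
  shows "energyh w = energy g"
proof -
  have "energy g = (\<integral>\<^sup>+x. ennreal (qnorm (Q x) (g x) powr p) * indicator \<Omega> x \<partial>lborel)"
    unfolding energy_def by (rule nn_integral_lebesgue_on) simp
  also have "\<dots> = energyh w"
    unfolding energyh_def
    by (rule nn_integral_cong_AE) (use assms Qh_eq in eventually_elim, use Qh_out in \<open>auto simp: indicator_def\<close>)
  finally show ?thesis ..
qed

lemma u_meas[measurable]: "0 \<le> t \<Longrightarrow> u t \<in> borel_measurable M"
  and u_L2: "0 \<le> t \<Longrightarrow> (\<integral>\<^sup>+x. ennreal ((u t x)\<^sup>2 * v x) \<partial>M) < \<infinity>"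
  using sol[of "t + 1"] by (auto simp: weak_solution_def)

lemma u_cont: "0 < t \<Longrightarrow> ((\<lambda>s. \<integral>\<^sup>+x. ennreal ((u s x - u t x)\<^sup>2 * v x) \<partial>M) \<longlongrightarrow> 0) (at t)"
proof -
  assume t: "0 < t"
  have "((\<lambda>s. \<integral>\<^sup>+x. ennreal ((u s x - u t x)\<^sup>2 * v x) \<partial>M) \<longlongrightarrow> 0) (at t within {0..t+1})"
    using sol[of "t + 1"] t by (auto simp: weak_solution_def)
  moreover have "at t within {0..t+1} = at t" using t by (intro at_within_interior) auto
  ultimately show ?thesis by simp
qed

lemma u_init: "((\<lambda>t. \<integral>\<^sup>+x. ennreal ((u t x - u0 x)\<^sup>2 * v x) \<partial>M) \<longlongrightarrow> 0) (at_right 0)"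
  using sol[of 1] by (auto simp: weak_solution_def)

lemma AE_time:
  fixes P :: "real \<Rightarrow> bool"
  assumes "\<And>T. 0 < T \<Longrightarrow> AE t in lebesgue_on {0..T}. P t"
  shows "AE t in lborel. 0 \<le> t \<longrightarrow> P t"
proof -
  have "AE t in lborel. t \<in> {0..real (Suc n)} \<longrightarrow> P t" for n
    using assms[of "real (Suc n)"] by (subst AE_lebesgue_on_iff[symmetric]) auto
  then have "AE t in lborel. \<forall>n. t \<in> {0..real (Suc n)} \<longrightarrow> P t"
    unfolding AE_all_countable by blast
  then show ?thesis
  proof eventually_elim
    case (elim t)
    obtain n :: nat where "t \<le> real n" using real_arch_simple by blast
    then show ?case using elim[rule_format, of n] by auto
  qed
qed

lemma AE_H0: "AE t in lborel. 0 \<le> t \<longrightarrow> (u t, G t) \<in> H0 \<Omega> Q v p"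
  using sol by (intro AE_time) (auto simp: weak_solution_def)

text \<open>Null sets in space-time are sliced by Tonelli: at almost every time the representatives
  agree with the actual solution almost everywhere in space. The energy estimates are carried out at
  such times.\<close>

lemma AE_good: "AE t in lborel. 0 \<le> t \<longrightarrow> (u t, G t) \<in> H0 \<Omega> Q v p \<and>
    (AE x in lborel. x \<in> \<Omega> \<longrightarrow> Gh (t, x) = G t x \<and> uh (t, x) = u t x)"
  using AE_H0 AE_lborel_pairD[OF Gh_eq] AE_lborel_pairD[OF uh_eq]
proof eventually_elim
  case (elim t)
  show ?case
  proof (intro impI conjI)
    assume t: "0 \<le> t"
    show "(u t, G t) \<in> H0 \<Omega> Q v p" using elim(1) t by blast
    show "AE x in lborel. x \<in> \<Omega> \<longrightarrow> Gh (t, x) = G t x \<and> uh (t, x) = u t x"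
      using elim(2,3) by eventually_elim (use t in auto)
  qed
qed

lemma time_energy_finite:
  assumes T: "0 < T"
  shows "(\<integral>\<^sup>+z. indicator {0..T} (fst z) * ennreal (N z powr p) \<partial>lborel) < \<infinity>"
proof -
  have "(\<integral>\<^sup>+z. indicator {0..T} (fst z) * ennreal (N z powr p) \<partial>lborel) =
    (\<integral>\<^sup>+t. (\<integral>\<^sup>+x. indicator {0..T} t * ennreal (N (t, x) powr p) \<partial>lborel) \<partial>lborel)"
    by (subst nn_integral_lborel_pair) simp_all
  also have "\<dots> = (\<integral>\<^sup>+t. indicator {0..T} t * energyh (\<lambda>x. Gh (t, x)) \<partial>lborel)"
    unfolding energyh_def by (intro nn_integral_cong, subst nn_integral_cmult) (auto simp: N_def)
  also have "\<dots> = (\<integral>\<^sup>+t. energy (G t) * indicator {0..T} t \<partial>lborel)"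
  proof (rule nn_integral_cong_AE)
    show "AE t in lborel. indicator {0..T} t * energyh (\<lambda>x. Gh (t, x)) = energy (G t) * indicator {0..T} t"
      using AE_good
    proof eventually_elim
      case (elim t)
      show ?case
      proof (cases "t \<in> {0..T}")
        case True
        then have "AE x in lborel. x \<in> \<Omega> \<longrightarrow> Gh (t, x) = G t x" using elim by (auto elim: eventually_mono)
        from energyh_eq[OF this] show ?thesis by (simp add: mult.commute)
      qed simp
    qed
  qed
  also have "\<dots> = (\<integral>\<^sup>+t. (\<integral>\<^sup>+x. ennreal (norm (msqrt (Q x) *v G t x) powr p) \<partial>M) \<partial>lebesgue_on {0..T})"
    by (subst nn_integral_lebesgue_on) (auto simp: energy_msqrt)
  also have "\<dots> < \<infinity>" using sol[OF T] by (simp add: weak_solution_def)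
  finally show ?thesis .
qed

text \<open>\<open>w\<close> depends on space only, so its share factors into the measure of
  \<open>I\<close> times its energy. The free \<open>d\<close> allows the flux term to be made small
  first and the energy of \<open>w\<close> afterwards.\<close>

lemma flux_pair_bound:
  assumes [measurable]: "w \<in> borel_measurable borel" "I \<in> sets borel" and d: "0 < d"
  shows "(\<integral>\<^sup>+z. indicator I (fst z) * ennreal \<bar>flux z \<bullet> w (snd z)\<bar> \<partial>lborel) \<le>
    ennreal d * (\<integral>\<^sup>+z. indicator I (fst z) * ennreal (N z powr p) \<partial>lborel) +
    ennreal (d powr (1 - p)) * (emeasure lborel I * energyh w)"
proof -
  let ?B = "\<lambda>z. ennreal d * (indicator I (fst z) * ennreal (N z powr p)) +
      ennreal (d powr (1 - p)) * (indicator I (fst z) * ennreal (qnorm (Qh (snd z)) (w (snd z)) powr p))"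
  have "(\<integral>\<^sup>+z. indicator I (fst z) * ennreal \<bar>flux z \<bullet> w (snd z)\<bar> \<partial>lborel) \<le> (\<integral>\<^sup>+z. ?B z \<partial>lborel)"
  proof (rule nn_integral_mono_AE)
    show "AE z in lborel. indicator I (fst z) * ennreal \<bar>flux z \<bullet> w (snd z)\<bar> \<le> ?B z"
      using AE_psd0_pair
    proof eventually_elim
      case (elim z)
      have "\<bar>flux z \<bullet> w (snd z)\<bar> \<le> N z powr (p - 1) * qnorm (Qh (snd z)) (w (snd z))"
        unfolding flux_def N_def using flux_inner_bound[OF elim p(1)] .
      also have "\<dots> \<le> d * N z powr p + d powr (1 - p) * qnorm (Qh (snd z)) (w (snd z)) powr p"
        using psd0_qnorm(1)[OF elim] d p by (intro young_powr) (auto simp: N_def)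
      finally have "ennreal \<bar>flux z \<bullet> w (snd z)\<bar> \<le> ennreal d * ennreal (N z powr p) + ennreal (d powr (1 - p)) * ennreal (qnorm (Qh (snd z)) (w (snd z)) powr p)"
        using d by (simp flip: ennreal_mult ennreal_plus)
      then show ?case by (cases "fst z \<in> I") auto
    qed
  qed
  also have "\<dots> = ennreal d * (\<integral>\<^sup>+z. indicator I (fst z) * ennreal (N z powr p) \<partial>lborel) +
      ennreal (d powr (1 - p)) * (\<integral>\<^sup>+z. indicator I (fst z) * ennreal (qnorm (Qh (snd z)) (w (snd z)) powr p) \<partial>lborel)"
    by (subst nn_integral_add) (auto simp: nn_integral_cmult)
  also have "(\<integral>\<^sup>+z. indicator I (fst z) * ennreal (qnorm (Qh (snd z)) (w (snd z)) powr p) \<partial>lborel) = emeasure lborel I * energyh w"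
    by (subst nn_integral_lborel_pair) (auto simp: energyh_def nn_integral_cmult nn_integral_multc)
  finally show ?thesis .
qed

lemma flux_pair_integrable:
  assumes [measurable]: "w \<in> borel_measurable borel" "I \<in> sets borel" and I: "I \<subseteq> {0..T}" and T: "0 < T" and w: "energyh w < \<infinity>"
  shows "integrable lborel (\<lambda>z. indicator I (fst z) * (flux z \<bullet> w (snd z)))"
proof (rule integrableI_bounded)
  have "(\<integral>\<^sup>+z. indicator I (fst z) * ennreal (N z powr p) \<partial>lborel) \<le> (\<integral>\<^sup>+z. indicator {0..T} (fst z) * ennreal (N z powr p) \<partial>lborel)"
    using I by (intro nn_integral_mono mult_right_mono) (auto simp: indicator_def)
  then have 1: "(\<integral>\<^sup>+z. indicator I (fst z) * ennreal (N z powr p) \<partial>lborel) < \<infinity>"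
    using time_energy_finite[OF T] by (rule le_less_trans)
  have "emeasure lborel I \<le> emeasure lborel {0..T}" using I by (intro emeasure_mono) auto
  then have 2: "emeasure lborel I < \<infinity>" using T by (auto intro: le_less_trans)
  have "(\<integral>\<^sup>+z. ennreal (norm (indicator I (fst z) * (flux z \<bullet> w (snd z)))) \<partial>lborel) =
    (\<integral>\<^sup>+z. indicator I (fst z) * ennreal \<bar>flux z \<bullet> w (snd z)\<bar> \<partial>lborel)"
    by (intro nn_integral_cong) (auto simp: indicator_def)
  also have "\<dots> \<le> ennreal 1 * (\<integral>\<^sup>+z. indicator I (fst z) * ennreal (N z powr p) \<partial>lborel) +
    ennreal (1 powr (1 - p)) * (emeasure lborel I * energyh w)" by (rule flux_pair_bound) auto
  also have "\<dots> < \<infinity>" using 1 2 w by (simp add: ennreal_mult_less_top)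
  finally show "(\<integral>\<^sup>+z. ennreal (norm (indicator I (fst z) * (flux z \<bullet> w (snd z)))) \<partial>lborel) < \<infinity>" .
qed measurable

lemma test_fun_const:
  assumes "lipc \<Omega> \<phi>"
  shows "test_fun \<Omega> T (\<lambda>_. \<phi>)"
proof -
  obtain L R K where *: "L-lipschitz_on UNIV \<phi>" "compact K" "K \<subseteq> \<Omega>" "\<forall>x. x \<notin> K \<longrightarrow> \<phi> x = 0" using lipcE[OF assms] by metis
  define D where "D k t = (if k = 0 then \<phi> else (\<lambda>x. 0))" for k :: nat and t :: real
  \<comment> \<open>The second supremum in \<open>lip_norm\<close> ranges over pairs of distinct
    points, so such a pair must be exhibited.\<close>
  have "lip_norm (\<lambda>x::real^'n. 0) = 0"
  proof -
    have "(axis undefined 1 :: real^'n) \<noteq> 0" by (simp add: axis_eq_0_iff)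
    then have "{(x, y). x \<noteq> (y :: real^'n)} \<noteq> {}" by blast
    then show ?thesis by (simp add: lip_norm_def split_beta)
  qed
  then have "(\<lambda>s. lip_norm (\<lambda>x. (D k s x - D k t x) / (s - t) - D (Suc k) t x)) = (\<lambda>s. 0)" for k t
    by (simp add: D_def)
  moreover have "\<exists>L. L-lipschitz_on UNIV (D k t)" for k t
  proof (cases "k = 0")
    case True
    then show ?thesis using *(1) by (auto simp: D_def)
  next
    case False
    then show ?thesis by (auto simp: D_def intro!: exI[of _ 0] lipschitz_on_constant)
  qed
  ultimately have "D 0 = (\<lambda>_. \<phi>) \<and> (\<forall>k. \<forall>t\<in>{0..T}. (\<forall>x. x \<notin> K \<longrightarrow> D k t x = 0) \<and> (\<exists>L. L-lipschitz_on UNIV (D k t)) \<and>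
     ((\<lambda>s. lip_norm (\<lambda>x. (D k s x - D k t x) / (s - t) - D (Suc k) t x)) \<longlongrightarrow> 0) (at t within {0..T}))"
    using *(4) by (auto simp: D_def)
  then show ?thesis unfolding test_fun_def using *(2,3) by blast
qed

lemma energyh_pgrad_finite:
  assumes "lipc \<Omega> \<phi>"
  shows "energyh (pgrad \<phi>) < \<infinity>"
proof -
  have "energyh (pgrad \<phi>) = energy (grad \<phi>)"
    using lipc_AE_grad[OF assms] by (intro energyh_eq) (auto elim: eventually_mono)
  then show ?thesis using H0_D(3)[OF lipc_in_H0[OF assms]] by simp
qed

text \<open>A test function constant in time leaves only the boundary terms on the right. The
  iterated Lebesgue integral of the definition is turned into one Borel integral over space-time,
  for which the bounds on the flux are stated.\<close>

lemma weak_const: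
  assumes \<phi>: "lipc \<Omega> \<phi>" and T: "0 < T"
  shows "(\<integral>z. indicator {0..T} (fst z) * (flux z \<bullet> pgrad \<phi> (snd z)) \<partial>lborel) =
    (\<integral>x. u0 x * \<phi> x * v x \<partial>M) - (\<integral>x. u T x * \<phi> x * v x \<partial>M)"
proof -
  have [measurable]: "\<phi> \<in> borel_measurable borel" by (rule lipc_measurable[OF \<phi>])
  let ?J = "\<lambda>t. \<integral>x. flux (t, x) \<bullet> pgrad \<phi> x \<partial>lborel"
  let ?I = "\<lambda>t. \<integral>x. norm (msqrt (Q x) *v G t x) powr (p - 2) * ((Q x *v G t x) \<bullet> grad \<phi> x) \<partial>M"
  have "(\<integral>t. ?I t \<partial>lebesgue_on {0..T}) =
     (\<integral>t. (\<integral>x. u t x * vector_derivative (\<lambda>s. \<phi> x) (at t within {0..T}) * v x \<partial>M) \<partial>lebesgue_on {0..T})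
          + (\<integral>x. u0 x * \<phi> x * v x \<partial>M) - (\<integral>x. u T x * \<phi> x * v x \<partial>M)"
    using sol[OF T] test_fun_const[OF \<phi>, of T] by (simp add: weak_solution_def)
  also have "(\<integral>t. (\<integral>x. u t x * vector_derivative (\<lambda>s. \<phi> x) (at t within {0..T}) * v x \<partial>M) \<partial>lebesgue_on {0..T})
     = (\<integral>t. 0 \<partial>lebesgue_on {0..T})"
  proof (rule Bochner_Integration.integral_cong)
    fix t assume "t \<in> space (lebesgue_on {0..T})"
    then have "vector_derivative (\<lambda>s. \<phi> x) (at t within {0..T}) = 0" for x
      using T by (intro vector_derivative_within_cbox[of 0 T, simplified]) (auto intro: has_vector_derivative_const)
    then show "(\<integral>x. u t x * vector_derivative (\<lambda>s. \<phi> x) (at t within {0..T}) * v x \<partial>M) = 0" by simp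
  qed simp
  finally have eq: "(\<integral>t. ?I t \<partial>lebesgue_on {0..T}) = (\<integral>x. u0 x * \<phi> x * v x \<partial>M) - (\<integral>x. u T x * \<phi> x * v x \<partial>M)" by simp
  have IJ: "AE t in lborel. 0 \<le> t \<longrightarrow> ?I t = ?J t"
    using AE_good
  proof eventually_elim
    case (elim t)
    show ?case
    proof
      assume "0 \<le> t"
      then have t: "AE x in lborel. x \<in> \<Omega> \<longrightarrow> Gh (t, x) = G t x" using elim by (auto elim: eventually_mono)
      have s: "AE x in lborel. x \<in> \<Omega> \<longrightarrow> spd (Q x)" using AE_spd by (simp add: AE_lebesgue_on_iff)
      have "?I t = (\<integral>x. indicator \<Omega> x *\<^sub>R (norm (msqrt (Q x) *v G t x) powr (p - 2) * ((Q x *v G t x) \<bullet> grad \<phi> x)) \<partial>lebesgue)"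
        by (rule integral_restrict_space) simp
      also have "\<dots> = ?J t"
      proof (rule integral_lebesgue_AE_borel(1))
        show "AE x in lborel. indicator \<Omega> x *\<^sub>R (norm (msqrt (Q x) *v G t x) powr (p - 2) * ((Q x *v G t x) \<bullet> grad \<phi> x)) = flux (t, x) \<bullet> pgrad \<phi> x"
          using t s Qh_eq lipc_AE_grad[OF \<phi>]
          by eventually_elim (use Qh_out in \<open>auto simp: flux_def N_def spd_norm indicator_def\<close>)
      qed measurable
      finally show "?I t = ?J t" .
    qed
  qed
  have "(\<integral>t. ?I t \<partial>lebesgue_on {0..T}) = (\<integral>t. indicator {0..T} t *\<^sub>R ?I t \<partial>lebesgue)"
    by (rule integral_restrict_space) simp
  also have "\<dots> = (\<integral>t. indicator {0..T} t * ?J t \<partial>lborel)"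
  proof (rule integral_lebesgue_AE_borel(1))
    show "AE t in lborel. indicator {0..T} t *\<^sub>R ?I t = indicator {0..T} t * ?J t"
      using IJ by eventually_elim (auto simp: indicator_def)
    have "(\<lambda>t. \<integral>x. flux (t, x) \<bullet> pgrad \<phi> x \<partial>lborel) \<in> borel_measurable borel"
      by (rule lborel.borel_measurable_lebesgue_integral) simp
    then show "(\<lambda>t. indicator {0..T} t * ?J t) \<in> borel_measurable borel" by measurable
  qed
  also have "\<dots> = (\<integral>t. (\<integral>x. indicator {0..T} t * (flux (t, x) \<bullet> pgrad \<phi> x) \<partial>lborel) \<partial>lborel)" by simp
  also have "\<dots> = (\<integral>z. indicator {0..T} (fst z) * (flux z \<bullet> pgrad \<phi> (snd z)) \<partial>lborel)"
  proof -
    have "integrable (lborel \<Otimes>\<^sub>M lborel) (\<lambda>z. indicator {0..T} (fst z) * (flux z \<bullet> pgrad \<phi> (snd z)))"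
      using flux_pair_integrable[of "pgrad \<phi>" "{0..T}" T] T energyh_pgrad_finite[OF \<phi>] by (simp add: lborel_prod)
    from lborel_pair.integral_fst'[OF this] show ?thesis by (simp add: lborel_prod)
  qed
  finally show ?thesis using eq by simp
qed

lemma L2_bounded_integrable:
  assumes [measurable]: "f \<in> borel_measurable M" "g \<in> borel_measurable M"
    and f: "(\<integral>\<^sup>+x. ennreal ((f x)\<^sup>2 * v x) \<partial>M) < \<infinity>" and g: "\<And>x. \<bar>g x\<bar> \<le> B"
  shows "integrable M (\<lambda>x. f x * g x * v x)"
proof -
  have B: "0 \<le> B" using g[of undefined] by linarith
  have "integrable M (\<lambda>x. (f x)\<^sup>2 * v x)"
    using f v_nonneg by (intro integrableI_nonneg) (auto intro!: AE_I2 mult_nonneg_nonneg)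
  then have "integrable M (\<lambda>x. B * ((f x)\<^sup>2 * v x + v x))" using v_int by auto
  then show ?thesis
  proof (rule Bochner_Integration.integrable_bound)
    show "AE x in M. norm (f x * g x * v x) \<le> norm (B * ((f x)\<^sup>2 * v x + v x))"
    proof (rule AE_I2)
      fix x assume x: "x \<in> space M"
      have "\<bar>f x\<bar> \<le> (f x)\<^sup>2 + 1"
      proof -
        have "0 \<le> (\<bar>f x\<bar> - 1)\<^sup>2 + \<bar>f x\<bar>\<^sup>2 + 1" by simp
        then show ?thesis by (simp add: power2_diff)
      qed
      then have "\<bar>f x\<bar> * \<bar>g x\<bar> \<le> ((f x)\<^sup>2 + 1) * B" using g[of x] by (intro mult_mono) auto
      then have "\<bar>f x\<bar> * \<bar>g x\<bar> * v x \<le> ((f x)\<^sup>2 + 1) * B * v x" using v_nonneg x by (intro mult_right_mono) auto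
      then show "norm (f x * g x * v x) \<le> norm (B * ((f x)\<^sup>2 * v x + v x))"
        using B v_nonneg x by (simp add: abs_mult algebra_simps)
    qed
  qed measurable
qed

text \<open>The identities up to \<open>t\<close> and up to \<open>s\<close> share the initial term,
  so their difference leaves the flux over \<open>{s<..t}\<close>; the interval is half-open to make
  the splitting of \<open>{0..t}\<close> exact.\<close>

lemma weak_increment_lipc:
  assumes \<phi>: "lipc \<Omega> \<phi>" and st: "0 < s" "s < t"
  shows "(\<integral>x. (u t x - u s x) * \<phi> x * v x \<partial>M) = - (\<integral>z. indicator {s<..t} (fst z) * (flux z \<bullet> pgrad \<phi> (snd z)) \<partial>lborel)"
proof -
  have [measurable]: "\<phi> \<in> borel_measurable borel" by (rule lipc_measurable[OF \<phi>])
  obtain B where B: "\<And>x. \<bar>\<phi> x\<bar> \<le> B" using lipc_bounded[OF \<phi>] by blast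
  have i: "integrable M (\<lambda>x. u r x * \<phi> x * v x)" if "0 \<le> r" for r
    by (rule L2_bounded_integrable[OF u_meas[OF that] lipc_meas_M(1)[OF \<phi>] u_L2[OF that] B])
  let ?g = "\<lambda>I z. indicator I (fst z) * (flux z \<bullet> pgrad \<phi> (snd z))"
  have j: "integrable lborel (?g {0..s})" "integrable lborel (?g {s<..t})"
  proof -
    have "{0..s} \<subseteq> {0..t}" "{s<..t} \<subseteq> {0..t}" "0 < t" using st by auto
    then show "integrable lborel (?g {0..s})" "integrable lborel (?g {s<..t})"
      using energyh_pgrad_finite[OF \<phi>]
      by (intro flux_pair_integrable[where w = "pgrad \<phi>" and T = t] pgrad_measurable; simp)+
  qed
  have "?g {0..t} = (\<lambda>z. ?g {0..s} z + ?g {s<..t} z)" using st by (auto simp: indicator_def fun_eq_iff)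
  then have "(\<integral>z. ?g {0..t} z \<partial>lborel) = (\<integral>z. ?g {0..s} z \<partial>lborel) + (\<integral>z. ?g {s<..t} z \<partial>lborel)"
    using Bochner_Integration.integral_add[OF j] by simp
  moreover have "(\<integral>x. (u t x - u s x) * \<phi> x * v x \<partial>M) = (\<integral>x. u t x * \<phi> x * v x \<partial>M) - (\<integral>x. u s x * \<phi> x * v x \<partial>M)"
    using i[of t] i[of s] st by (simp add: left_diff_distrib)
  ultimately show ?thesis using weak_const[OF \<phi>, of t] weak_const[OF \<phi>, of s] st by simp
qed

end

text \<open>Pointwise \<open>|d| \<le> k + d^2 / k\<close>. When \<open>v\<close> has finite mass,
  fixing a small \<open>k\<close> first turns smallness in \<open>L^2_v\<close> into smallness in
  \<open>L^1_v\<close>.\<close>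

lemma nn_integral_weight_L1_le:
  fixes d v :: "'a \<Rightarrow> real"
  assumes [measurable]: "d \<in> borel_measurable M" "v \<in> borel_measurable M" and v: "\<And>x. x \<in> space M \<Longrightarrow> 0 \<le> v x" and k: "0 < k"
  shows "(\<integral>\<^sup>+x. ennreal (\<bar>d x\<bar> * v x) \<partial>M) \<le> ennreal k * (\<integral>\<^sup>+x. ennreal (v x) \<partial>M) + ennreal (1 / k) * (\<integral>\<^sup>+x. ennreal ((d x)\<^sup>2 * v x) \<partial>M)"
proof -
  have "(\<integral>\<^sup>+x. ennreal (\<bar>d x\<bar> * v x) \<partial>M) \<le> (\<integral>\<^sup>+x. ennreal k * ennreal (v x) + ennreal (1 / k) * ennreal ((d x)\<^sup>2 * v x) \<partial>M)"
  proof (rule nn_integral_mono)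
    fix x assume x: "x \<in> space M"
    have "\<bar>d x\<bar> \<le> k + (1 / k) * (d x)\<^sup>2"
    proof (cases "\<bar>d x\<bar> \<le> k")
      case True
      then show ?thesis using k by (simp add: add_increasing2)
    next
      case False
      then have "k * \<bar>d x\<bar> \<le> \<bar>d x\<bar> * \<bar>d x\<bar>" by (intro mult_right_mono) auto
      then have "\<bar>d x\<bar> \<le> (1 / k) * (d x)\<^sup>2" using k by (simp add: power2_eq_square pos_le_divide_eq mult.commute)
      then show ?thesis using k by simp
    qed
    then have "\<bar>d x\<bar> * v x \<le> (k + (1 / k) * (d x)\<^sup>2) * v x" using v[OF x] by (rule mult_right_mono)
    also have "\<dots> = k * v x + (1 / k) * ((d x)\<^sup>2 * v x)" by (simp add: algebra_simps)
    finally have "ennreal (\<bar>d x\<bar> * v x) \<le> ennreal (k * v x + (1 / k) * ((d x)\<^sup>2 * v x))" by (rule ennreal_leI)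
    also have "\<dots> = ennreal (k * v x) + ennreal ((1 / k) * ((d x)\<^sup>2 * v x))"
      using k v[OF x] by (intro ennreal_plus) auto
    also have "ennreal (k * v x) = ennreal k * ennreal (v x)"
      using k v[OF x] by (intro ennreal_mult) auto
    also have "ennreal ((1 / k) * ((d x)\<^sup>2 * v x)) = ennreal (1 / k) * ennreal ((d x)\<^sup>2 * v x)"
      using k v[OF x] by (intro ennreal_mult) auto
    finally show "ennreal (\<bar>d x\<bar> * v x) \<le> ennreal k * ennreal (v x) + ennreal (1 / k) * ennreal ((d x)\<^sup>2 * v x)" .
  qed
  also have "\<dots> = ennreal k * (\<integral>\<^sup>+x. ennreal (v x) \<partial>M) + ennreal (1 / k) * (\<integral>\<^sup>+x. ennreal ((d x)\<^sup>2 * v x) \<partial>M)"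
    by (simp add: nn_integral_add nn_integral_cmult)
  finally show ?thesis .
qed

lemma ennreal_mult_le_small:
  fixes A :: ennreal and e :: real
  assumes "A < \<infinity>" "0 < e"
  obtains d :: real where "0 < d" "ennreal d * A \<le> ennreal e"
proof -
  obtain a where a: "A = ennreal a" "0 \<le> a" using assms(1) by (cases A) auto
  show ?thesis
  proof (rule that[of "e / (a + 1)"])
    show "0 < e / (a + 1)" using a assms by simp
    have "e / (a + 1) * a \<le> e" using a assms(2) by (simp add: field_simps)
    then show "ennreal (e / (a + 1)) * A \<le> ennreal e" using a assms by (simp flip: ennreal_mult add: ennreal_leI)
  qed
qed

section \<open>Integral functionals with Lipschitz density on \<open>L^2_v\<close>\<close>

context degenerate_weight
begin

lemma lipschitz_functional_integrable:
  assumes [measurable]: "f \<in> borel_measurable M" and f: "(\<integral>\<^sup>+x. ennreal ((f x)\<^sup>2 * v x) \<partial>M) < \<infinity>"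
    and P: "C-lipschitz_on UNIV \<Phi>" "\<Phi> 0 = 0"
  shows "integrable M (\<lambda>x. \<Phi> (f x) * v x)"
proof -
  have [measurable]: "\<Phi> \<in> borel_measurable borel" using P(1) by (rule lipschitz_borel_measurable)
  have C: "0 \<le> C" by (rule lipschitz_on_nonneg[OF P(1)])
  have "(\<integral>\<^sup>+x. ennreal (\<bar>f x\<bar> * v x) \<partial>M) \<le> ennreal 1 * (\<integral>\<^sup>+x. ennreal (v x) \<partial>M) + ennreal (1 / 1) * (\<integral>\<^sup>+x. ennreal ((f x)\<^sup>2 * v x) \<partial>M)"
    using v_nonneg by (intro nn_integral_weight_L1_le) auto
  also have "\<dots> < \<infinity>" using f v_nn_finite by simp
  finally have "integrable M (\<lambda>x. \<bar>f x\<bar> * v x)" using v_nonneg by (intro integrableI_nonneg) (auto intro!: AE_I2)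
  then have "integrable M (\<lambda>x. C * (\<bar>f x\<bar> * v x))" by simp
  then show ?thesis
  proof (rule Bochner_Integration.integrable_bound)
    show "AE x in M. norm (\<Phi> (f x) * v x) \<le> norm (C * (\<bar>f x\<bar> * v x))"
    proof (rule AE_I2)
      fix x assume "x \<in> space M"
      then have "0 \<le> v x" using v_nonneg by simp
      moreover have "\<bar>\<Phi> (f x)\<bar> \<le> C * \<bar>f x\<bar>" using lipschitz_onD[OF P(1), of "f x" 0] P(2) by (simp add: dist_real_def)
      ultimately show "norm (\<Phi> (f x) * v x) \<le> norm (C * (\<bar>f x\<bar> * v x))"
        using C by (simp add: abs_mult mult_right_mono flip: mult.assoc)
    qed
  qed measurable
qed

lemma lipschitz_functional_continuous:
  assumes [measurable]: "f \<in> borel_measurable M" and f: "(\<integral>\<^sup>+x. ennreal ((f x)\<^sup>2 * v x) \<partial>M) < \<infinity>"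
    and g: "\<forall>\<^sub>F s in A. g s \<in> borel_measurable M \<and> (\<integral>\<^sup>+x. ennreal ((g s x)\<^sup>2 * v x) \<partial>M) < \<infinity>"
    and P: "C-lipschitz_on UNIV \<Phi>" "\<Phi> 0 = 0"
    and lim: "((\<lambda>s. \<integral>\<^sup>+x. ennreal ((g s x - f x)\<^sup>2 * v x) \<partial>M) \<longlongrightarrow> 0) A"
  shows "((\<lambda>s. \<integral>x. \<Phi> (g s x) * v x \<partial>M) \<longlongrightarrow> (\<integral>x. \<Phi> (f x) * v x \<partial>M)) A"
proof -
  have C: "0 \<le> C" by (rule lipschitz_on_nonneg[OF P(1)])
  have "((\<lambda>s. ennreal \<bar>(\<integral>x. \<Phi> (g s x) * v x \<partial>M) - (\<integral>x. \<Phi> (f x) * v x \<partial>M)\<bar>) \<longlongrightarrow> 0) A"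
  proof (rule tendsto_0_if_ennreal_le)
    fix e :: real assume e: "0 < e"
    have "ennreal C * (\<integral>\<^sup>+x. ennreal (v x) \<partial>M) < \<infinity>" using v_nn_finite by (simp add: ennreal_mult_less_top)
    \<comment> \<open>\<open>k\<close> controls the contribution of the total mass of
      \<open>v\<close>; once it is fixed, the remaining term with factor \<open>C / k\<close> tends
      to 0 along the filter.\<close>
    then obtain k where k: "0 < k" "ennreal k * (ennreal C * (\<integral>\<^sup>+x. ennreal (v x) \<partial>M)) \<le> ennreal (e / 2)"
      using ennreal_mult_le_small[of _ "e / 2"] e by auto
    have "((\<lambda>s. ennreal (C / k) * (\<integral>\<^sup>+x. ennreal ((g s x - f x)\<^sup>2 * v x) \<partial>M)) \<longlongrightarrow> ennreal (C / k) * 0) A"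
      by (intro ennreal_tendsto_cmult lim) auto
    then have "\<forall>\<^sub>F s in A. ennreal (C / k) * (\<integral>\<^sup>+x. ennreal ((g s x - f x)\<^sup>2 * v x) \<partial>M) < ennreal (e / 2)"
      using e by (intro order_tendstoD) auto
    then show "\<forall>\<^sub>F s in A. ennreal \<bar>(\<integral>x. \<Phi> (g s x) * v x \<partial>M) - (\<integral>x. \<Phi> (f x) * v x \<partial>M)\<bar> \<le> ennreal e"
      using g
    proof eventually_elim
      case (elim s)
      then have [measurable]: "g s \<in> borel_measurable M" by blast
      have [measurable]: "\<Phi> \<in> borel_measurable borel" using P(1) by (rule lipschitz_borel_measurable)
      have i: "integrable M (\<lambda>x. \<Phi> (g s x) * v x)" "integrable M (\<lambda>x. \<Phi> (f x) * v x)"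
        using elim f P by (intro lipschitz_functional_integrable; simp)+
      have "ennreal \<bar>(\<integral>x. \<Phi> (g s x) * v x \<partial>M) - (\<integral>x. \<Phi> (f x) * v x \<partial>M)\<bar> = ennreal (norm (\<integral>x. \<Phi> (g s x) * v x - \<Phi> (f x) * v x \<partial>M))"
        using i by simp
      also have "\<dots> \<le> (\<integral>\<^sup>+x. ennreal (norm (\<Phi> (g s x) * v x - \<Phi> (f x) * v x)) \<partial>M)"
        using i by (intro integral_norm_bound_ennreal) auto
      also have "\<dots> \<le> (\<integral>\<^sup>+x. ennreal C * ennreal (\<bar>g s x - f x\<bar> * v x) \<partial>M)"
      proof (rule nn_integral_mono)
        fix x assume "x \<in> space M"
        then have v0: "0 \<le> v x" using v_nonneg by simp
        have "\<bar>\<Phi> (g s x) - \<Phi> (f x)\<bar> \<le> C * \<bar>g s x - f x\<bar>"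
          using lipschitz_onD[OF P(1), of "g s x" "f x"] by (simp add: dist_real_def)
        then have "\<bar>\<Phi> (g s x) - \<Phi> (f x)\<bar> * v x \<le> C * \<bar>g s x - f x\<bar> * v x" using v0 by (rule mult_right_mono)
        then show "ennreal (norm (\<Phi> (g s x) * v x - \<Phi> (f x) * v x)) \<le> ennreal C * ennreal (\<bar>g s x - f x\<bar> * v x)"
          using C v0 by (simp add: abs_mult ennreal_leI mult.assoc flip: left_diff_distrib ennreal_mult)
      qed
      also have "\<dots> = ennreal C * (\<integral>\<^sup>+x. ennreal (\<bar>g s x - f x\<bar> * v x) \<partial>M)" by (rule nn_integral_cmult) measurable
      also have "\<dots> \<le> ennreal C * (ennreal k * (\<integral>\<^sup>+x. ennreal (v x) \<partial>M) + ennreal (1 / k) * (\<integral>\<^sup>+x. ennreal ((g s x - f x)\<^sup>2 * v x) \<partial>M))"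
        using v_nonneg k by (intro mult_left_mono nn_integral_weight_L1_le) auto
      also have "\<dots> = ennreal k * (ennreal C * (\<integral>\<^sup>+x. ennreal (v x) \<partial>M)) + ennreal (C / k) * (\<integral>\<^sup>+x. ennreal ((g s x - f x)\<^sup>2 * v x) \<partial>M)"
      proof -
        have "ennreal (C / k) = ennreal C * ennreal (1 / k)" using ennreal_mult[of C "1 / k"] C k by simp
        then show ?thesis by (simp only: distrib_left mult.assoc mult.left_commute mult.commute)
      qed
      also have "\<dots> \<le> ennreal (e / 2) + ennreal (e / 2)" using k(2) elim(1) by (intro add_mono) auto
      also have "\<dots> = ennreal e" using e by (simp flip: ennreal_plus)
      finally show ?case .
    qed
  qed
  then have "((\<lambda>s. \<bar>(\<integral>x. \<Phi> (g s x) * v x \<partial>M) - (\<integral>x. \<Phi> (f x) * v x \<partial>M)\<bar>) \<longlongrightarrow> 0) A"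
    by (intro tendsto_ennrealD) auto
  then show ?thesis by (simp add: tendsto_rabs_zero_iff LIM_zero_iff)
qed

end

section \<open>Increments of the solution tested with functions of the solution\<close>

context weak_flow_borel
begin

text \<open>The identity is known for the Lipschitz functions \<open>F (\<phi> k x)\<close>. On the
  left, boundedness of \<open>F\<close> gives a majorant; on the right,
  \<open>flux_pair_bound\<close> is used with its parameter chosen first, so that energy convergence
  of the gradients finishes the estimate. \<open>U\<close> is a fixed function, later the solution
  at the later time.\<close>

lemma weak_increment_H0:
  assumes Ug: "(U, g) \<in> H0 \<Omega> Q v p" and F: "C1b F F'" and Fb: "\<And>x. \<bar>F x\<bar> \<le> C"
    and [measurable]: "w \<in> borel_measurable borel" and w: "AE x in lborel. x \<in> \<Omega> \<longrightarrow> w x = F' (U x) *\<^sub>R g x"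
    and st: "0 < s" "s < t"
  shows "energyh w < \<infinity>"
    and "(\<integral>x. (u t x - u s x) * F (U x) * v x \<partial>M) = - (\<integral>z. indicator {s<..t} (fst z) * (flux z \<bullet> w (snd z)) \<partial>lborel)"
proof -
  note Ugm[measurable] = H0_D(1,2)[OF Ug]
  have Fm[measurable]: "F \<in> borel_measurable borel" "F' \<in> borel_measurable borel" using C1b_measurable[OF F] by blast+
  obtain B where B: "0 \<le> B" "\<And>x. \<bar>F' x\<bar> \<le> B" using C1b_lipschitz[OF F] by blast
  obtain \<phi> where l: "\<And>k. lipc \<Omega> (\<phi> k)" and ae: "AE x in M. (\<lambda>k. \<phi> k x) \<longlonglongrightarrow> U x"
    and c: "(\<lambda>k. energy (\<lambda>x. grad (\<phi> k) x - g x)) \<longlonglongrightarrow> 0" using H0_approx[OF Ug] by blast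
  have lF: "lipc \<Omega> (\<lambda>x. F (\<phi> k x))" for k using F l by (rule lipc_compose)
  have phm[measurable]: "\<phi> k \<in> borel_measurable M" for k using lipc_meas_M l by blast
  have um[measurable]: "u t \<in> borel_measurable M" "u s \<in> borel_measurable M" using st by (auto intro!: u_meas)
  define wk where "wk k = pgrad (\<lambda>y. F (\<phi> k y))" for k
  have [measurable]: "wk k \<in> borel_measurable borel" for k
    unfolding wk_def by (intro pgrad_measurable lipc_measurable[OF lF])
  have wk: "AE x in lborel. wk k x = grad (\<lambda>y. F (\<phi> k y)) x" for k
    using lipc_AE_grad[OF lF[of k]] by (auto simp: wk_def elim: eventually_mono)
  have "energyh w = energy (\<lambda>x. F' (U x) *\<^sub>R g x)" by (rule energyh_eq[OF w])
  also have "\<dots> < \<infinity>" using B H0_D(3)[OF Ug] by (intro energy_mult_finite) measurable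
  finally show wf: "energyh w < \<infinity>" .
  have wkf: "energyh (wk k) < \<infinity>" for k unfolding wk_def by (rule energyh_pgrad_finite[OF lF])
  have "energyh (\<lambda>x. wk k x - w x) = energy (\<lambda>x. grad (\<lambda>y. F (\<phi> k y)) x - F' (U x) *\<^sub>R g x)" for k
    by (rule energyh_eq) (use wk[of k] w in eventually_elim, auto)
  then have d: "(\<lambda>k. energyh (\<lambda>x. wk k x - w x)) \<longlonglongrightarrow> 0"
    using chain_rule_convergence[OF F l ae c Ugm H0_D(3)[OF Ug]] by simp
  let ?I = "{s<..t}"
  have I: "?I \<subseteq> {0..t}" "0 < t" using st by auto
  let ?A = "\<integral>\<^sup>+z. indicator ?I (fst z) * ennreal (N z powr p) \<partial>lborel"
  have "?A \<le> (\<integral>\<^sup>+z. indicator {0..t} (fst z) * ennreal (N z powr p) \<partial>lborel)"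
    using I by (intro nn_integral_mono mult_right_mono) (auto simp: indicator_def)
  then have A: "?A < \<infinity>" using time_energy_finite[OF I(2)] by (rule le_less_trans)
  have R: "(\<lambda>k. \<integral>z. indicator ?I (fst z) * (flux z \<bullet> wk k (snd z)) \<partial>lborel) \<longlonglongrightarrow> (\<integral>z. indicator ?I (fst z) * (flux z \<bullet> w (snd z)) \<partial>lborel)"
  proof (rule tendsto_L1_int)
    show "integrable lborel (\<lambda>z. indicator ?I (fst z) * (flux z \<bullet> wk k (snd z)))" for k
      using I wkf by (intro flux_pair_integrable) auto
    show "integrable lborel (\<lambda>z. indicator ?I (fst z) * (flux z \<bullet> w (snd z)))"
      using I wf by (intro flux_pair_integrable) auto
    show "(\<lambda>k. \<integral>\<^sup>+z. norm (indicator ?I (fst z) * (flux z \<bullet> wk k (snd z)) - indicator ?I (fst z) * (flux z \<bullet> w (snd z))) \<partial>lborel) \<longlonglongrightarrow> 0"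
    proof (rule tendsto_0_if_ennreal_le)
      fix e :: real assume e: "0 < e"
      then obtain k0 where k0: "0 < k0" "ennreal k0 * ?A \<le> ennreal (e / 2)" using ennreal_mult_le_small[OF A, of "e / 2"] by auto
      have "(\<lambda>k. ennreal (k0 powr (1 - p)) * (emeasure lborel ?I * energyh (\<lambda>x. wk k x - w x))) \<longlonglongrightarrow> ennreal (k0 powr (1 - p)) * (emeasure lborel ?I * 0)"
        using st by (intro ennreal_tendsto_cmult d) auto
      then have "\<forall>\<^sub>F k in sequentially. ennreal (k0 powr (1 - p)) * (emeasure lborel ?I * energyh (\<lambda>x. wk k x - w x)) < ennreal (e / 2)"
        using e by (intro order_tendstoD) auto
      then show "\<forall>\<^sub>F k in sequentially. (\<integral>\<^sup>+z. norm (indicator ?I (fst z) * (flux z \<bullet> wk k (snd z)) - indicator ?I (fst z) * (flux z \<bullet> w (snd z))) \<partial>lborel) \<le> ennreal e"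
      proof eventually_elim
        case (elim k)
        have "(\<integral>\<^sup>+z. norm (indicator ?I (fst z) * (flux z \<bullet> wk k (snd z)) - indicator ?I (fst z) * (flux z \<bullet> w (snd z))) \<partial>lborel)
          = (\<integral>\<^sup>+z. indicator ?I (fst z) * ennreal \<bar>flux z \<bullet> (wk k (snd z) - w (snd z))\<bar> \<partial>lborel)"
          by (intro nn_integral_cong) (auto simp: indicator_def inner_diff_right)
        also have "\<dots> \<le> ennreal k0 * ?A + ennreal (k0 powr (1 - p)) * (emeasure lborel ?I * energyh (\<lambda>x. wk k x - w x))"
          by (rule flux_pair_bound) (use k0 in auto)
        also have "\<dots> \<le> ennreal (e / 2) + ennreal (e / 2)" using k0 elim by (intro add_mono) auto
        also have "\<dots> = ennreal e" using e by (simp flip: ennreal_plus)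
        finally show ?case .
      qed
    qed
  qed
  have Lk: "(\<lambda>k. \<integral>x. (u t x - u s x) * F (\<phi> k x) * v x \<partial>M) \<longlonglongrightarrow> (\<integral>x. (u t x - u s x) * F (U x) * v x \<partial>M)"
  proof (rule integral_dominated_convergence[where w = "\<lambda>x. C * \<bar>(u t x - u s x) * v x\<bar>"])
    have "integrable M (\<lambda>x. u r x * 1 * v x)" if "0 \<le> r" for r
      by (rule L2_bounded_integrable[OF u_meas[OF that] _ u_L2[OF that], of _ 1]) auto
    from this[of t] this[of s] have "integrable M (\<lambda>x. u t x * v x - u s x * v x)" using st by auto
    then show "integrable M (\<lambda>x. C * \<bar>(u t x - u s x) * v x\<bar>)" by (simp add: left_diff_distrib)
    show "AE x in M. (\<lambda>k. (u t x - u s x) * F (\<phi> k x) * v x) \<longlonglongrightarrow> (u t x - u s x) * F (U x) * v x"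
      using ae by eventually_elim (intro tendsto_mult tendsto_const isCont_tendsto_compose[OF C1b_cont(1)[OF F]])
    show "AE x in M. norm ((u t x - u s x) * F (\<phi> k x) * v x) \<le> C * \<bar>(u t x - u s x) * v x\<bar>" for k
    proof (rule AE_I2)
      fix x
      have "\<bar>F (\<phi> k x)\<bar> * \<bar>(u t x - u s x) * v x\<bar> \<le> C * \<bar>(u t x - u s x) * v x\<bar>" using Fb by (intro mult_right_mono) auto
      then show "norm ((u t x - u s x) * F (\<phi> k x) * v x) \<le> C * \<bar>(u t x - u s x) * v x\<bar>" by (simp add: abs_mult mult_ac)
    qed
  qed measurable
  have "(\<integral>x. (u t x - u s x) * F (\<phi> k x) * v x \<partial>M) = - (\<integral>z. indicator ?I (fst z) * (flux z \<bullet> wk k (snd z)) \<partial>lborel)" for k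
    unfolding wk_def by (rule weak_increment_lipc[OF lF st])
  then have "(\<lambda>k. - (\<integral>z. indicator ?I (fst z) * (flux z \<bullet> wk k (snd z)) \<partial>lborel)) \<longlonglongrightarrow> (\<integral>x. (u t x - u s x) * F (U x) * v x \<partial>M)"
    using Lk by simp
  from LIMSEQ_unique[OF this tendsto_minus[OF R]]
  show "(\<integral>x. (u t x - u s x) * F (U x) * v x \<partial>M) = - (\<integral>z. indicator ?I (fst z) * (flux z \<bullet> w (snd z)) \<partial>lborel)" .
qed

lemma AE_flux_inner_self: "AE z in lborel. flux z \<bullet> (c z *\<^sub>R Gh z) = c z * N z powr p"
  using AE_psd0_pair
proof eventually_elim
  case (elim z)
  have "N z powr (p - 2) * (N z)\<^sup>2 = N z powr p"
  proof (cases "N z = 0")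
    case False
    then have "0 < N z" using psd0_qnorm(1)[OF elim, of "Gh z"] by (simp add: N_def)
    then have "N z powr p = N z powr (p - 2) * N z powr 2" using powr_add[of "N z" "p - 2" 2] by simp
    then show ?thesis using \<open>0 < N z\<close> by simp
  qed simp
  then show ?case by (simp add: flux_def psd0_qnorm(4)[OF elim] flip: N_def)
qed

lemma energy_increment:
  assumes F: "C1b F F'" and Fb: "\<And>x. \<bar>F x\<bar> \<le> C" and F0: "\<And>x. 0 \<le> F' x"
    and \<Phi>: "\<And>x. (\<Phi> has_real_derivative F x) (at x)" "\<Phi> 0 = 0"
  shows "AE t in lborel. \<forall>h. 0 < h \<and> h < t \<longrightarrow>
     ennreal h * (\<integral>\<^sup>+x. ennreal (F' (uh (t, x)) * N (t, x) powr p) \<partial>lborel) + ennreal (\<integral>x. \<Phi> (u t x) * v x \<partial>M) \<le>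
     (\<integral>\<^sup>+z. indicator {t-h<..t} (fst z) * ennreal \<bar>(flux z - flux (t, snd z)) \<bullet> (F' (uh (t, snd z)) *\<^sub>R Gh (t, snd z))\<bar> \<partial>lborel)
     + ennreal (\<integral>x. \<Phi> (u (t - h) x) * v x \<partial>M)"
  using AE_good AE_lborel_pairD[OF AE_flux_inner_self[of "\<lambda>z. F' (uh z)"]]
proof eventually_elim
  case (elim t)
  show ?case
  proof (intro allI impI)
    fix h :: real assume h: "0 < h \<and> h < t"
    then have t: "0 \<le> t" by simp
    have Fm[measurable]: "F \<in> borel_measurable borel" "F' \<in> borel_measurable borel" using C1b_measurable[OF F] by blast+
    have ugt: "(u t, G t) \<in> H0 \<Omega> Q v p" and ht: "AE x in lborel. x \<in> \<Omega> \<longrightarrow> Gh (t, x) = G t x \<and> uh (t, x) = u t x"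
      using elim(1) t by blast+
    define w where "w x = F' (uh (t, x)) *\<^sub>R Gh (t, x)" for x
    have [measurable]: "w \<in> borel_measurable borel" unfolding w_def[abs_def] by measurable
    have w: "AE x in lborel. x \<in> \<Omega> \<longrightarrow> w x = F' (u t x) *\<^sub>R G t x" using ht by (auto simp: w_def elim: eventually_mono)
    let ?I = "{t-h<..t}"
    note inc = weak_increment_H0[OF ugt F Fb _ w, of "t - h" t]
    have mono: "F x \<le> F y" if "x \<le> y" for x y
      using F F0 that by (intro DERIV_nonneg_imp_nondecreasing[of x y F]) (auto simp: C1b_def)
    \<comment> \<open>Convexity with the slope taken at \<open>y\<close>, the later value: this is
      why \<open>F\<close> of the solution at time \<open>t\<close>, and not at
      \<open>t - h\<close>, is the test function.\<close>
    have conv: "\<Phi> y - \<Phi> x \<le> (y - x) * F y" for x y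
    proof (cases x y rule: linorder_cases)
      case less
      then obtain c where "x < c" "c < y" "\<Phi> y - \<Phi> x = (y - x) * F c" using MVT2[of x y \<Phi> F] \<Phi>(1) by blast
      then show ?thesis using mono[of c y] less by (simp add: mult_left_mono)
    next
      case greater
      then obtain c where c: "y < c" "c < x" "\<Phi> x - \<Phi> y = (x - y) * F c" using MVT2[of y x \<Phi> F] \<Phi>(1) by blast
      then have "(x - y) * F y \<le> (x - y) * F c" using mono[of y c] greater by (intro mult_left_mono) auto
      then show ?thesis using c(3) by (simp add: algebra_simps)
    qed simp
    have Pnn: "0 \<le> \<Phi> x" for x using conv[of 0 x] F \<Phi>(2) by (simp add: C1b_def)
    have PL: "C-lipschitz_on UNIV \<Phi>"
    proof (rule lipschitz_onI)
      fix x y :: real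
      have "norm (\<Phi> x - \<Phi> y) \<le> C * norm (x - y)"
        by (rule field_differentiable_bound[of UNIV \<Phi> F]) (use Fb \<Phi>(1) in \<open>auto intro: has_field_derivative_at_within\<close>)
      then show "dist (\<Phi> x) (\<Phi> y) \<le> C * dist x y" by (simp add: dist_norm)
    qed (use Fb[of 0] in linarith)
    have Pi: "integrable M (\<lambda>x. \<Phi> (u r x) * v x)" if "0 \<le> r" for r
      by (rule lipschitz_functional_integrable[OF u_meas[OF that] u_L2[OF that] PL \<Phi>(2)])
    have um[measurable]: "u t \<in> borel_measurable M" "u (t - h) \<in> borel_measurable M" using h by (auto intro!: u_meas)
    have ui: "integrable M (\<lambda>x. u r x * F (u t x) * v x)" if "0 \<le> r" for r
      by (rule L2_bounded_integrable[OF u_meas[OF that] _ u_L2[OF that], of _ C]) (use Fb in auto)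
    have "(\<integral>x. \<Phi> (u t x) * v x \<partial>M) - (\<integral>x. \<Phi> (u (t - h) x) * v x \<partial>M) = (\<integral>x. \<Phi> (u t x) * v x - \<Phi> (u (t - h) x) * v x \<partial>M)"
      using Pi[of t] Pi[of "t - h"] h by simp
    also have "\<dots> \<le> (\<integral>x. (u t x - u (t - h) x) * F (u t x) * v x \<partial>M)"
    proof (rule integral_mono)
      show "integrable M (\<lambda>x. \<Phi> (u t x) * v x - \<Phi> (u (t - h) x) * v x)" using Pi[of t] Pi[of "t - h"] h by simp
      show "integrable M (\<lambda>x. (u t x - u (t - h) x) * F (u t x) * v x)"
        using ui[of t] ui[of "t - h"] h by (simp add: left_diff_distrib)
      fix x assume "x \<in> space M"
      then have "0 \<le> v x" using v_nonneg by simp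
      then show "\<Phi> (u t x) * v x - \<Phi> (u (t - h) x) * v x \<le> (u t x - u (t - h) x) * F (u t x) * v x"
        using conv[of "u t x" "u (t - h) x"] by (simp add: mult_right_mono flip: left_diff_distrib)
    qed
    also have "\<dots> = - (\<integral>z. indicator ?I (fst z) * (flux z \<bullet> w (snd z)) \<partial>lborel)"
      using h by (intro inc(2)) auto
    finally have E: "(\<integral>x. \<Phi> (u t x) * v x \<partial>M) - (\<integral>x. \<Phi> (u (t - h) x) * v x \<partial>M) \<le> - (\<integral>z. indicator ?I (fst z) * (flux z \<bullet> w (snd z)) \<partial>lborel)" .
    have wf: "energyh w < \<infinity>" using h by (intro inc(1)) auto
    have iI: "integrable lborel (\<lambda>z. indicator ?I (fst z) * (flux z \<bullet> w (snd z)))"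
      using h wf by (intro flux_pair_integrable[where T = t]) auto
    let ?Z = "\<integral>\<^sup>+x. ennreal (F' (uh (t, x)) * N (t, x) powr p) \<partial>lborel"
    let ?\<rho> = "\<integral>\<^sup>+z. indicator ?I (fst z) * ennreal \<bar>(flux z - flux (t, snd z)) \<bullet> (F' (uh (t, snd z)) *\<^sub>R Gh (t, snd z))\<bar> \<partial>lborel"
    obtain B where B: "0 \<le> B" "\<And>x. \<bar>F' x\<bar> \<le> B" using C1b_lipschitz[OF F] by blast
    have "?Z \<le> (\<integral>\<^sup>+x. ennreal B * ennreal (qnorm (Qh x) (Gh (t, x)) powr p) \<partial>lborel)"
      using B by (intro nn_integral_mono) (auto simp: N_def abs_le_iff intro!: ennreal_leI mult_right_mono simp flip: ennreal_mult)
    also have "\<dots> = ennreal B * energyh (\<lambda>x. Gh (t, x))" unfolding energyh_def by (rule nn_integral_cmult) measurable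
    also have "energyh (\<lambda>x. Gh (t, x)) = energy (G t)" using ht by (intro energyh_eq) (auto elim: eventually_mono)
    also have "ennreal B * energy (G t) < \<infinity>" using H0_D(3)[OF ugt] by (simp add: ennreal_mult_less_top)
    finally have Zf: "?Z < \<infinity>" .
    let ?j = "\<lambda>z. indicator ?I (fst z) * (F' (uh (t, snd z)) * N (t, snd z) powr p)"
    have "(\<integral>\<^sup>+z. ennreal (?j z) \<partial>lborel) = (\<integral>\<^sup>+z. indicator ?I (fst z) * ennreal (F' (uh (t, snd z)) * N (t, snd z) powr p) \<partial>lborel)"
      by (intro nn_integral_cong) (auto simp: indicator_def)
    also have "\<dots> = (\<integral>\<^sup>+\<tau>. (\<integral>\<^sup>+x. indicator ?I \<tau> * ennreal (F' (uh (t, x)) * N (t, x) powr p) \<partial>lborel) \<partial>lborel)"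
      by (subst nn_integral_lborel_pair) simp_all
    also have "\<dots> = (\<integral>\<^sup>+\<tau>. indicator ?I \<tau> * ?Z \<partial>lborel)" by (intro nn_integral_cong nn_integral_cmult) measurable
    also have "\<dots> = ennreal h * ?Z" using h by (subst nn_integral_multc) auto
    finally have jnn: "(\<integral>\<^sup>+z. ennreal (?j z) \<partial>lborel) = ennreal h * ?Z" .
    have ij: "integrable lborel ?j"
      by (rule integrableI_nonneg) (use jnn Zf F0 in \<open>auto simp: ennreal_mult_less_top\<close>)
    have "(\<integral>z. ?j z \<partial>lborel) = enn2real (ennreal h * ?Z)"
      using F0 jnn by (subst integral_eq_nn_integral) auto
    then have jval: "ennreal (\<integral>z. ?j z \<partial>lborel) = ennreal h * ?Z"
      using Zf by (simp add: ennreal_mult_less_top)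
    have ae: "AE z in lborel. ?j z = indicator ?I (fst z) * (flux (t, snd z) \<bullet> w (snd z))"
      using AE_lborel_snd[OF elim(2), where 'a = real] by eventually_elim (auto simp: w_def indicator_def)
    show "ennreal h * ?Z + ennreal (\<integral>x. \<Phi> (u t x) * v x \<partial>M) \<le> ?\<rho> + ennreal (\<integral>x. \<Phi> (u (t - h) x) * v x \<partial>M)"
    proof -
      have En: "0 \<le> (\<integral>x. \<Phi> (u r x) * v x \<partial>M)" for r
        using Pnn v_nonneg by (intro integral_nonneg_AE AE_I2) auto
      let ?j' = "\<lambda>z. indicator ?I (fst z) * (flux (t, snd z) \<bullet> w (snd z))"
      have ij': "integrable lborel ?j'" and jj': "(\<integral>z. ?j z \<partial>lborel) = (\<integral>z. ?j' z \<partial>lborel)"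
        using ij ae by (auto intro!: integral_cong_AE elim: integrable_cong_AE_imp)
      have "ennreal ((\<integral>z. ?j z \<partial>lborel) - (\<integral>z. indicator ?I (fst z) * (flux z \<bullet> w (snd z)) \<partial>lborel)) \<le>
        ennreal (norm (\<integral>z. ?j' z - indicator ?I (fst z) * (flux z \<bullet> w (snd z)) \<partial>lborel))"
        unfolding jj' using iI ij' by (intro ennreal_leI) simp
      also have "\<dots> \<le> (\<integral>\<^sup>+z. ennreal (norm (?j' z - indicator ?I (fst z) * (flux z \<bullet> w (snd z)))) \<partial>lborel)"
        using iI ij' by (intro integral_norm_bound_ennreal) auto
      also have "\<dots> = ?\<rho>"
        by (intro nn_integral_cong) (auto simp: indicator_def w_def inner_diff_left right_diff_distrib abs_minus_commute)
      finally have \<rho>: "ennreal ((\<integral>z. ?j z \<partial>lborel) - (\<integral>z. indicator ?I (fst z) * (flux z \<bullet> w (snd z)) \<partial>lborel)) \<le> ?\<rho>" .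
      have jn: "0 \<le> (\<integral>z. ?j z \<partial>lborel)" using F0 by (intro integral_nonneg_AE AE_I2) auto
      have "ennreal h * ?Z + ennreal (\<integral>x. \<Phi> (u t x) * v x \<partial>M) = ennreal ((\<integral>z. ?j z \<partial>lborel) + (\<integral>x. \<Phi> (u t x) * v x \<partial>M))"
        unfolding jval[symmetric] using jn En by (simp add: ennreal_plus)
      \<comment> \<open>The difference of the two integrals may be negative, where
        \<open>ennreal\<close> returns 0; \<open>max 0\<close> makes this explicit before sums are
        split.\<close>
      also have "\<dots> \<le> ennreal (max 0 ((\<integral>z. ?j z \<partial>lborel) - (\<integral>z. indicator ?I (fst z) * (flux z \<bullet> w (snd z)) \<partial>lborel)) + (\<integral>x. \<Phi> (u (t - h) x) * v x \<partial>M))"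
        using E by (intro ennreal_leI) linarith
      also have "\<dots> = ennreal ((\<integral>z. ?j z \<partial>lborel) - (\<integral>z. indicator ?I (fst z) * (flux z \<bullet> w (snd z)) \<partial>lborel)) + ennreal (\<integral>x. \<Phi> (u (t - h) x) * v x \<partial>M)"
        using En by (subst ennreal_plus) (auto simp: max_def ennreal_neg)
      also have "\<dots> \<le> ?\<rho> + ennreal (\<integral>x. \<Phi> (u (t - h) x) * v x \<partial>M)" using \<rho> by (rule add_right_mono)
      finally show ?thesis .
    qed
  qed
qed

end

section \<open>The energy inequality\<close>

context weak_flow_borel
begin

lemma energyh_const_finite: "energyh (\<lambda>_. c) < \<infinity>"
proof -
  have "energyh (\<lambda>_. c) = energy (\<lambda>_. c)" by (rule energyh_eq) simp
  also have "\<dots> \<le> (\<integral>\<^sup>+x. ennreal (norm c powr p) * ennreal (v x) \<partial>M)"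
    unfolding energy_def
  proof (rule nn_integral_mono_AE)
    show "AE x in M. ennreal (qnorm (Q x) c powr p) \<le> ennreal (norm c powr p) * ennreal (v x)"
      using AE_qnorm_le AE_v_pos by eventually_elim (auto simp: mult.commute ennreal_leI simp flip: ennreal_mult)
  qed
  also have "\<dots> = ennreal (norm c powr p) * (\<integral>\<^sup>+x. ennreal (v x) \<partial>M)" by (rule nn_integral_cmult) measurable
  also have "\<dots> < \<infinity>" using v_nn_finite by (simp add: ennreal_mult_less_top)
  finally show ?thesis .
qed

text \<open>Each component is the pairing with a basis vector, a constant field, which has finite
  energy because (H) bounds it by the integrable \<open>v\<close>. Integrability gives access to
  continuity of translations in \<open>L^1\<close>.\<close>

lemma flux_integrable:
  assumes T: "0 < T"
  shows "integrable lborel (\<lambda>z. indicator {0..T} (fst z) *\<^sub>R flux z)"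
proof -
  have "integrable lborel (\<lambda>z. \<Sum>i\<in>Basis. (indicator {0..T} (fst z) * (flux z \<bullet> i)) *\<^sub>R i)"
    using T energyh_const_finite
    by (intro Bochner_Integration.integrable_sum integrable_scaleR_left flux_pair_integrable[where w = "\<lambda>_. _" and T = T]) auto
  also have "(\<lambda>z. \<Sum>i\<in>Basis. (indicator {0..T} (fst z) * (flux z \<bullet> i)) *\<^sub>R i) = (\<lambda>z. indicator {0..T} (fst z) *\<^sub>R flux z)"
  proof
    fix z :: "real \<times> (real^'n)"
    have "(\<Sum>i\<in>Basis. (indicator {0..T} (fst z) * (flux z \<bullet> i)) *\<^sub>R i) = indicator {0..T} (fst z) *\<^sub>R (\<Sum>i\<in>Basis. (flux z \<bullet> i) *\<^sub>R i)"
      by (simp add: scaleR_sum_right)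
    then show "(\<Sum>i\<in>Basis. (indicator {0..T} (fst z) * (flux z \<bullet> i)) *\<^sub>R i) = indicator {0..T} (fst z) *\<^sub>R flux z"
      by (simp add: euclidean_representation)
  qed
  finally show ?thesis .
qed

text \<open>A modulus of continuity in time for the flux, measured against the field with which it
  is paired; only the flux is shifted back, \<open>bb\<close> stays at the later time.\<close>

definition osc where
  "osc bb a b r = (\<integral>\<^sup>+z. indicator {a..b} (fst z) * ennreal \<bar>(flux (fst z - r, snd z) - flux z) \<bullet> bb z\<bar> \<partial>lborel)"

text \<open>The weighted length of \<open>bb\<close> is dominated by \<open>B * N z\<close>, whose
  \<open>p\<close>-th power is integrable on \<open>{0..b}\<close>, and at each point the part above
  level \<open>n\<close> is eventually 0, so dominated convergence applies.\<close>

lemma truncation_tail: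
  assumes [measurable]: "bb \<in> borel_measurable borel"
    and bb: "AE z in lborel. qnorm (Qh (snd z)) (bb z) \<le> B * N z" and B: "0 \<le> B" and b: "0 < b"
  shows "(\<lambda>n. \<integral>\<^sup>+z. indicator {0..b} (fst z) * ennreal (qnorm (Qh (snd z)) (if norm (bb z) \<le> real n then 0 else bb z) powr p) \<partial>lborel) \<longlonglongrightarrow> 0"
proof -
  let ?f = "\<lambda>n z. indicator {0..b} (fst z) * ennreal (qnorm (Qh (snd z)) (if norm (bb z) \<le> real n then 0 else bb z) powr p)"
  have "(\<lambda>n. \<integral>\<^sup>+z. ?f n z \<partial>lborel) \<longlonglongrightarrow> (\<integral>\<^sup>+z. 0 \<partial>(lborel :: (real \<times> (real^'n)) measure))"
  proof (rule nn_integral_dominated_convergence[where w = "\<lambda>z. ennreal (B powr p) * (indicator {0..b} (fst z) * ennreal (N z powr p))"])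
    have "(\<integral>\<^sup>+z. ennreal (B powr p) * (indicator {0..b} (fst z) * ennreal (N z powr p)) \<partial>lborel) =
       ennreal (B powr p) * (\<integral>\<^sup>+z. indicator {0..b} (fst z) * ennreal (N z powr p) \<partial>lborel)" by (rule nn_integral_cmult) measurable
    then show "(\<integral>\<^sup>+z. ennreal (B powr p) * (indicator {0..b} (fst z) * ennreal (N z powr p)) \<partial>lborel) < \<infinity>"
      using time_energy_finite[OF b] by (simp add: ennreal_mult_less_top)
    show "AE z in lborel. ?f n z \<le> ennreal (B powr p) * (indicator {0..b} (fst z) * ennreal (N z powr p))" for n
      using bb AE_psd0_pair
    proof eventually_elim
      case (elim z)
      have N0: "0 \<le> N z" using psd0_qnorm(1)[OF elim(2)] by (simp add: N_def)
      have "qnorm (Qh (snd z)) (if norm (bb z) \<le> real n then 0 else bb z) powr p \<le> (B * N z) powr p"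
        using elim p B N0 psd0_qnorm(1)[OF elim(2)] by (intro powr_mono2) auto
      also have "\<dots> = B powr p * N z powr p" using B N0 by (simp add: powr_mult)
      finally show ?case by (auto simp: indicator_def ennreal_leI simp flip: ennreal_mult)
    qed
    show "AE z in lborel. (\<lambda>n. ?f n z) \<longlonglongrightarrow> 0"
    proof (rule AE_I2)
      fix z :: "real \<times> (real^'n)"
      obtain n0 :: nat where "norm (bb z) \<le> real n0" using real_arch_simple by blast
      then have "?f n z = 0" if "n0 \<le> n" for n using that by auto
      then show "(\<lambda>n. ?f n z) \<longlonglongrightarrow> 0"
        by (intro tendsto_eventually) (unfold eventually_sequentially, blast)
    qed
  qed measurable
  then show ?thesis by simp
qed

text \<open>\<open>bb\<close> is split into a bounded part, for which translations of the flux are small in \<open>L\<^sup>1\<close>, and a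
  part that is small in the energy, for which Young's inequality is used.\<close>

lemma osc_small:
  assumes [measurable]: "bb \<in> borel_measurable borel"
    and bb: "AE z in lborel. qnorm (Qh (snd z)) (bb z) \<le> B * N z" and B: "0 \<le> B" and ab: "0 < a" "a < b" and e: "0 < (e::real)"
  shows "\<exists>h>0. \<forall>r. 0 \<le> r \<and> r < h \<longrightarrow> osc bb a b r \<le> ennreal e"
proof -
  let ?A = "\<integral>\<^sup>+z. indicator {0..b} (fst z) * ennreal (N z powr p) \<partial>lborel"
  have b0: "0 < b" using ab by simp
  have A: "?A < \<infinity>" by (rule time_energy_finite[OF b0])
  have A2: "?A + ?A < \<infinity>" using A by simp
  obtain d where d: "0 < d" "ennreal d * (?A + ?A) \<le> ennreal (e / 3)" using ennreal_mult_le_small[OF A2, of "e/3"] e by auto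
  define c where "c n z = (if norm (bb z) \<le> real n then 0 else bb z)" for n z
  have [measurable]: "c n \<in> borel_measurable borel" for n unfolding c_def[abs_def] by measurable
  let ?tail = "\<lambda>n. \<integral>\<^sup>+z. indicator {0..b} (fst z) * ennreal (qnorm (Qh (snd z)) (c n z) powr p) \<partial>lborel"
  \<comment> \<open>The factor 2 counts two uses of Young's inequality, for the shifted and for the
    unshifted flux.\<close>
  let ?k = "2 * d powr (1 - p)"
  have "?tail \<longlonglongrightarrow> 0" unfolding c_def by (rule truncation_tail[OF _ bb B b0]) measurable
  then have "(\<lambda>n. ennreal ?k * ?tail n) \<longlonglongrightarrow> ennreal ?k * 0" by (intro ennreal_tendsto_cmult) auto
  then have "\<forall>\<^sub>F n in sequentially. ennreal ?k * ?tail n < ennreal (e / 3)" using e by (intro order_tendstoD) auto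
  then obtain n where n: "ennreal ?k * ?tail n < ennreal (e / 3)" by (auto simp: eventually_sequentially)
  \<comment> \<open>The cut-off in time makes the flux integrable. For \<open>r < a\<close> a time
    in \<open>{a..b}\<close> and its shift both lie in \<open>{0..b}\<close>, so the cut-off is not
    seen.\<close>
  define fl where "fl z = indicator {0..b} (fst z) *\<^sub>R flux z" for z
  have [measurable]: "fl \<in> borel_measurable borel" unfolding fl_def[abs_def] by measurable
  have "integrable lborel fl" unfolding fl_def[abs_def] by (rule flux_integrable[OF b0])
  moreover have "0 < e / (3 * (real n + 1))" using e by simp
  ultimately obtain h1 where h1: "0 < h1" "\<And>y. norm y < h1 \<Longrightarrow> (\<integral>\<^sup>+z. ennreal (norm (fl (z + y) - fl z)) \<partial>lborel) \<le> ennreal (e / (3 * (real n + 1)))"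
    using L1_translation_continuous by blast
  have "osc bb a b r \<le> ennreal e" if r: "0 \<le> r" "r < min h1 a" for r
  proof -
    define y :: "real \<times> (real^'n)" where "y = (- r, 0)"
    have ny: "norm y < h1" using r by (simp add: y_def)
    let ?n1 = "\<lambda>z. indicator {0..b} (fst z) * ennreal (N z powr p)"
    let ?B = "\<lambda>z. ennreal (real n) * ennreal (norm (fl (z + y) - fl z)) +
       (ennreal d * (?n1 (z + y) + ?n1 z) + ennreal ?k * (indicator {0..b} (fst z) * ennreal (qnorm (Qh (snd z)) (c n z) powr p)))"
    have "osc bb a b r \<le> (\<integral>\<^sup>+z. ?B z \<partial>lborel)"
      unfolding osc_def
    proof (rule nn_integral_mono_AE)
      show "AE z in lborel. indicator {a..b} (fst z) * ennreal \<bar>(flux (fst z - r, snd z) - flux z) \<bullet> bb z\<bar> \<le> ?B z"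
        using AE_psd0_pair
      proof eventually_elim
        case (elim z)
        show ?case
        proof (cases "fst z \<in> {a..b}")
          case True
          then have in1: "fst z \<in> {0..b}" "fst (z + y) \<in> {0..b}" using ab r by (auto simp: y_def)
          have zy: "z + y = (fst z - r, snd z)" by (simp add: y_def prod_eq_iff)
          let ?q = "qnorm (Qh (snd z)) (c n z)"
          have fb: "\<bar>flux w \<bullet> c n z\<bar> \<le> d * N w powr p + d powr (1 - p) * ?q powr p" if "snd w = snd z" for w
          proof -
            have "\<bar>flux w \<bullet> c n z\<bar> \<le> N w powr (p - 1) * ?q"
              unfolding flux_def N_def that using flux_inner_bound[OF elim p(1)] .
            also have "\<dots> \<le> d * N w powr p + d powr (1 - p) * ?q powr p"
              using psd0_qnorm(1)[OF elim] d p that by (intro young_powr) (auto simp: N_def)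
            finally show ?thesis .
          qed
          have "bb z - c n z = (if norm (bb z) \<le> real n then bb z else 0)" by (simp add: c_def)
          then have nb: "norm (bb z - c n z) \<le> real n" by simp
          have "\<bar>(flux (z + y) - flux z) \<bullet> bb z\<bar> = \<bar>(fl (z + y) - fl z) \<bullet> (bb z - c n z) + flux (z + y) \<bullet> c n z - flux z \<bullet> c n z\<bar>"
            using in1 by (simp add: fl_def inner_diff_left inner_diff_right)
          also have "\<dots> \<le> \<bar>(fl (z + y) - fl z) \<bullet> (bb z - c n z)\<bar> + \<bar>flux (z + y) \<bullet> c n z\<bar> + \<bar>flux z \<bullet> c n z\<bar>" by linarith
          also have "\<bar>(fl (z + y) - fl z) \<bullet> (bb z - c n z)\<bar> \<le> norm (fl (z + y) - fl z) * norm (bb z - c n z)" by (rule Cauchy_Schwarz_ineq2)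
          also have "\<dots> \<le> norm (fl (z + y) - fl z) * real n" using nb by (rule mult_left_mono) simp
          finally have "\<bar>(flux (z + y) - flux z) \<bullet> bb z\<bar> \<le> real n * norm (fl (z + y) - fl z) +
              (d * (N (z + y) powr p + N z powr p) + ?k * ?q powr p)"
            using fb[of "z + y"] fb[of z] by (simp add: y_def algebra_simps)
          then have "ennreal \<bar>(flux (z + y) - flux z) \<bullet> bb z\<bar> \<le> ennreal (real n * norm (fl (z + y) - fl z) +
              (d * (N (z + y) powr p + N z powr p) + ?k * ?q powr p))" by (rule ennreal_leI)
          also have "\<dots> = ennreal (real n) * ennreal (norm (fl (z + y) - fl z)) +
              (ennreal d * (ennreal (N (z + y) powr p) + ennreal (N z powr p)) + ennreal ?k * ennreal (?q powr p))"
            using d(1) by (simp add: ennreal_mult ennreal_plus)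
          finally show ?thesis using True in1 by (simp add: zy)
        qed simp
      qed
    qed
    also have "\<dots> = ennreal (real n) * (\<integral>\<^sup>+z. ennreal (norm (fl (z + y) - fl z)) \<partial>lborel) +
       (ennreal d * ((\<integral>\<^sup>+z. ?n1 (z + y) \<partial>lborel) + ?A) + ennreal ?k * ?tail n)"
      by (simp add: nn_integral_add nn_integral_cmult)
    also have "(\<integral>\<^sup>+z. ?n1 (z + y) \<partial>lborel) = ?A" by (rule nn_integral_lborel_shift) measurable
    also have "ennreal (real n) * (\<integral>\<^sup>+z. ennreal (norm (fl (z + y) - fl z)) \<partial>lborel) \<le> ennreal (real n) * ennreal (e / (3 * (real n + 1)))"
      using h1(2)[OF ny] by (intro mult_left_mono) auto
    also have "\<dots> = ennreal (real n * (e / (3 * (real n + 1))))" using e by (intro ennreal_mult[symmetric]) auto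
    also have "\<dots> \<le> ennreal (e / 3)" using e by (intro ennreal_leI) (simp add: field_simps)
    finally have "osc bb a b r \<le> ennreal (e / 3) + (ennreal d * (?A + ?A) + ennreal ?k * ?tail n)" by (simp add: add_right_mono)
    also have "\<dots> \<le> ennreal (e / 3) + (ennreal (e / 3) + ennreal (e / 3))" using d n by (intro add_mono) auto
    also have "\<dots> = ennreal e" using e by (simp flip: ennreal_plus)
    finally show ?thesis .
  qed
  then show ?thesis using h1(1) ab by (intro exI[of _ "min h1 a"]) auto
qed

text \<open>The earlier time is written as \<open>t - r\<close> and the integrals are exchanged.
  Integrated over \<open>t\<close>, the error of \<open>energy_increment\<close> becomes an integral
  of \<open>osc\<close> over shifts below \<open>h\<close>, which \<open>osc_small\<close> makes of
  smaller order than \<open>h\<close>.\<close>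

lemma fluctuation_eq:
  assumes [measurable]: "bb \<in> borel_measurable borel"
  shows "(\<integral>\<^sup>+t. indicator {a..b} t * (\<integral>\<^sup>+z. indicator {t-h<..t} (fst z) * ennreal \<bar>(flux z - flux (t, snd z)) \<bullet> bb (t, snd z)\<bar> \<partial>lborel) \<partial>lborel)
    = (\<integral>\<^sup>+r. indicator {0..<h} r * osc bb a b r \<partial>lborel)"
proof -
  let ?g = "\<lambda>t \<tau> x. ennreal \<bar>(flux (\<tau>, x) - flux (t, x)) \<bullet> bb (t, x)\<bar>"
  have "(\<integral>\<^sup>+z. indicator {t-h<..t} (fst z) * ennreal \<bar>(flux z - flux (t, snd z)) \<bullet> bb (t, snd z)\<bar> \<partial>lborel)
     = (\<integral>\<^sup>+r. indicator {0..<h} r * (\<integral>\<^sup>+x. ?g t (t - r) x \<partial>lborel) \<partial>lborel)" for t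
  proof -
    have "(\<integral>\<^sup>+z. indicator {t-h<..t} (fst z) * ennreal \<bar>(flux z - flux (t, snd z)) \<bullet> bb (t, snd z)\<bar> \<partial>lborel)
       = (\<integral>\<^sup>+\<tau>. (\<integral>\<^sup>+x. indicator {t-h<..t} \<tau> * ?g t \<tau> x \<partial>lborel) \<partial>lborel)"
      by (subst nn_integral_lborel_pair) simp_all
    also have "\<dots> = (\<integral>\<^sup>+\<tau>. indicator {t-h<..t} \<tau> * (\<integral>\<^sup>+x. ?g t \<tau> x \<partial>lborel) \<partial>lborel)"
      by (intro nn_integral_cong nn_integral_cmult) measurable
    also have "\<dots> = ennreal \<bar>-1\<bar> * (\<integral>\<^sup>+r. indicator {t-h<..t} (t + -1 * r) * (\<integral>\<^sup>+x. ?g t (t + -1 * r) x \<partial>lborel) \<partial>lborel)"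
      by (rule nn_integral_real_affine) simp_all
    also have "\<dots> = (\<integral>\<^sup>+r. indicator {0..<h} r * (\<integral>\<^sup>+x. ?g t (t - r) x \<partial>lborel) \<partial>lborel)"
      by (simp, intro nn_integral_cong) (auto simp: indicator_def)
    finally show ?thesis .
  qed
  then have "(\<integral>\<^sup>+t. indicator {a..b} t * (\<integral>\<^sup>+z. indicator {t-h<..t} (fst z) * ennreal \<bar>(flux z - flux (t, snd z)) \<bullet> bb (t, snd z)\<bar> \<partial>lborel) \<partial>lborel)
    = (\<integral>\<^sup>+t. (\<integral>\<^sup>+r. indicator {a..b} t * (indicator {0..<h} r * (\<integral>\<^sup>+x. ?g t (t - r) x \<partial>lborel)) \<partial>lborel) \<partial>lborel)"
    by (simp add: nn_integral_cmult)
  also have "\<dots> = (\<integral>\<^sup>+r. (\<integral>\<^sup>+t. indicator {a..b} t * (indicator {0..<h} r * (\<integral>\<^sup>+x. ?g t (t - r) x \<partial>lborel)) \<partial>lborel) \<partial>lborel)"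
    by (rule lborel_pair.Fubini'[symmetric]) measurable
  also have "\<dots> = (\<integral>\<^sup>+r. indicator {0..<h} r * osc bb a b r \<partial>lborel)"
  proof (rule nn_integral_cong)
    fix r :: real
    have "(\<integral>\<^sup>+t. indicator {a..b} t * (indicator {0..<h} r * (\<integral>\<^sup>+x. ?g t (t - r) x \<partial>lborel)) \<partial>lborel)
      = (\<integral>\<^sup>+t. indicator {0..<h} r * (\<integral>\<^sup>+x. indicator {a..b} t * ?g t (t - r) x \<partial>lborel) \<partial>lborel)"
      by (intro nn_integral_cong) (simp add: nn_integral_cmult mult.left_commute)
    also have "\<dots> = indicator {0..<h} r * (\<integral>\<^sup>+t. (\<integral>\<^sup>+x. indicator {a..b} t * ?g t (t - r) x \<partial>lborel) \<partial>lborel)"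
      by (rule nn_integral_cmult) measurable
    also have "(\<integral>\<^sup>+t. (\<integral>\<^sup>+x. indicator {a..b} t * ?g t (t - r) x \<partial>lborel) \<partial>lborel) = osc bb a b r"
      unfolding osc_def by (subst nn_integral_lborel_pair) simp_all
    finally show "(\<integral>\<^sup>+t. indicator {a..b} t * (indicator {0..<h} r * (\<integral>\<^sup>+x. ?g t (t - r) x \<partial>lborel)) \<partial>lborel) = indicator {0..<h} r * osc bb a b r" .
  qed
  finally show ?thesis .
qed

lemma functional_isCont:
  assumes "C-lipschitz_on UNIV \<Phi>" "\<Phi> 0 = 0" "0 < t"
  shows "isCont (\<lambda>t. \<integral>x. \<Phi> (u t x) * v x \<partial>M) t"
  unfolding isCont_def
proof (rule lipschitz_functional_continuous[OF _ _ _ assms(1,2) u_cont[OF assms(3)]])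
  have "\<forall>\<^sub>F s in at t. 0 < s" using assms(3) by (rule order_tendstoD(1)[OF tendsto_ident_at])
  then show "\<forall>\<^sub>F s in at t. u s \<in> borel_measurable M \<and> (\<integral>\<^sup>+x. ennreal ((u s x)\<^sup>2 * v x) \<partial>M) < \<infinity>"
    by eventually_elim (use u_meas u_L2 in auto)
qed (use assms(3) u_meas u_L2 in auto)

text \<open>Integrating \<open>energy_increment\<close> over \<open>{a..b}\<close> bounds
  \<open>h\<close> times the total dissipation by increments of a primitive \<open>P\<close> of the
  energy plus an error \<open>h * e\<close>. After division by \<open>h\<close>, the limit only uses
  that \<open>P\<close> has derivative \<open>E\<close>; the energy itself is never
  differentiated.\<close>

lemma energy_inequality:
  assumes F: "C1b F F'" and Fb: "\<And>x. \<bar>F x\<bar> \<le> C" and F0: "\<And>x. 0 \<le> F' x"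
    and \<Phi>: "\<And>x. (\<Phi> has_real_derivative F x) (at x)" "\<Phi> 0 = 0" and \<Phi>0: "\<And>x. 0 \<le> \<Phi> x" and PL: "C-lipschitz_on UNIV \<Phi>"
    and ab: "0 < a" "a < b"
  shows "(\<integral>\<^sup>+t. indicator {a..b} t * (\<integral>\<^sup>+x. ennreal (F' (uh (t, x)) * N (t, x) powr p) \<partial>lborel) \<partial>lborel)
     + ennreal (\<integral>x. \<Phi> (u b x) * v x \<partial>M) \<le> ennreal (\<integral>x. \<Phi> (u a x) * v x \<partial>M)"
proof -
  define E where "E t = (\<integral>x. \<Phi> (u t x) * v x \<partial>M)" for t
  have Fm[measurable]: "F \<in> borel_measurable borel" "F' \<in> borel_measurable borel" using C1b_measurable[OF F] by blast+
  obtain B where B: "0 \<le> B" "\<And>x. \<bar>F' x\<bar> \<le> B" using C1b_lipschitz[OF F] by blast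
  have E0: "0 \<le> E t" for t unfolding E_def using \<Phi>0 v_nonneg by (intro integral_nonneg_AE AE_I2) auto
  have Ec: "isCont E t" if "0 < t" for t unfolding E_def[abs_def] by (rule functional_isCont[OF PL \<Phi>(2) that])
  \<comment> \<open>A Borel function on the whole line that equals \<open>E\<close> at positive
    times, where continuity is known.\<close>
  define Eb where "Eb t = indicator {0<..} t *\<^sub>R E t" for t
  have [measurable]: "Eb \<in> borel_measurable borel"
    unfolding Eb_def[abs_def]
    by (rule borel_measurable_continuous_on_indicator) (auto intro!: continuous_at_imp_continuous_on Ec)
  have Eb: "Eb t = E t" if "0 < t" for t using that by (simp add: Eb_def)
  \<comment> \<open>The larger interval gives \<open>P\<close> two-sided derivatives at
    \<open>a\<close> and \<open>b\<close> and leaves room to evaluate it at \<open>a - h\<close> for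
    \<open>h < a / 2\<close>.\<close>
  have "continuous_on {a/2..b+1} E" using ab by (intro continuous_at_imp_continuous_on ballI Ec) auto
  then obtain P where P: "\<And>x. x \<in> {a/2..b+1} \<Longrightarrow> (P has_vector_derivative E x) (at x within {a/2..b+1})"
    using antiderivative_continuous by blast
  have Pd: "(P has_real_derivative E x) (at x)" if "a/2 < x" "x < b + 1" for x
  proof -
    have "(P has_vector_derivative E x) (at x within {a/2..b+1})" using that by (intro P) auto
    moreover have "at x within {a/2..b+1} = at x" using that by (intro at_within_interior) auto
    ultimately show ?thesis by (simp add: has_real_derivative_iff_has_vector_derivative)
  qed
  define Z where "Z = (\<integral>\<^sup>+t. indicator {a..b} t * (\<integral>\<^sup>+x. ennreal (F' (uh (t, x)) * N (t, x) powr p) \<partial>lborel) \<partial>lborel)"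
  define bb where "bb z = F' (uh z) *\<^sub>R Gh z" for z
  have [measurable]: "bb \<in> borel_measurable borel" unfolding bb_def[abs_def] by measurable
  have bb: "AE z in lborel. qnorm (Qh (snd z)) (bb z) \<le> B * N z"
    using AE_psd0_pair
    by eventually_elim (use B in \<open>auto simp: bb_def N_def psd0_qnorm(1,2) intro!: mult_right_mono\<close>)
  have step: "ennreal h * Z + ennreal (P b - P a) \<le> ennreal h * ennreal e + ennreal (P (b - h) - P (a - h))"
    if h: "0 < h" "h < a / 2" and osc: "\<And>r. 0 \<le> r \<Longrightarrow> r < h \<Longrightarrow> osc bb a b r \<le> ennreal e" for h e
  proof -
    have ftc: "(\<integral>\<^sup>+t. indicator {a..b} t * ennreal (Eb (t - k)) \<partial>lborel) = ennreal (P (b - k) - P (a - k))" if "0 \<le> k" "k < a / 2" for k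
    proof -
      have "(\<integral>\<^sup>+t. ennreal (Eb (t - k)) * indicator {a..b} t \<partial>lborel) = ennreal (P (b - k) - P (a - k))"
      proof (rule nn_integral_FTC_Icc[where F = "\<lambda>t. P (t - k)" and f = "\<lambda>t. Eb (t - k)"])
        fix x assume x: "x \<in> {a..b}"
        have "(P has_real_derivative E (x - k)) (at (x - k))" using x that ab by (intro Pd) auto
        then have "((\<lambda>t. P (t - k)) has_real_derivative E (x - k)) (at x)"
          using DERIV_shift[of P "E (x - k)" x "- k"] by simp
        then show "((\<lambda>t. P (t - k)) has_real_derivative Eb (x - k)) (at x)"
          using x that ab by (subst Eb) auto
        show "0 \<le> Eb (x - k)" using E0 by (simp add: Eb_def)
      qed (use ab in auto)
      then show ?thesis by (simp add: mult.commute)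
    qed
    let ?Z = "\<lambda>t. \<integral>\<^sup>+x. ennreal (F' (uh (t, x)) * N (t, x) powr p) \<partial>lborel"
    let ?\<rho> = "\<lambda>t. \<integral>\<^sup>+z. indicator {t-h<..t} (fst z) * ennreal \<bar>(flux z - flux (t, snd z)) \<bullet> bb (t, snd z)\<bar> \<partial>lborel"
    have [measurable]: "?\<rho> \<in> borel_measurable borel"
    proof -
      have "?\<rho> = (\<lambda>t. \<integral>\<^sup>+z. indicator {z :: real \<times> (real \<times> (real^'n)). fst z - h < fst (snd z) \<and> fst (snd z) \<le> fst z} (t, z) * ennreal \<bar>(flux z - flux (t, snd z)) \<bullet> bb (t, snd z)\<bar> \<partial>lborel)"
        by (intro ext nn_integral_cong) (auto simp: indicator_def)
      also have "\<dots> \<in> borel_measurable borel" by measurable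
      finally show ?thesis .
    qed
    have "ennreal h * Z + ennreal (P b - P a) = ennreal h * (\<integral>\<^sup>+t. indicator {a..b} t * ?Z t \<partial>lborel) + (\<integral>\<^sup>+t. indicator {a..b} t * ennreal (Eb t) \<partial>lborel)"
      using ftc[of 0] ab unfolding Z_def by simp
    also have "\<dots> = (\<integral>\<^sup>+t. indicator {a..b} t * (ennreal h * ?Z t + ennreal (Eb t)) \<partial>lborel)"
      by (simp add: nn_integral_cmult nn_integral_add distrib_left mult.left_commute)
    also have "\<dots> \<le> (\<integral>\<^sup>+t. indicator {a..b} t * ?\<rho> t + indicator {a..b} t * ennreal (Eb (t - h)) \<partial>lborel)"
    proof (rule nn_integral_mono_AE)
      show "AE t in lborel. indicator {a..b} t * (ennreal h * ?Z t + ennreal (Eb t)) \<le> indicator {a..b} t * ?\<rho> t + indicator {a..b} t * ennreal (Eb (t - h))"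
        using energy_increment[OF F Fb F0 \<Phi>]
      proof eventually_elim
        case (elim t)
        show ?case
        proof (cases "t \<in> {a..b}")
          case True
          then have "0 < t" "0 < h \<and> h < t" "0 < t - h" using h ab by auto
          then show ?thesis using elim[rule_format, of h] True by (simp add: Eb E_def bb_def)
        qed simp
      qed
    qed
    also have "\<dots> = (\<integral>\<^sup>+t. indicator {a..b} t * ?\<rho> t \<partial>lborel) + (\<integral>\<^sup>+t. indicator {a..b} t * ennreal (Eb (t - h)) \<partial>lborel)"
      by (rule nn_integral_add) measurable
    also have "(\<integral>\<^sup>+t. indicator {a..b} t * ennreal (Eb (t - h)) \<partial>lborel) = ennreal (P (b - h) - P (a - h))"
      using h by (intro ftc) auto
    also have "(\<integral>\<^sup>+t. indicator {a..b} t * ?\<rho> t \<partial>lborel) = (\<integral>\<^sup>+r. indicator {0..<h} r * osc bb a b r \<partial>lborel)"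
      by (rule fluctuation_eq) measurable
    also have "\<dots> \<le> (\<integral>\<^sup>+r. indicator {0..<h} r * ennreal e \<partial>lborel)"
      using osc by (intro nn_integral_mono) (auto simp: indicator_def)
    also have "\<dots> = ennreal h * ennreal e" using h by (subst nn_integral_multc) auto
    finally show ?thesis by (simp add: add_right_mono)
  qed
  have PE: "P x \<le> P y" if "a / 2 < x" "x \<le> y" "y < b + 1" for x y
    using that E0 by (intro DERIV_nonneg_imp_nondecreasing[of x y P]) (auto intro!: exI Pd)
  \<comment> \<open>The dissipation has to be finite before it can be treated as the real number
    \<open>zr\<close> and the inequality divided by \<open>h\<close>.\<close>
  have Zf: "Z < \<infinity>"
  proof -
    have "Z \<le> (\<integral>\<^sup>+t. (\<integral>\<^sup>+x. ennreal B * (indicator {0..b} t * ennreal (N (t, x) powr p)) \<partial>lborel) \<partial>lborel)"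
      unfolding Z_def
    proof (rule nn_integral_mono)
      fix t :: real
      have "indicator {a..b} t * (\<integral>\<^sup>+x. ennreal (F' (uh (t, x)) * N (t, x) powr p) \<partial>lborel) =
         (\<integral>\<^sup>+x. indicator {a..b} t * ennreal (F' (uh (t, x)) * N (t, x) powr p) \<partial>lborel)"
        by (rule nn_integral_cmult[symmetric]) measurable
      also have "\<dots> \<le> (\<integral>\<^sup>+x. ennreal B * (indicator {0..b} t * ennreal (N (t, x) powr p)) \<partial>lborel)"
        using B ab by (intro nn_integral_mono) (auto simp: indicator_def abs_le_iff intro!: ennreal_leI mult_right_mono simp flip: ennreal_mult)
      finally show "indicator {a..b} t * (\<integral>\<^sup>+x. ennreal (F' (uh (t, x)) * N (t, x) powr p) \<partial>lborel) \<le>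
         (\<integral>\<^sup>+x. ennreal B * (indicator {0..b} t * ennreal (N (t, x) powr p)) \<partial>lborel)" .
    qed
    also have "\<dots> = (\<integral>\<^sup>+z. ennreal B * (indicator {0..b} (fst z) * ennreal (N z powr p)) \<partial>lborel)"
      by (subst nn_integral_lborel_pair) simp_all
    also have "\<dots> = ennreal B * (\<integral>\<^sup>+z. indicator {0..b} (fst z) * ennreal (N z powr p) \<partial>lborel)"
      by (rule nn_integral_cmult) measurable
    also have "\<dots> < \<infinity>" using time_energy_finite[of b] ab by (simp add: ennreal_mult_less_top)
    finally show ?thesis .
  qed
  then obtain zr where zr: "Z = ennreal zr" "0 \<le> zr" by (cases Z) auto
  have "zr + E b \<le> E a + e" if e: "0 < e" for e
  proof -
    obtain h0 where h0: "0 < h0" "\<And>r. 0 \<le> r \<Longrightarrow> r < h0 \<Longrightarrow> osc bb a b r \<le> ennreal e"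
      using osc_small[OF _ bb B(1) ab e] by auto
    \<comment> \<open>This is what \<open>step\<close> leaves on the right after division by
      \<open>h\<close>, apart from \<open>e\<close>; it tends to \<open>E a - E b\<close>.\<close>
    let ?D = "\<lambda>h. (P (b - h) - P b) / h - (P (a - h) - P a) / h"
    have lim: "((\<lambda>h. (P (x - h) - P x) / h) \<longlongrightarrow> - E x) (at_right 0)" if "a/2 < x" "x < b + 1" for x
    proof -
      have "((\<lambda>h. P (x - h)) has_real_derivative E x * (-1)) (at 0)"
        by (rule DERIV_chain2[of P "E x"]) (use Pd[OF that] in \<open>auto intro!: derivative_eq_intros\<close>)
      then have "((\<lambda>h. (P (x - h) - P x) / h) \<longlongrightarrow> - E x) (at 0)" by (simp add: DERIV_def)
      then show ?thesis by (rule filterlim_mono) (auto simp: at_le)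
    qed
    have "(?D \<longlongrightarrow> - E b - - E a) (at_right 0)" using ab by (intro tendsto_diff lim) auto
    moreover have "\<forall>\<^sub>F h in at_right 0. zr \<le> e + ?D h"
    proof -
      have "\<forall>\<^sub>F h in at_right (0::real). h < min h0 (a/2)" using h0(1) ab by (intro order_tendstoD(2)[OF tendsto_ident_at]) auto
      moreover have "\<forall>\<^sub>F h in at_right (0::real). 0 < h" by (simp add: eventually_at_right_less)
      ultimately show ?thesis
      proof eventually_elim
        case (elim h)
        have "ennreal h * Z + ennreal (P b - P a) \<le> ennreal h * ennreal e + ennreal (P (b - h) - P (a - h))"
          using elim h0(2) by (intro step) auto
        moreover have "0 \<le> P b - P a" "0 \<le> P (b - h) - P (a - h)" using PE[of a b] PE[of "a - h" "b - h"] ab elim by auto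
        ultimately have "ennreal (h * zr + (P b - P a)) \<le> ennreal (h * e + (P (b - h) - P (a - h)))"
          using zr elim e by (simp add: ennreal_mult ennreal_plus)
        then have "h * zr + (P b - P a) \<le> h * e + (P (b - h) - P (a - h))"
          using e elim \<open>0 \<le> P (b - h) - P (a - h)\<close> by (subst (asm) ennreal_le_iff) (auto intro!: add_nonneg_nonneg)
        moreover have "h * (X / h - Y / h) = X - Y" for X Y
          using elim by (simp flip: diff_divide_distrib)
        then have "h * ?D h = (P (b - h) - P b) - (P (a - h) - P a)" by blast
        ultimately have "h * zr \<le> h * e + h * ?D h" by linarith
        then have "h * zr \<le> h * (e + ?D h)" by (simp only: distrib_left)
        then show ?case using elim by simp
      qed
    qed
    ultimately have "zr \<le> e + (- E b - - E a)"
      by (intro tendsto_lowerbound[of "\<lambda>h. e + ?D h"] tendsto_add tendsto_const) auto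
    then show ?thesis by simp
  qed
  then have "zr + E b \<le> E a" by (rule field_le_epsilon)
  then have "ennreal (zr + E b) \<le> ennreal (E a)" by (rule ennreal_leI)
  then show ?thesis using zr E0 unfolding Z_def[symmetric] E_def[symmetric] by (simp add: ennreal_plus)
qed

end

section \<open>Cut-off powers and finite extinction\<close>

lemma continuous_antiderivative:
  fixes f :: "real \<Rightarrow> real"
  assumes "continuous_on UNIV f"
  obtains F where "F 0 = 0" "\<And>x. (F has_real_derivative f x) (at x)"
proof -
  define F where "F x = (LBINT y=0..x. f y)" for x :: real
  have "(F has_real_derivative f x) (at x)" for x
  proof -
    let ?a = "- \<bar>x\<bar> - 1" and ?b = "\<bar>x\<bar> + 1"
    have "(F has_vector_derivative f x) (at x within {?a..?b})"
      unfolding F_def[abs_def] zero_ereal_def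
      by (rule interval_integral_FTC2) (use continuous_on_subset[OF assms] in auto)
    moreover have "at x within {?a..?b} = at x" by (intro at_within_interior) auto
    ultimately show ?thesis by (simp add: has_real_derivative_iff_has_vector_derivative)
  qed
  moreover have "F 0 = 0" by (simp add: F_def zero_ereal_def interval_integral_endpoints_same)
  ultimately show ?thesis using that by blast
qed

lemma antiderivative_of_even_is_odd:
  fixes F f :: "real \<Rightarrow> real"
  assumes d: "\<And>x. (F has_real_derivative f x) (at x)" and "F 0 = 0" and even: "\<And>x. f (- x) = f x"
  shows "F (- x) = - F x"
proof -
  have "((\<lambda>x. F x + F (- x)) has_real_derivative 0) (at x)" for x
  proof -
    have "((\<lambda>x. F (- x)) has_real_derivative f (- x) * (- 1)) (at x)"
      by (rule DERIV_chain2[OF d]) (auto intro!: derivative_eq_intros)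
    from DERIV_add[OF d this] show ?thesis by (simp add: even)
  qed
  then have "\<forall>x. DERIV (\<lambda>x. F x + F (- x)) x :> 0" by blast
  from DERIV_isconst_all[OF this, of x 0] show ?thesis using assms(2) by simp
qed

lemma antiderivative_of_odd_is_even:
  fixes F f :: "real \<Rightarrow> real"
  assumes d: "\<And>x. (F has_real_derivative f x) (at x)" and odd: "\<And>x. f (- x) = - f x"
  shows "F (- x) = F x"
proof -
  have "((\<lambda>x. F x - F (- x)) has_real_derivative 0) (at x)" for x
  proof -
    have "((\<lambda>x. F (- x)) has_real_derivative f (- x) * (- 1)) (at x)"
      by (rule DERIV_chain2[OF d]) (auto intro!: derivative_eq_intros)
    from DERIV_diff[OF d this] show ?thesis by (simp add: odd)
  qed
  then have "\<forall>x. DERIV (\<lambda>x. F x - F (- x)) x :> 0" by blast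
  from DERIV_isconst_all[OF this, of x 0] show ?thesis by simp
qed

text \<open>Only the upper half of \<open>[0, s]\<close> is used, where an increasing power is at
  least its value at \<open>s / 2\<close>. This is the source of the factors 2 and 4 in
  \<open>is_cutoff\<close>.\<close>

lemma antiderivative_lower_bound:
  fixes F f :: "real \<Rightarrow> real"
  assumes d: "\<And>x. (F has_real_derivative f x) (at x)" and F0: "F 0 = 0" and nn: "\<And>x. 0 \<le> x \<Longrightarrow> 0 \<le> f x"
    and s: "0 \<le> s" and lb: "\<And>x. s / 2 \<le> x \<Longrightarrow> x \<le> s \<Longrightarrow> c \<le> f x"
  shows "s / 2 * c \<le> F s"
proof (cases "s = 0")
  case False
  then have "s / 2 < s" using s by simp
  from MVT2[OF this d] obtain z where z: "s / 2 < z" "z < s" "F s - F (s / 2) = (s - s / 2) * f z" by blast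
  have "F 0 \<le> F (s / 2)"
    by (rule DERIV_nonneg_imp_nondecreasing) (use s d nn in auto)
  moreover have "s / 2 * c \<le> s / 2 * f z" using lb[of z] z s by (intro mult_left_mono) auto
  ultimately show ?thesis using z(3) F0 by simp
qed (simp add: F0)

lemma antiderivative_upper_bound:
  fixes F f :: "real \<Rightarrow> real"
  assumes d: "\<And>x. (F has_real_derivative f x) (at x)" and F0: "F 0 = 0" and ub: "\<And>x. \<bar>x\<bar> \<le> \<bar>s\<bar> \<Longrightarrow> \<bar>f x\<bar> \<le> c"
  shows "\<bar>F s\<bar> \<le> c * \<bar>s\<bar>"
proof -
  have "norm (F s - F 0) \<le> c * norm (s - 0)"
    by (rule field_differentiable_bound[of "{-\<bar>s\<bar>..\<bar>s\<bar>}" F f])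
       (use d ub in \<open>auto intro: has_field_derivative_at_within\<close>)
  then show ?thesis by (simp add: F0)
qed

text \<open>\<open>F'\<close>, the second derivative of \<open>\<Phi>\<close>, is the
  \<open>p\<close>-th power of \<open>H'\<close>, which makes the dissipation the energy of the
  gradient of \<open>H(u)\<close>. The comparisons with powers have constants free of
  \<open>k\<close>, while the Lipschitz constant \<open>C\<close> may depend on the level. Lower
  bounds up to level \<open>k\<close> suffice for Fatou's lemma, since every fixed value is
  eventually below the level.\<close>

definition is_cutoff where
  "is_cutoff q p k F F' \<Phi> H H' C \<longleftrightarrow> C1b F F' \<and> (\<forall>x. \<bar>F x\<bar> \<le> C) \<and> (\<forall>x. 0 \<le> F' x) \<and>
     (\<forall>x. (\<Phi> has_real_derivative F x) (at x)) \<and> \<Phi> 0 = 0 \<and> (\<forall>x. 0 \<le> \<Phi> x) \<and> C-lipschitz_on UNIV \<Phi> \<and>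
     C1b H H' \<and> (\<forall>x. 0 \<le> H' x \<and> H' x powr p = F' x) \<and>
     (\<forall>s. \<Phi> s \<le> \<bar>s\<bar> powr q) \<and> (\<forall>s. \<bar>s\<bar> \<le> k \<longrightarrow> (\<bar>s\<bar> / 4) powr q \<le> \<Phi> s) \<and>
     (\<forall>s. \<bar>s\<bar> \<le> k \<longrightarrow> (\<bar>s\<bar> / 2) powr ((q - 2 + p) / p) \<le> \<bar>H s\<bar>)"

text \<open>\<open>F'\<close> is the power with exponent \<open>q - 2\<close> up to
  \<open>k\<close>, brought down to 0 at \<open>k + 1\<close>. Integrating twice gives
  \<open>F\<close> and \<open>\<Phi>\<close>, integrating the \<open>p\<close>-th root gives
  \<open>H\<close>, and parity reduces the lower bounds to positive arguments.\<close>

lemma cutoff_family: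
  fixes q p k :: real
  assumes q: "2 \<le> q" and p: "1 < p" and k: "0 < k"
  shows "\<exists>F F' \<Phi> H H' C. is_cutoff q p k F F' \<Phi> H H' C"
proof -
  \<comment> \<open>The case distinction is needed because \<open>0 powr 0 = 0\<close>.\<close>
  define w where "w s = (if q = 2 then 1 else \<bar>s\<bar> powr (q - 2))" for s :: real
  \<comment> \<open>The linear ramp between \<open>k\<close> and \<open>k + 1\<close> keeps
    \<open>f\<close> continuous with compact support, so that its primitive is bounded.\<close>
  define f where "f s = w s * max 0 (min 1 (k + 1 - \<bar>s\<bar>))" for s
  define h where "h s = f s powr (1 / p)" for s
  have w0: "0 \<le> w s" for s by (simp add: w_def)
  have wmono: "w x \<le> w y" if "\<bar>x\<bar> \<le> \<bar>y\<bar>" for x y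
    using that q by (auto simp: w_def intro!: powr_mono2)
  have wpowr: "w s = \<bar>s\<bar> powr (q - 2)" if "s \<noteq> 0" for s using that by (simp add: w_def)
  have contw: "continuous_on UNIV w"
  proof (cases "q = 2")
    case False
    then have "w = (\<lambda>s. \<bar>s\<bar> powr (q - 2))" by (auto simp: w_def)
    moreover have "continuous_on UNIV (\<lambda>s::real. \<bar>s\<bar> powr (q - 2))"
      by (intro continuous_on_powr' continuous_intros) (use q False in auto)
    ultimately show ?thesis by simp
  qed (simp add: w_def)
  have contf: "continuous_on UNIV f" unfolding f_def by (intro continuous_intros contw)
  have f0: "0 \<le> f s" for s using w0 by (simp add: f_def)
  have fw: "f s \<le> w s" for s unfolding f_def using w0[of s] by (intro mult_left_le) auto
  have fk: "f s = w s" if "\<bar>s\<bar> \<le> k" for s using that by (simp add: f_def)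
  have fz: "f s = 0" if "k + 1 \<le> \<bar>s\<bar>" for s using that by (simp add: f_def)
  define B where "B = w (k + 1)"
  have fB: "\<bar>f s\<bar> \<le> B" for s
  proof (cases "\<bar>s\<bar> \<le> k + 1")
    case True
    then have "w s \<le> B" unfolding B_def using k by (intro wmono) auto
    then show ?thesis using fw[of s] f0[of s] by simp
  next
    case False
    then show ?thesis using fz[of s] w0 by (simp add: B_def)
  qed
  have B0: "0 \<le> B" using w0 by (simp add: B_def)
  have feven: "f (- s) = f s" for s by (simp add: f_def w_def)
  obtain F where F: "F 0 = 0" "\<And>x. (F has_real_derivative f x) (at x)" using continuous_antiderivative[OF contf] by blast
  have F1: "C1b F f" unfolding C1b_def using F contf fB by blast
  \<comment> \<open>Beyond \<open>k + 1\<close> the primitive \<open>F\<close> is constant, so the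
    linear bound at \<open>k + 1\<close> serves everywhere.\<close>
  define C where "C = B * (k + 1)"
  have Fodd: "F (- x) = - F x" for x by (rule antiderivative_of_even_is_odd[OF F(2,1) feven])
  have Fmono: "F x \<le> F y" if "x \<le> y" for x y
    using that F(2) f0 by (intro DERIV_nonneg_imp_nondecreasing[of x y F]) auto
  have Fub: "\<bar>F s\<bar> \<le> B * \<bar>s\<bar>" for s by (rule antiderivative_upper_bound[OF F(2,1)]) (rule fB)
  have FC: "\<bar>F x\<bar> \<le> C" for x
  proof (cases "\<bar>x\<bar> \<le> k + 1")
    case True
    then show ?thesis using Fub[of x] mult_left_mono[OF True B0] by (simp add: C_def)
  next
    case False
    have far: "\<bar>F y\<bar> \<le> C" if "k + 1 < y" for y
    proof -
      have "norm (F y - F (k + 1)) \<le> 0 * norm (y - (k + 1))"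
      proof (rule field_differentiable_bound[of "{k+1..}" F f])
        show "(F has_field_derivative f z) (at z within {k+1..})" for z
          using F(2) by (rule has_field_derivative_at_within)
        show "norm (f z) \<le> 0" if "z \<in> {k+1..}" for z using fz[of z] that k by simp
      qed (use that in auto)
      then show ?thesis using Fub[of "k + 1"] k by (simp add: C_def)
    qed
    show ?thesis using far[of x] far[of "- x"] False Fodd[of x] by (auto simp: abs_if split: if_splits)
  qed
  have contF: "continuous_on UNIV F" using F(2) by (intro continuous_at_imp_continuous_on ballI DERIV_isCont)
  obtain \<Phi> where \<Phi>: "\<Phi> 0 = 0" "\<And>x. (\<Phi> has_real_derivative F x) (at x)" using continuous_antiderivative[OF contF] by blast
  have \<Phi>even: "\<Phi> (- x) = \<Phi> x" for x by (rule antiderivative_of_odd_is_even[OF \<Phi>(2) Fodd])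
  have Fpos: "0 \<le> F x" if "0 \<le> x" for x using Fmono[OF that] F(1) by simp
  have \<Phi>pos': "0 \<le> \<Phi> x" if "0 \<le> x" for x
    using DERIV_nonneg_imp_nondecreasing[of 0 x \<Phi>] \<Phi> Fpos that by force
  have \<Phi>pos: "0 \<le> \<Phi> x" for x using \<Phi>pos'[of x] \<Phi>pos'[of "- x"] \<Phi>even[of x] by (cases "0 \<le> x") auto
  have \<Phi>L: "C-lipschitz_on UNIV \<Phi>"
  proof (rule lipschitz_onI)
    fix x y :: real
    have "norm (\<Phi> x - \<Phi> y) \<le> C * norm (x - y)"
      by (rule field_differentiable_bound[of UNIV \<Phi> F]) (use FC \<Phi>(2) in \<open>auto intro: has_field_derivative_at_within\<close>)
    then show "dist (\<Phi> x) (\<Phi> y) \<le> C * dist x y" by (simp add: dist_norm)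
  qed (use k B0 in \<open>simp add: C_def\<close>)
  have \<Phi>ub: "\<Phi> s \<le> \<bar>s\<bar> powr q" for s
  proof (cases "s = 0")
    case False
    have "\<bar>F r\<bar> \<le> w s * \<bar>s\<bar>" if "\<bar>r\<bar> \<le> \<bar>s\<bar>" for r
    proof -
      have "\<bar>F r\<bar> \<le> w r * \<bar>r\<bar>"
      proof (rule antiderivative_upper_bound[OF F(2,1)])
        fix y assume "\<bar>y\<bar> \<le> \<bar>r\<bar>"
        then show "\<bar>f y\<bar> \<le> w r" using f0[of y] fw[of y] wmono[of y r] by linarith
      qed
      also have "\<dots> \<le> w s * \<bar>s\<bar>" using that w0 wmono by (intro mult_mono) auto
      finally show ?thesis .
    qed
    then have "\<bar>\<Phi> s\<bar> \<le> w s * \<bar>s\<bar> * \<bar>s\<bar>" by (rule antiderivative_upper_bound[OF \<Phi>(2,1)])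
    also have "\<dots> = \<bar>s\<bar> powr (q - 2) * \<bar>s\<bar> powr 2" using False by (simp add: wpowr power2_eq_square)
    also have "\<dots> = \<bar>s\<bar> powr q" using powr_add[of "\<bar>s\<bar>" "q - 2" 2] by simp
    finally show ?thesis by simp
  qed (simp add: \<Phi>)
  have Flb: "(s / 2) powr (q - 1) \<le> F s" if "0 < s" "s \<le> k" for s
  proof -
    have "s / 2 * w (s / 2) \<le> F s"
      by (rule antiderivative_lower_bound[OF F(2,1) f0]) (use that fk wmono in auto)
    moreover have "s / 2 * w (s / 2) = (s / 2) powr (q - 1)"
      using that powr_add[of "s / 2" 1 "q - 2"] by (simp add: wpowr)
    ultimately show ?thesis by simp
  qed
  have \<Phi>lb': "(s / 4) powr q \<le> \<Phi> s" if "0 < s" "s \<le> k" for s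
  proof -
    have "s / 2 * F (s / 2) \<le> \<Phi> s"
      by (rule antiderivative_lower_bound[OF \<Phi>(2,1) Fpos]) (use that Fmono in auto)
    moreover have "s / 4 * (s / 4) powr (q - 1) \<le> s / 2 * F (s / 2)"
      using Flb[of "s / 2"] that by (intro mult_mono) auto
    moreover have "s / 4 * (s / 4) powr (q - 1) = (s / 4) powr q"
      using that powr_add[of "s / 4" 1 "q - 1"] by simp
    ultimately show ?thesis by simp
  qed
  have \<Phi>lb: "(\<bar>s\<bar> / 4) powr q \<le> \<Phi> s" if "\<bar>s\<bar> \<le> k" for s
  proof (cases s "0::real" rule: linorder_cases)
    case less
    then show ?thesis using \<Phi>lb'[of "- s"] \<Phi>even[of s] that by simp
  qed (use \<Phi>lb'[of s] that \<Phi>(1) in auto)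
  have conth: "continuous_on UNIV h" unfolding h_def using p f0 by (intro continuous_on_powr' contf) auto
  have hp: "h x powr p = f x" for x using p f0[of x] by (simp add: h_def powr_powr)
  have h0: "0 \<le> h x" for x by (simp add: h_def)
  obtain H where H: "H 0 = 0" "\<And>x. (H has_real_derivative h x) (at x)" using continuous_antiderivative[OF conth] by blast
  have hB: "\<bar>h x\<bar> \<le> B powr (1 / p)" for x
    using fB[of x] f0[of x] p by (auto simp: h_def intro!: powr_mono2)
  have H1: "C1b H h" unfolding C1b_def using H conth hB by blast
  have heven: "h (- x) = h x" for x by (simp add: h_def feven)
  have Hodd: "H (- x) = - H x" for x by (rule antiderivative_of_even_is_odd[OF H(2,1) heven])
  have Hlb': "(s / 2) powr ((q - 2 + p) / p) \<le> H s" if "0 < s" "s \<le> k" for s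
  proof -
    have "s / 2 * w (s / 2) powr (1 / p) \<le> H s"
      by (rule antiderivative_lower_bound[OF H(2,1) h0])
         (use that fk wmono w0 p in \<open>auto simp: h_def intro!: powr_mono2\<close>)
    moreover have "s / 2 * w (s / 2) powr (1 / p) = (s / 2) powr ((q - 2 + p) / p)"
    proof -
      have "(q - 2 + p) / p = 1 + (q - 2) / p" using p by (simp add: field_simps)
      then show ?thesis using that powr_add[of "s / 2" 1 "(q - 2) / p"] by (simp add: wpowr powr_powr)
    qed
    ultimately show ?thesis by simp
  qed
  have Hlb: "(\<bar>s\<bar> / 2) powr ((q - 2 + p) / p) \<le> \<bar>H s\<bar>" if "\<bar>s\<bar> \<le> k" for s
  proof (cases s "0::real" rule: linorder_cases)
    case less
    then show ?thesis using Hlb'[of "- s"] Hodd[of s] that by simp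
  next
    case greater
    then show ?thesis using Hlb'[of s] that by simp
  qed (simp add: H)
  have "is_cutoff q p k F f \<Phi> H h C"
    unfolding is_cutoff_def
    by (intro conjI allI impI F1 FC f0 \<Phi> \<Phi>pos \<Phi>L H1 h0 hp \<Phi>ub \<Phi>lb Hlb)
  then show ?thesis by blast
qed

text \<open>A halving argument. Falling from level \<open>x n\<close> to half of it takes at most
  time \<open>\<tau> n\<close>: otherwise the loss would be at least
  \<open>c * \<tau> n * x (Suc n) powr \<alpha>\<close>, which equals \<open>x (Suc n)\<close>, and
  \<open>e\<close> could not have stayed above \<open>x (Suc n)\<close>. As
  \<open>\<alpha> < 1\<close>, these times form a convergent geometric series.\<close>

lemma finite_extinction:
  fixes e :: "real \<Rightarrow> real"
  assumes nn: "\<And>t. 0 < t \<Longrightarrow> 0 \<le> e t" and K: "\<And>t. 0 < t \<Longrightarrow> e t \<le> K" and c: "0 < c" and al: "0 < \<alpha>" "\<alpha> < 1"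
    and dec: "\<And>a b. 0 < a \<Longrightarrow> a < b \<Longrightarrow> 0 < e b \<Longrightarrow> e b + c * (b - a) * e b powr \<alpha> \<le> e a"
  shows "\<exists>T>0. \<forall>t\<ge>T. e t = 0"
proof -
  \<comment> \<open>The maximum makes the starting level positive.\<close>
  define K1 where "K1 = max K 1"
  have K1: "0 < K1" "\<And>t. 0 < t \<Longrightarrow> e t \<le> K1" using K by (auto simp: K1_def le_max_iff_disj)
  define x where "x n = K1 / 2 ^ n" for n :: nat
  have x0: "0 < x n" for n using K1 by (simp add: x_def)
  define \<tau> where "\<tau> n = x (Suc n) powr (1 - \<alpha>) / c" for n
  have \<tau>0: "0 < \<tau> n" for n using x0[of "Suc n"] c by (simp add: \<tau>_def)
  define \<rho> where "\<rho> = (1 / 2) powr (1 - \<alpha>)"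
  have \<rho>: "0 < \<rho>" "\<rho> < 1"
  proof -
    show "0 < \<rho>" by (simp add: \<rho>_def)
    have "(1 / 2 :: real) powr (1 - \<alpha>) < 1 powr (1 - \<alpha>)" using al by (intro powr_less_mono2) auto
    then show "\<rho> < 1" by (simp add: \<rho>_def)
  qed
  have geo: "\<tau> n = \<tau> 0 * \<rho> ^ n" for n
  proof (induction n)
    case (Suc n)
    have "x (Suc (Suc n)) = x (Suc n) * (1 / 2)" by (simp add: x_def)
    then have "x (Suc (Suc n)) powr (1 - \<alpha>) = (x (Suc n) * (1 / 2)) powr (1 - \<alpha>)" by (rule arg_cong)
    also have "\<dots> = x (Suc n) powr (1 - \<alpha>) * \<rho>"
      unfolding \<rho>_def by (rule powr_mult)
    finally have "x (Suc (Suc n)) powr (1 - \<alpha>) = x (Suc n) powr (1 - \<alpha>) * \<rho>" .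
    then have "\<tau> (Suc n) = \<tau> n * \<rho>" by (simp add: \<tau>_def)
    then show ?case using Suc by simp
  qed simp
  define T where "T = 1 + \<tau> 0 / (1 - \<rho>)"
  have sum: "(\<Sum>j<n. \<tau> j) \<le> \<tau> 0 / (1 - \<rho>)" for n
  proof -
    have "(\<Sum>j<n. \<tau> j) = \<tau> 0 * (\<Sum>j<n. \<rho> ^ j)" by (subst geo) (simp add: sum_distrib_left)
    also have "(\<Sum>j<n. \<rho> ^ j) \<le> (\<Sum>j. \<rho> ^ j)" using \<rho> by (intro sum_le_suminf summable_geometric) auto
    also have "(\<Sum>j. \<rho> ^ j) = 1 / (1 - \<rho>)" using \<rho> by (intro suminf_geometric) auto
    finally show ?thesis using \<tau>0[of 0] by (simp add: mult_left_mono)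
  qed
  \<comment> \<open>The leading 1 is a positive starting time, because bounds and decay are assumed
    at positive times only.\<close>
  have main: "e t \<le> x n" if "1 + (\<Sum>j<n. \<tau> j) \<le> t" for n t
    using that
  proof (induction n arbitrary: t)
    case 0
    then show ?case using K1(2)[of t] by (simp add: x_def)
  next
    case (Suc n)
    show ?case
    proof (rule ccontr)
      assume "\<not> e t \<le> x (Suc n)"
      then have gt: "x (Suc n) < e t" by simp
      let ?s = "1 + (\<Sum>j<n. \<tau> j)"
      have s0: "0 < ?s" using \<tau>0 by (intro add_pos_nonneg sum_nonneg) (auto intro: less_imp_le)
      have st: "?s + \<tau> n \<le> t" using Suc.prems by simp
      then have "?s < t" using \<tau>0[of n] by linarith
      have "e t + c * (t - ?s) * e t powr \<alpha> \<le> e ?s"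
        using s0 \<open>?s < t\<close> gt x0[of "Suc n"] by (intro dec) auto
      also have "\<dots> \<le> x n" by (rule Suc.IH) simp
      also have "x n = x (Suc n) + x (Suc n)" by (simp add: x_def)
      finally have le: "e t + c * (t - ?s) * e t powr \<alpha> \<le> x (Suc n) + x (Suc n)" .
      have "x (Suc n) = c * \<tau> n * x (Suc n) powr \<alpha>"
        using c x0[of "Suc n"] powr_add[of "x (Suc n)" "1 - \<alpha>" \<alpha>] by (simp add: \<tau>_def)
      also have "\<dots> \<le> c * (t - ?s) * e t powr \<alpha>"
        using c st \<tau>0[of n] gt x0[of "Suc n"] al by (intro mult_mono powr_mono2) auto
      finally show False using le gt by linarith
    qed
  qed
  have "e t = 0" if "T \<le> t" for t
  proof -
    have T0: "0 < T" unfolding T_def using \<tau>0[of 0] \<rho> by (intro add_pos_nonneg) auto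
    have "e t \<le> x n" for n using sum[of n] that unfolding T_def by (intro main) linarith
    moreover have "x \<longlonglongrightarrow> 0" unfolding x_def[abs_def] by real_asymp
    ultimately have "e t \<le> 0" by (intro LIMSEQ_le_const) auto
    then show ?thesis using nn[of t] that T0 by simp
  qed
  moreover have "0 < T" unfolding T_def using \<tau>0[of 0] \<rho> by (intro add_pos_nonneg) auto
  ultimately show ?thesis by blast
qed

text \<open>Up to the threshold \<open>l\<close> the power is at most \<open>l powr q\<close>; above
  it the exponent is raised to \<open>\<beta>\<close> at the cost of
  \<open>l powr (q - \<beta>)\<close>. Over a finite measure this does the work of Hoelder's
  inequality.\<close>

lemma young_threshold:
  fixes s l q \<beta> :: real
  assumes "0 < l" "0 < q" "q \<le> \<beta>"
  shows "\<bar>s\<bar> powr q \<le> l powr q + l powr (q - \<beta>) * \<bar>s\<bar> powr \<beta>"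
proof (cases "\<bar>s\<bar> \<le> l")
  case True
  then have "\<bar>s\<bar> powr q \<le> l powr q" using assms by (intro powr_mono2) auto
  then show ?thesis by (simp add: add_increasing2)
next
  case False
  then have "\<bar>s\<bar> powr (q - \<beta>) \<le> l powr (q - \<beta>)" using assms by (intro powr_mono2') auto
  then have "\<bar>s\<bar> powr (q - \<beta>) * \<bar>s\<bar> powr \<beta> \<le> l powr (q - \<beta>) * \<bar>s\<bar> powr \<beta>" by (rule mult_right_mono) simp
  then have "\<bar>s\<bar> powr q \<le> l powr (q - \<beta>) * \<bar>s\<bar> powr \<beta>" by (simp flip: powr_add)
  then show ?thesis by (simp add: add_increasing)
qed

section \<open>Removal of the truncation and extinction in finite time\<close>

context weak_flow_borel
begin

text \<open>The factor \<open>f\<close> is the \<open>p\<close>-th power of \<open>h\<close>, which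
  moves inside \<open>qnorm\<close> by homogeneity. With \<open>H'\<close> for \<open>h\<close>, the
  dissipation becomes the quantity that \<open>sobolev_truncated\<close> bounds from below.\<close>

lemma dissipation_eq_energy:
  assumes t: "AE x in lborel. x \<in> \<Omega> \<longrightarrow> Gh (t, x) = g x \<and> uh (t, x) = U x"
    and h: "\<And>x. 0 \<le> h x \<and> h x powr p = f x"
  shows "(\<integral>\<^sup>+x. ennreal (f (uh (t, x)) * N (t, x) powr p) \<partial>lborel) = energy (\<lambda>x. h (U x) *\<^sub>R g x)"
proof -
  have "energy (\<lambda>x. h (U x) *\<^sub>R g x) = energyh (\<lambda>x. h (uh (t, x)) *\<^sub>R Gh (t, x))"
    using t by (intro energyh_eq[symmetric]) (auto elim: eventually_mono)
  also have "\<dots> = (\<integral>\<^sup>+x. ennreal (f (uh (t, x)) * N (t, x) powr p) \<partial>lborel)"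
    unfolding energyh_def
  proof (rule nn_integral_cong_AE)
    show "AE x in lborel. ennreal (qnorm (Qh x) (h (uh (t, x)) *\<^sub>R Gh (t, x)) powr p) = ennreal (f (uh (t, x)) * N (t, x) powr p)"
      using AE_psd0
    proof eventually_elim
      case (elim x)
      have "qnorm (Qh x) (h (uh (t, x)) *\<^sub>R Gh (t, x)) powr p = h (uh (t, x)) powr p * N (t, x) powr p"
        using h[of "uh (t, x)"] psd0_qnorm(1,2)[OF elim] by (simp add: N_def powr_mult)
      then show ?case using h[of "uh (t, x)"] by simp
    qed
  qed
  finally show ?thesis ..
qed

text \<open>Each truncated energy \<open>E k\<close> obeys the energy inequality. Their lower limit
  is bounded by the initial data, decreases in time and is comparable with the integral of the
  \<open>q\<close>-th power of the solution; Sobolev and Fatou bound the dissipation below by a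
  power of it, and \<open>finite_extinction\<close> concludes.\<close>

lemma extinction_of_weak_flow:
  assumes S: "hyp_S \<Omega> Q v p \<sigma> Ms" and Ms: "0 < Ms" and \<sigma>: "1 < \<sigma>" and q: "2 \<le> q" and q\<sigma>: "q \<le> \<sigma> * (q - 2 + p)"
    and u0q: "(\<integral>\<^sup>+x. ennreal (\<bar>u0 x\<bar> powr q * v x) \<partial>M) < \<infinity>"
  shows "\<exists>T>0. \<forall>t\<ge>T. AE x in M. u t x = 0"
proof -
  \<comment> \<open>The exponent that the Sobolev inequality yields: \<open>H\<close> has size
    \<open>|s|^((q-2+p)/p)\<close>, and its power \<open>\<sigma> * p\<close> is integrated.\<close>
  define \<beta> where "\<beta> = \<sigma> * (q - 2 + p)"
  have \<beta>: "q \<le> \<beta>" "0 < \<beta>" using q q\<sigma> by (auto simp: \<beta>_def)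
  have "\<forall>k::nat. \<exists>F F' \<Phi> H H' C. is_cutoff q p (real (Suc k)) F F' \<Phi> H H' C"
    using cutoff_family[OF q p(1)] by simp
  then obtain F F' \<Phi> H H' C where cut: "\<And>k. is_cutoff q p (real (Suc k)) (F k) (F' k) (\<Phi> k) (H k) (H' k) (C k)"
    by metis
  note c = cut[unfolded is_cutoff_def]
  have F: "C1b (F k) (F' k)" "\<bar>F k x\<bar> \<le> C k" "0 \<le> F' k x" for k x using c[of k] by blast+
  have \<Phi>: "(\<Phi> k has_real_derivative F k x) (at x)" "\<Phi> k 0 = 0" "0 \<le> \<Phi> k x" "(C k)-lipschitz_on UNIV (\<Phi> k)" for k x
    using c[of k] by blast+
  have H: "C1b (H k) (H' k)" "0 \<le> H' k x \<and> H' k x powr p = F' k x" for k x using c[of k] by blast+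
  have \<Phi>ub: "\<Phi> k s \<le> \<bar>s\<bar> powr q" for k s using c[of k] by blast
  have \<Phi>lb: "\<bar>s\<bar> \<le> real (Suc k) \<Longrightarrow> (\<bar>s\<bar> / 4) powr q \<le> \<Phi> k s" for k s using c[of k] by blast
  have Hlb: "\<bar>s\<bar> \<le> real (Suc k) \<Longrightarrow> (\<bar>s\<bar> / 2) powr ((q - 2 + p) / p) \<le> \<bar>H k s\<bar>" for k s using c[of k] by blast
  have [measurable]: "F' k \<in> borel_measurable borel" "H k \<in> borel_measurable borel" "H' k \<in> borel_measurable borel" for k
    using C1b_measurable F(1) H(1) by blast+
  have [measurable]: "\<Phi> k \<in> borel_measurable borel" for k using \<Phi>(4) by (rule lipschitz_borel_measurable)
  have large: "\<forall>\<^sub>F k in sequentially. \<bar>s\<bar> \<le> real (Suc k)" for s :: real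
  proof -
    obtain k0 :: nat where k0: "\<bar>s\<bar> \<le> real k0" using real_arch_simple by blast
    have "\<bar>s\<bar> \<le> real (Suc k)" if "k0 \<le> k" for k
    proof -
      have "real k0 \<le> real (Suc k)" using that by linarith
      then show ?thesis using k0 by linarith
    qed
    then show ?thesis unfolding eventually_sequentially by blast
  qed
  define E where "E k t = (\<integral>x. \<Phi> k (u t x) * v x \<partial>M)" for k t
  define Z where "Z k t = (\<integral>\<^sup>+x. ennreal (F' k (uh (t, x)) * N (t, x) powr p) \<partial>lborel)" for k t
  have [measurable]: "Z k \<in> borel_measurable borel" for k unfolding Z_def[abs_def] by measurable
  have ineq: "(\<integral>\<^sup>+t. indicator {a..b} t * Z k t \<partial>lborel) + ennreal (E k b) \<le> ennreal (E k a)" if "0 < a" "a < b" for k a b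
    unfolding E_def Z_def by (rule energy_inequality[OF F(1) F(2) F(3) \<Phi> that])
  have E0: "0 \<le> E k t" for k t unfolding E_def using \<Phi>(3) v_nonneg by (intro integral_nonneg_AE AE_I2) auto
  have Emono: "E k b \<le> E k a" if "0 < a" "a \<le> b" for k a b
  proof (cases "a = b")
    case False
    then have "ennreal (E k b) \<le> ennreal (E k a)"
      using ineq[of a b k] that by (auto intro: order_trans[rotated] simp: add_increasing)
    then show ?thesis using E0 by simp
  qed simp
  have Enn: "ennreal (\<integral>x. \<Phi> k (U x) * v x \<partial>M) = (\<integral>\<^sup>+x. ennreal (\<Phi> k (U x) * v x) \<partial>M)"
    if "U \<in> borel_measurable M" "(\<integral>\<^sup>+x. ennreal ((U x)\<^sup>2 * v x) \<partial>M) < \<infinity>" for k U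
    using lipschitz_functional_integrable[OF that \<Phi>(4,2)] \<Phi>(3) v_nonneg
    by (intro nn_integral_eq_integral[symmetric] AE_I2) auto
  obtain K where K: "(\<integral>\<^sup>+x. ennreal (\<bar>u0 x\<bar> powr q * v x) \<partial>M) = ennreal K" "0 \<le> K"
    using u0q by (cases "\<integral>\<^sup>+x. ennreal (\<bar>u0 x\<bar> powr q * v x) \<partial>M") auto
  \<comment> \<open>By monotonicity \<open>E k t\<close> is at most the limit of \<open>E k\<close>
    at time 0, which is its value at \<open>u0\<close>; there \<open>\<Phi>\<close> is at most the
    \<open>q\<close>-th power.\<close>
  have EK: "E k t \<le> K" if t: "0 < t" for k t
  proof -
    have "((\<lambda>s. E k s) \<longlongrightarrow> (\<integral>x. \<Phi> k (u0 x) * v x \<partial>M)) (at_right 0)"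
      unfolding E_def
    proof (rule lipschitz_functional_continuous[OF u0_meas u0_L2 _ \<Phi>(4,2) u_init])
      have "\<forall>\<^sub>F s in at_right (0::real). 0 < s" by (simp add: eventually_at_right_less)
      then show "\<forall>\<^sub>F s in at_right 0. u s \<in> borel_measurable M \<and> (\<integral>\<^sup>+x. ennreal ((u s x)\<^sup>2 * v x) \<partial>M) < \<infinity>"
        by eventually_elim (use u_meas u_L2 in auto)
    qed
    moreover have "\<forall>\<^sub>F s in at_right 0. E k t \<le> E k s"
    proof -
      have "\<forall>\<^sub>F s in at_right (0::real). s < t" using t by (intro order_tendstoD(2)[OF tendsto_ident_at])
      moreover have "\<forall>\<^sub>F s in at_right (0::real). 0 < s" by (simp add: eventually_at_right_less)
      ultimately show ?thesis by eventually_elim (use Emono in auto)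
    qed
    ultimately have le: "E k t \<le> (\<integral>x. \<Phi> k (u0 x) * v x \<partial>M)" by (intro tendsto_lowerbound) auto
    have "ennreal (\<integral>x. \<Phi> k (u0 x) * v x \<partial>M) \<le> ennreal K"
      unfolding Enn[OF u0_meas u0_L2] K(1)[symmetric]
      using \<Phi>ub v_nonneg by (intro nn_integral_mono ennreal_leI mult_right_mono) auto
    then show ?thesis using le K(2) by simp
  qed
  \<comment> \<open>The lower limit fits Fatou's lemma directly. It lies between the integrals of
    \<open>(\<bar>u t x\<bar> / 4) powr q\<close> and
    \<open>\<bar>u t x\<bar> powr q\<close>.\<close>
  define ei where "ei t = liminf (\<lambda>k. ennreal (E k t))" for t
  have eiK: "ei t \<le> ennreal K" if "0 < t" for t
  proof -
    have "ei t \<le> limsup (\<lambda>k. ennreal (E k t))" unfolding ei_def by (rule Liminf_le_Limsup) simp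
    also have "\<dots> \<le> ennreal K" using EK[OF that] by (intro Limsup_bounded always_eventually allI ennreal_leI)
    finally show ?thesis .
  qed
  define e where "e t = enn2real (ei t)" for t
  have e: "ei t = ennreal (e t)" "0 \<le> e t" "e t \<le> K" if "0 < t" for t
  proof -
    have "ei t < top" using eiK[OF that] by (auto intro: le_less_trans)
    then show *: "ei t = ennreal (e t)" by (simp add: e_def)
    show "0 \<le> e t" by (simp add: e_def)
    show "e t \<le> K" using eiK[OF that] K(2) unfolding * by simp
  qed
  have ei_lower: "(\<integral>\<^sup>+x. ennreal ((\<bar>u t x\<bar> / 4) powr q * v x) \<partial>M) \<le> ei t" if t: "0 < t" for t
  proof -
    have um[measurable]: "u t \<in> borel_measurable M" using t by (intro u_meas) simp
    have "(\<integral>\<^sup>+x. ennreal ((\<bar>u t x\<bar> / 4) powr q * v x) \<partial>M) \<le> (\<integral>\<^sup>+x. liminf (\<lambda>k. ennreal (\<Phi> k (u t x) * v x)) \<partial>M)"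
    proof (rule nn_integral_mono)
      fix x assume "x \<in> space M"
      then have v0: "0 \<le> v x" using v_nonneg by simp
      have "\<forall>\<^sub>F k in sequentially. ennreal ((\<bar>u t x\<bar> / 4) powr q * v x) \<le> ennreal (\<Phi> k (u t x) * v x)"
        using large[of "u t x"] by eventually_elim (intro ennreal_leI mult_right_mono \<Phi>lb v0)
      then show "ennreal ((\<bar>u t x\<bar> / 4) powr q * v x) \<le> liminf (\<lambda>k. ennreal (\<Phi> k (u t x) * v x))" by (rule Liminf_bounded)
    qed
    also have "\<dots> \<le> liminf (\<lambda>k. \<integral>\<^sup>+x. ennreal (\<Phi> k (u t x) * v x) \<partial>M)" by (rule nn_integral_liminf) measurable
    also have "\<dots> = ei t" unfolding ei_def E_def using t by (subst Enn[OF um u_L2]) auto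
    finally show ?thesis .
  qed
  have ei_upper: "ei t \<le> (\<integral>\<^sup>+x. ennreal (\<bar>u t x\<bar> powr q * v x) \<partial>M)" if t: "0 < t" for t
  proof -
    have um[measurable]: "u t \<in> borel_measurable M" using t by (intro u_meas) simp
    have "ennreal (E k t) \<le> (\<integral>\<^sup>+x. ennreal (\<bar>u t x\<bar> powr q * v x) \<partial>M)" for k
      unfolding E_def Enn[OF um u_L2[OF less_imp_le[OF t]]]
      using \<Phi>ub v_nonneg by (intro nn_integral_mono ennreal_leI mult_right_mono) auto
    then have "limsup (\<lambda>k. ennreal (E k t)) \<le> (\<integral>\<^sup>+x. ennreal (\<bar>u t x\<bar> powr q * v x) \<partial>M)"
      by (intro Limsup_bounded always_eventually allI)
    moreover have "ei t \<le> limsup (\<lambda>k. ennreal (E k t))" unfolding ei_def by (rule Liminf_le_Limsup) simp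
    ultimately show ?thesis by (rule order_trans[rotated])
  qed
  have e_mono: "e b \<le> e a" if "0 < a" "a \<le> b" for a b
  proof -
    have "ei b \<le> ei a" unfolding ei_def using Emono[OF that] by (intro Liminf_mono always_eventually allI ennreal_leI)
    then show ?thesis using e[of a] e[of b] that by simp
  qed
  obtain V where V: "(\<integral>\<^sup>+x. ennreal (v x) \<partial>M) = ennreal V" "0 \<le> V"
    using v_nn_finite by (cases "\<integral>\<^sup>+x. ennreal (v x) \<partial>M") auto
  define X where "X t = (\<integral>\<^sup>+x. ennreal ((\<bar>u t x\<bar> / 2) powr \<beta> * v x) \<partial>M)" for t
  \<comment> \<open>One half is lost in absorbing the part of the solution below the threshold,
    another half buys strict inequality, \<open>2 powr (- \<beta>)\<close> comes from the argument
    \<open>\<bar>u t x\<bar> / 2\<close>, and the last factor from the threshold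
    \<open>l\<close>.\<close>
  define c1 where "c1 = 1 / 4 * 2 powr (- \<beta>) * (1 / (2 * (V + 1))) powr ((\<beta> - q) / q)"
  have c1: "0 < c1" using V by (simp add: c1_def)
  \<comment> \<open>Equal to \<open>\<beta> / (\<sigma> * q)\<close>: the exponent
    \<open>\<beta> / q\<close> of \<open>X_lower\<close> after the \<open>\<sigma>\<close>-th root
    in the Sobolev inequality.\<close>
  define \<alpha> where "\<alpha> = (q - 2 + p) / q"
  have \<alpha>: "0 < \<alpha>" "\<alpha> < 1" using q p by (auto simp: \<alpha>_def)
  \<comment> \<open>Obtained by solving the inequality of \<open>sobolev_truncated\<close>, with
    left-hand side \<open>c1 * eb powr (\<beta> / q)\<close>, for the dissipation.\<close>
  define cc where "cc = (c1 / Ms powr (\<sigma> * p)) powr (1 / \<sigma>) / 2 powr p"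
  have cc: "0 < cc" using c1 Ms by (simp add: cc_def)
  \<comment> \<open>Strict, so that after Fatou's lemma the bound holds for all sufficiently large
    \<open>k\<close> and not merely in the limit.\<close>
  have X_lower: "ennreal (c1 * eb powr (\<beta> / q)) < X t" if t: "0 < t" and eb: "0 < eb" "eb \<le> e t" for t eb
  proof -
    have um[measurable]: "u t \<in> borel_measurable M" using t by (intro u_meas) simp
    \<comment> \<open>With this threshold the values below it contribute at most
      \<open>eb / 2\<close>; \<open>V + 1\<close> avoids division by zero.\<close>
    define l where "l = (eb / (2 * (V + 1))) powr (1 / q)"
    have l0: "0 < l" using eb V by (simp add: l_def)
    have lq: "l powr q = eb / (2 * (V + 1))" using eb V q by (simp add: l_def powr_powr)
    have "ennreal eb \<le> (\<integral>\<^sup>+x. ennreal (\<bar>u t x\<bar> powr q * v x) \<partial>M)"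
      using ei_upper[OF t] e(1)[OF t] eb by (auto intro: order_trans[rotated] simp: ennreal_leI)
    also have "\<dots> \<le> (\<integral>\<^sup>+x. ennreal (l powr q) * ennreal (v x) + ennreal (l powr (q - \<beta>) * 2 powr \<beta>) * ennreal ((\<bar>u t x\<bar> / 2) powr \<beta> * v x) \<partial>M)"
    proof (rule nn_integral_mono)
      fix x assume "x \<in> space M"
      then have v0: "0 \<le> v x" using v_nonneg by simp
      have "\<bar>u t x\<bar> powr q * v x \<le> (l powr q + l powr (q - \<beta>) * \<bar>u t x\<bar> powr \<beta>) * v x"
        using v0 l0 q \<beta> by (intro mult_right_mono young_threshold) auto
      also have "\<bar>u t x\<bar> powr \<beta> = 2 powr \<beta> * (\<bar>u t x\<bar> / 2) powr \<beta>" by (simp flip: powr_mult)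
      finally have "\<bar>u t x\<bar> powr q * v x \<le> l powr q * v x + (l powr (q - \<beta>) * 2 powr \<beta>) * ((\<bar>u t x\<bar> / 2) powr \<beta> * v x)"
        by (simp add: algebra_simps)
      then have "ennreal (\<bar>u t x\<bar> powr q * v x) \<le> ennreal (l powr q * v x + (l powr (q - \<beta>) * 2 powr \<beta>) * ((\<bar>u t x\<bar> / 2) powr \<beta> * v x))"
        by (rule ennreal_leI)
      also have "\<dots> = ennreal (l powr q * v x) + ennreal ((l powr (q - \<beta>) * 2 powr \<beta>) * ((\<bar>u t x\<bar> / 2) powr \<beta> * v x))"
        using v0 by (intro ennreal_plus) auto
      also have "ennreal (l powr q * v x) = ennreal (l powr q) * ennreal (v x)" using v0 by (intro ennreal_mult) auto
      also have "ennreal ((l powr (q - \<beta>) * 2 powr \<beta>) * ((\<bar>u t x\<bar> / 2) powr \<beta> * v x)) =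
        ennreal (l powr (q - \<beta>) * 2 powr \<beta>) * ennreal ((\<bar>u t x\<bar> / 2) powr \<beta> * v x)" using v0 by (intro ennreal_mult) auto
      finally show "ennreal (\<bar>u t x\<bar> powr q * v x) \<le> ennreal (l powr q) * ennreal (v x) + ennreal (l powr (q - \<beta>) * 2 powr \<beta>) * ennreal ((\<bar>u t x\<bar> / 2) powr \<beta> * v x)" .
    qed
    also have "\<dots> = ennreal (l powr q) * ennreal V + ennreal (l powr (q - \<beta>) * 2 powr \<beta>) * X t"
      unfolding X_def V(1)[symmetric] by (subst nn_integral_add) (auto simp: nn_integral_cmult)
    finally have main: "ennreal eb \<le> ennreal (l powr q) * ennreal V + ennreal (l powr (q - \<beta>) * 2 powr \<beta>) * X t" .
    show ?thesis
    proof (cases "X t")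
      case (real xr)
      have "eb \<le> l powr q * V + l powr (q - \<beta>) * 2 powr \<beta> * xr"
      proof -
        have "ennreal (l powr q) * ennreal V + ennreal (l powr (q - \<beta>) * 2 powr \<beta>) * X t = ennreal (l powr q * V + l powr (q - \<beta>) * 2 powr \<beta> * xr)"
          using real V by (subst ennreal_plus) (auto simp: ennreal_mult)
        with main have "ennreal eb \<le> ennreal (l powr q * V + l powr (q - \<beta>) * 2 powr \<beta> * xr)" by (simp only:)
        moreover have "0 \<le> l powr q * V + l powr (q - \<beta>) * 2 powr \<beta> * xr" using real V by simp
        ultimately show ?thesis by (simp only: ennreal_le_iff)
      qed
      moreover have "l powr q * V \<le> eb / 2"
      proof -
        have "eb * (V / (V + 1)) \<le> eb" using eb V by (intro mult_left_le) auto
        then have "eb * (V / (V + 1)) / 2 \<le> eb / 2" by (rule divide_right_mono) simp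
        moreover have "eb / (2 * (V + 1)) * V = eb * (V / (V + 1)) / 2" by simp
        ultimately show ?thesis unfolding lq by (simp only:)
      qed
      ultimately have 1: "eb / 2 \<le> l powr (q - \<beta>) * 2 powr \<beta> * xr" by linarith
      have lb: "l powr (\<beta> - q) = eb powr ((\<beta> - q) / q) * (1 / (2 * (V + 1))) powr ((\<beta> - q) / q)"
      proof -
        have "l powr (\<beta> - q) = (eb * (1 / (2 * (V + 1)))) powr ((\<beta> - q) / q)" by (simp add: l_def powr_powr)
        also have "\<dots> = eb powr ((\<beta> - q) / q) * (1 / (2 * (V + 1))) powr ((\<beta> - q) / q)" by (rule powr_mult)
        finally show ?thesis .
      qed
      have "eb / 2 * (l powr (\<beta> - q) * 2 powr (- \<beta>)) \<le> l powr (q - \<beta>) * 2 powr \<beta> * xr * (l powr (\<beta> - q) * 2 powr (- \<beta>))"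
        using 1 by (rule mult_right_mono) simp
      also have "\<dots> = (l powr (q - \<beta>) * l powr (\<beta> - q)) * (2 powr \<beta> * 2 powr (- \<beta>)) * xr" by (simp add: mult_ac)
      also have "\<dots> = xr" using l0 by (simp flip: powr_add)
      finally have 2: "eb / 2 * (l powr (\<beta> - q) * 2 powr (- \<beta>)) \<le> xr" .
      have "eb powr (\<beta> / q) = eb * eb powr ((\<beta> - q) / q)"
      proof -
        have "\<beta> / q = 1 + (\<beta> - q) / q" using q by (simp add: field_simps)
        then show ?thesis using powr_add[of eb 1 "(\<beta> - q) / q"] eb by simp
      qed
      then have "2 * (c1 * eb powr (\<beta> / q)) = eb / 2 * (l powr (\<beta> - q) * 2 powr (- \<beta>))"
        unfolding lb c1_def by simp
      then have "2 * (c1 * eb powr (\<beta> / q)) \<le> xr" using 2 by simp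
      moreover have "0 < c1 * eb powr (\<beta> / q)" using c1 eb by simp
      ultimately have "c1 * eb powr (\<beta> / q) < xr" by linarith
      then show ?thesis using real \<open>0 < c1 * eb powr (\<beta> / q)\<close> by (simp add: ennreal_less_iff)
    qed simp
  qed
  \<comment> \<open>On an interval \<open>{a..b}\<close> this is used with \<open>eb = e b\<close>,
    which is at most \<open>e t\<close> throughout by monotonicity. Keeping \<open>eb\<close> inside
    the \<open>AE\<close> makes the null set independent of it.\<close>
  have Z_lower: "AE t in lborel. 0 < t \<longrightarrow> (\<forall>eb. 0 < eb \<and> eb \<le> e t \<longrightarrow> ennreal (cc * eb powr \<alpha>) \<le> liminf (\<lambda>k. Z k t))"
    using AE_good
  proof eventually_elim
    case (elim t)
    show ?case
    proof (intro impI allI)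
      fix eb assume t: "0 < t" and eb: "0 < eb \<and> eb \<le> e t"
      have ug: "(u t, G t) \<in> H0 \<Omega> Q v p" and ht: "AE x in lborel. x \<in> \<Omega> \<longrightarrow> Gh (t, x) = G t x \<and> uh (t, x) = u t x"
        using elim t by auto
      have [measurable]: "u t \<in> borel_measurable M" "G t \<in> borel_measurable M" using H0_D[OF ug] by blast+
      have Zen: "Z k t = energy (\<lambda>x. H' k (u t x) *\<^sub>R G t x)" for k
        unfolding Z_def by (rule dissipation_eq_energy[OF ht H(2)])
      have Zfin: "Z k t < top" for k
      proof -
        obtain B where "0 \<le> B" "\<And>x. \<bar>H' k x\<bar> \<le> B" using C1b_lipschitz[OF H(1)] by blast
        then show ?thesis unfolding Zen using energy_mult_finite[OF _ _ _ _ H0_D(3)[OF ug], of "\<lambda>x. H' k (u t x)" B] by simp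
      qed
      let ?W = "\<lambda>k. \<integral>\<^sup>+x. ennreal (\<bar>H k (u t x)\<bar> powr (\<sigma> * p) * v x) \<partial>M"
      have "X t \<le> (\<integral>\<^sup>+x. liminf (\<lambda>k. ennreal (\<bar>H k (u t x)\<bar> powr (\<sigma> * p) * v x)) \<partial>M)"
        unfolding X_def
      proof (rule nn_integral_mono)
        fix x assume "x \<in> space M"
        then have v0: "0 \<le> v x" using v_nonneg by simp
        have "\<forall>\<^sub>F k in sequentially. ennreal ((\<bar>u t x\<bar> / 2) powr \<beta> * v x) \<le> ennreal (\<bar>H k (u t x)\<bar> powr (\<sigma> * p) * v x)"
          using large[of "u t x"]
        proof eventually_elim
          case (elim k)
          have "(\<bar>u t x\<bar> / 2) powr \<beta> = ((\<bar>u t x\<bar> / 2) powr ((q - 2 + p) / p)) powr (\<sigma> * p)"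
            using p by (simp add: powr_powr \<beta>_def mult.commute)
          also have "\<dots> \<le> \<bar>H k (u t x)\<bar> powr (\<sigma> * p)" using Hlb[OF elim] \<sigma> p by (intro powr_mono2) auto
          finally show ?case using v0 by (intro ennreal_leI mult_right_mono)
        qed
        then show "ennreal ((\<bar>u t x\<bar> / 2) powr \<beta> * v x) \<le> liminf (\<lambda>k. ennreal (\<bar>H k (u t x)\<bar> powr (\<sigma> * p) * v x))" by (rule Liminf_bounded)
      qed
      also have "\<dots> \<le> liminf ?W" by (rule nn_integral_liminf) measurable
      finally have "X t \<le> liminf ?W" .
      then have "ennreal (c1 * eb powr (\<beta> / q)) < liminf ?W" using X_lower[OF t] eb by (auto intro: less_le_trans)
      then have "\<forall>\<^sub>F k in sequentially. ennreal (c1 * eb powr (\<beta> / q)) < ?W k" by (rule less_LiminfD)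
      then have "\<forall>\<^sub>F k in sequentially. ennreal (cc * eb powr \<alpha>) \<le> Z k t"
      proof eventually_elim
        case (elim k)
        let ?z = "enn2real (Z k t)"
        let ?A = "c1 * eb powr (\<beta> / q)"
        note elim
        also have "?W k \<le> ennreal (Ms powr (\<sigma> * p) * (2 powr p * ?z) powr \<sigma>)"
          unfolding Zen by (rule sobolev_truncated[OF S \<sigma> Ms ug H(1)])
        finally have "?A < Ms powr (\<sigma> * p) * (2 powr p * ?z) powr \<sigma>"
          using c1 eb by (subst (asm) ennreal_less_iff) auto
        then have "?A / Ms powr (\<sigma> * p) \<le> (2 powr p * ?z) powr \<sigma>" using Ms by (simp add: pos_divide_le_eq mult.commute)
        then have "(?A / Ms powr (\<sigma> * p)) powr (1 / \<sigma>) \<le> ((2 powr p * ?z) powr \<sigma>) powr (1 / \<sigma>)"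
          using c1 eb \<sigma> by (intro powr_mono2) auto
        also have "\<dots> = 2 powr p * ?z" using \<sigma> by (simp add: powr_powr)
        finally have 1: "(?A / Ms powr (\<sigma> * p)) powr (1 / \<sigma>) / 2 powr p \<le> ?z" by (simp add: pos_divide_le_eq mult.commute)
        have "(?A / Ms powr (\<sigma> * p)) powr (1 / \<sigma>) = (c1 / Ms powr (\<sigma> * p) * eb powr (\<beta> / q)) powr (1 / \<sigma>)" by simp
        also have "\<dots> = (c1 / Ms powr (\<sigma> * p)) powr (1 / \<sigma>) * (eb powr (\<beta> / q)) powr (1 / \<sigma>)"
          by (rule powr_mult)
        also have "(eb powr (\<beta> / q)) powr (1 / \<sigma>) = eb powr \<alpha>"
          using \<sigma> by (simp add: powr_powr \<beta>_def \<alpha>_def)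
        finally have "cc * eb powr \<alpha> \<le> ?z" using 1 by (simp add: cc_def)
        then have "ennreal (cc * eb powr \<alpha>) \<le> ennreal ?z" by (rule ennreal_leI)
        then show ?case using Zfin[of k] by simp
      qed
      then show "ennreal (cc * eb powr \<alpha>) \<le> liminf (\<lambda>k. Z k t)" by (rule Liminf_bounded)
    qed
  qed
  have "\<exists>T>0. \<forall>t\<ge>T. e t = 0"
  proof (rule finite_extinction[of e K cc \<alpha>])
    show "0 < cc" "0 < \<alpha>" "\<alpha> < 1" by fact+
    show "0 \<le> e t" "e t \<le> K" if "0 < t" for t using e[OF that] by blast+
    fix a b assume ab: "0 < a" "a < b" and eb: "0 < e b"
    let ?y = "cc * e b powr \<alpha>"
    have y0: "0 < ?y" using cc eb by simp
    let ?I = "\<lambda>k. \<integral>\<^sup>+t. indicator {a..b} t * Z k t \<partial>lborel"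
    have "ennreal ((b - a) * ?y) = (\<integral>\<^sup>+t. indicator {a..b} t * ennreal ?y \<partial>lborel)"
      using ab y0 by (subst nn_integral_multc) (auto simp: ennreal_mult)
    \<comment> \<open>The constant lower bound holds for the lower limit at almost every time;
      Fatou's lemma, now in time, carries it to the integrated dissipations.\<close>
    also have "\<dots> \<le> (\<integral>\<^sup>+t. liminf (\<lambda>k. indicator {a..b} t * Z k t) \<partial>lborel)"
    proof (rule nn_integral_mono_AE)
      show "AE t in lborel. indicator {a..b} t * ennreal ?y \<le> liminf (\<lambda>k. indicator {a..b} t * Z k t)"
        using Z_lower
      proof eventually_elim
        case (elim t)
        show ?case
        proof (cases "t \<in> {a..b}")
          case True
          then have "0 < t" "e b \<le> e t" using ab by (auto intro: e_mono)
          then show ?thesis using elim eb True by simp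
        qed simp
      qed
    qed
    also have "\<dots> \<le> liminf ?I" by (rule nn_integral_liminf) measurable
    finally have Il: "ennreal ((b - a) * ?y) \<le> liminf ?I" .
    \<comment> \<open>For large \<open>k\<close> the dissipation exceeds
      \<open>(b - a) * ?y - d / 2\<close> and \<open>E k b\<close> exceeds
      \<open>e b - d / 2\<close>, so both bounds can be inserted into the energy inequality at the
      same level.\<close>
    have "e b + (b - a) * ?y \<le> e a + d" if d: "0 < d" for d
    proof -
      have by0: "0 < (b - a) * ?y" using ab y0 by simp
      have "ennreal ((b - a) * ?y - d / 2) < ennreal ((b - a) * ?y)" using d by0 by (intro ennreal_lessI) auto
      then have "ennreal ((b - a) * ?y - d / 2) < liminf ?I" using Il by (rule less_le_trans)
      then have 1: "\<forall>\<^sub>F k in sequentially. ennreal ((b - a) * ?y - d / 2) < ?I k" by (rule less_LiminfD)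
      have "ennreal (e b - d / 2) < ennreal (e b)" using d eb by (intro ennreal_lessI) auto
      also have "\<dots> = ei b" using e(1)[of b] ab by simp
      finally have "ennreal (e b - d / 2) < liminf (\<lambda>k. ennreal (E k b))" by (simp add: ei_def)
      then have 2: "\<forall>\<^sub>F k in sequentially. ennreal (e b - d / 2) < ennreal (E k b)" by (rule less_LiminfD)
      from 1 2 have "\<forall>\<^sub>F k in sequentially. ennreal (e b + (b - a) * ?y - d) \<le> ennreal (E k a)"
      proof eventually_elim
        case (elim k)
        have "ennreal (e b + (b - a) * ?y - d) \<le> ennreal (max 0 ((b - a) * ?y - d / 2) + max 0 (e b - d / 2))"
          by (intro ennreal_leI) (auto simp: max_def)
        also have "\<dots> = ennreal ((b - a) * ?y - d / 2) + ennreal (e b - d / 2)"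
          by (subst ennreal_plus) (auto simp: max_def ennreal_neg)
        also have "\<dots> \<le> ?I k + ennreal (E k b)" using elim by (intro add_mono) auto
        also have "\<dots> \<le> ennreal (E k a)" using ineq[OF ab] .
        finally show ?case .
      qed
      then have "ennreal (e b + (b - a) * ?y - d) \<le> ei a" unfolding ei_def by (rule Liminf_bounded)
      then show ?thesis using e(1,2)[OF ab(1)] by simp
    qed
    then have "e b + (b - a) * ?y \<le> e a" by (rule field_le_epsilon)
    then show "e b + cc * (b - a) * e b powr \<alpha> \<le> e a" by (simp add: mult_ac)
  qed
  then obtain T where T: "0 < T" "\<And>t. T \<le> t \<Longrightarrow> e t = 0" by blast
  have "AE x in M. u t x = 0" if "T \<le> t" for t
  proof -
    have t: "0 < t" using that T(1) by simp
    have [measurable]: "u t \<in> borel_measurable M" using t by (intro u_meas) simp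
    have "(\<integral>\<^sup>+x. ennreal ((\<bar>u t x\<bar> / 4) powr q * v x) \<partial>M) = 0"
      using ei_lower[OF t] e(1)[OF t] T(2)[OF that] by simp
    then have "AE x in M. ennreal ((\<bar>u t x\<bar> / 4) powr q * v x) = 0" by (subst (asm) nn_integral_0_iff_AE) measurable
    then show ?thesis using AE_v_pos
    proof eventually_elim
      case (elim x)
      then have "(\<bar>u t x\<bar> / 4) powr q * v x \<le> 0" by (simp add: ennreal_eq_0_iff)
      moreover have "0 < (\<bar>u t x\<bar> / 4) powr q * v x" if "u t x \<noteq> 0" using that elim by simp
      ultimately show ?case by fastforce
    qed
  qed
  then show ?thesis using T(1) by blast
qed

end

theorem theorem2p16:
  fixes \<Omega> :: "(real^'n) set"
    and Q :: "real^'n \<Rightarrow> real^'n^'n"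
    and v :: "real^'n \<Rightarrow> real"
    and p \<sigma> M m :: real
    and u0 :: "real^'n \<Rightarrow> real"
    and u :: "real \<Rightarrow> real^'n \<Rightarrow> real"
    and G :: "real \<Rightarrow> real^'n \<Rightarrow> real^'n"
  assumes "CARD('n) \<ge> 3"
    and "open \<Omega>" and "connected \<Omega>" and "\<Omega> \<noteq> {}" and "bounded \<Omega>"
    and "1 < p" and "p < 2"
    and "hyp_H \<Omega> Q v p"
    and "0 < M" and "1 < \<sigma>"
    and "hyp_S \<Omega> Q v p \<sigma> M"
    and "m = max 2 ((\<sigma> / (\<sigma> - 1)) * (2 - p))"
    and "u0 \<in> borel_measurable (lebesgue_on \<Omega>)"
    and "(\<integral>\<^sup>+ x. ennreal (\<bar>u0 x\<bar> powr m * v x) \<partial>lebesgue_on \<Omega>) < \<infinity>"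
    and "\<forall>T>0. weak_solution \<Omega> Q v p u0 T u G"
  shows "\<exists>T0>0. \<forall>t\<ge>T0. AE x in lebesgue_on \<Omega>. u t x = 0"
proof -
  interpret degenerate_weight \<Omega> Q v p using assms by unfold_locales auto
  have Om: "\<Omega> \<in> sets borel" using assms(2) by simp
  have sol: "weak_solution \<Omega> Q v p u0 T u G" if "0 < T" for T using assms(15) that by blast
  obtain Qh where Qh: "Qh \<in> borel_measurable borel" "AE x in lborel. x \<in> \<Omega> \<longrightarrow> Qh x = Q x" "\<And>x. x \<notin> \<Omega> \<Longrightarrow> Qh x = 0"
    using lebesgue_on_ex_borel[OF Q_meas Om] by blast
  have joint: "(\<lambda>(t, x). u t x) \<in> borel_measurable (lebesgue_on ({0..T} \<times> \<Omega>))"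
    "(\<lambda>(t, x). G t x) \<in> borel_measurable (lebesgue_on ({0..T} \<times> \<Omega>))" if "0 < T" for T
    using sol[OF that] by (simp_all add: weak_solution_def)
  obtain Gh where Gh: "Gh \<in> borel_measurable borel" "AE z in lborel. 0 \<le> fst z \<and> snd z \<in> \<Omega> \<longrightarrow> Gh z = G (fst z) (snd z)"
    "\<And>t x. t < 0 \<or> x \<notin> \<Omega> \<Longrightarrow> Gh (t, x) = 0"
  proof (rule lebesgue_on_times_ex_borel[of G \<Omega>])
    show "(\<lambda>(t, x). G t x) \<in> borel_measurable (lebesgue_on ({0..T} \<times> \<Omega>))" if "0 < T" for T
      using that by (rule joint(2))
    fix g assume "g \<in> borel_measurable borel" "AE z in lborel. 0 \<le> fst z \<and> snd z \<in> \<Omega> \<longrightarrow> g z = G (fst z) (snd z)"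
      "\<And>t x. t < 0 \<or> x \<notin> \<Omega> \<Longrightarrow> g (t, x) = 0"
    then show thesis by (intro that[of g])
  qed (rule Om)
  obtain uh where uh: "uh \<in> borel_measurable borel" "AE z in lborel. 0 \<le> fst z \<and> snd z \<in> \<Omega> \<longrightarrow> uh z = u (fst z) (snd z)"
  proof (rule lebesgue_on_times_ex_borel[of u \<Omega>])
    show "(\<lambda>(t, x). u t x) \<in> borel_measurable (lebesgue_on ({0..T} \<times> \<Omega>))" if "0 < T" for T
      using that by (rule joint(1))
    fix g assume "g \<in> borel_measurable borel" "AE z in lborel. 0 \<le> fst z \<and> snd z \<in> \<Omega> \<longrightarrow> g z = u (fst z) (snd z)"
      "\<And>t x. t < 0 \<or> x \<notin> \<Omega> \<Longrightarrow> g (t, x) = 0"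
    then show thesis by (intro that[of g])
  qed (rule Om)
  have m2: "2 \<le> m" using assms(12) by simp
  \<comment> \<open>Since \<open>m \<ge> 2\<close>, the square is at most 1 plus the
    \<open>m\<close>-th power, and \<open>v\<close> is integrable; hence the initial datum lies in
    \<open>L^2_v\<close>.\<close>
  have "(\<integral>\<^sup>+x. ennreal ((u0 x)\<^sup>2 * v x) \<partial>lebesgue_on \<Omega>) \<le> (\<integral>\<^sup>+x. ennreal (v x) + ennreal (\<bar>u0 x\<bar> powr m * v x) \<partial>lebesgue_on \<Omega>)"
  proof (rule nn_integral_mono)
    fix x assume "x \<in> space (lebesgue_on \<Omega>)"
    then have v0: "0 \<le> v x" using v_nonneg by simp
    have "(u0 x)\<^sup>2 \<le> 1 + \<bar>u0 x\<bar> powr m"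
      using young_threshold[of 1 2 m "u0 x"] m2 by (cases "u0 x = 0") auto
    then have "(u0 x)\<^sup>2 * v x \<le> v x + \<bar>u0 x\<bar> powr m * v x"
      using mult_right_mono[OF _ v0] by (fastforce simp: distrib_right)
    then have "ennreal ((u0 x)\<^sup>2 * v x) \<le> ennreal (v x + \<bar>u0 x\<bar> powr m * v x)" by (rule ennreal_leI)
    also have "\<dots> = ennreal (v x) + ennreal (\<bar>u0 x\<bar> powr m * v x)" using v0 by (intro ennreal_plus) auto
    finally show "ennreal ((u0 x)\<^sup>2 * v x) \<le> ennreal (v x) + ennreal (\<bar>u0 x\<bar> powr m * v x)" .
  qed
  also have "\<dots> = (\<integral>\<^sup>+x. ennreal (v x) \<partial>lebesgue_on \<Omega>) + (\<integral>\<^sup>+x. ennreal (\<bar>u0 x\<bar> powr m * v x) \<partial>lebesgue_on \<Omega>)"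
    using assms(13) v_meas by (intro nn_integral_add) measurable
  also have "\<dots> < \<infinity>" using v_nn_finite assms(14) by simp
  finally have u0L2: "(\<integral>\<^sup>+x. ennreal ((u0 x)\<^sup>2 * v x) \<partial>lebesgue_on \<Omega>) < \<infinity>" .
  interpret weak_flow_borel \<Omega> Q v p u0 u G Qh Gh uh
    using assms(13) u0L2 sol Qh Gh uh by unfold_locales auto
  \<comment> \<open>This is \<open>m \<ge> q_c\<close> cleared of the denominator
    \<open>\<sigma> - 1\<close>.\<close>
  have "m \<le> \<sigma> * (m - 2 + p)"
  proof -
    have "\<sigma> * (2 - p) / (\<sigma> - 1) \<le> m" using assms(12) by simp
    then have "\<sigma> * (2 - p) \<le> m * (\<sigma> - 1)" using assms(10) by (simp add: pos_divide_le_eq)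
    then show ?thesis by (simp add: algebra_simps)
  qed
  then show ?thesis by (rule extinction_of_weak_flow[OF assms(11,9,10) m2 _ assms(14)])
qed

end
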